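(* Supersymmetry compatible connections exist on any super-null Riemannian manifold: if $(M,g,Q,P)$ is a super-null Riemannian manifold, then there exists an affine connection $\nabla$ on $M$ such that $\nabla_XQ=0$ for all $X\in\mathrm{Vect}(M)$.
   Context: Supermanifolds are real, finite-dimensional, in the Berezin–Leites (locally ringed space) sense, $M=(|M|,\mathcal{O}_M)$; $C^\infty(M)$ is the superalgebra of global functions, $\mathrm{Vect}(M)$ the $C^\infty(M)$-module of vector fields, $\widetilde{\cdot}$ denotes $\mathbb{Z}_2$-parity, and $[X,Y]=XY-(-1)^{\widetilde X\widetilde Y}YX$ is the graded commutator. A metric $g$ on $M$ is an even, graded-symmetric, rank 2 covariant tensor, possibly degenerate; it determines a pairing $\langle X|Y\rangle$ with $\widetilde{\langle X|Y\rangle}=\widetilde X+\widetilde Y$, $\langle X|Y\rangle=(-1)^{\widetilde X\widetilde Y}\langle Y|X\rangle$, $\langle fX+Y|Z\rangle=f\langle X|Z\rangle+\langle Y|Z\rangle$. Its kernel is $\ker(g)=\{X\in\mathrm{Vect}(M) : \langle X|Y\rangle=0\ \text{for all } Y\in\mathrm{Vect}(M)\}$; $g$ is degenerate if $\ker(g)\neq\{0\}$. A super-null Riemannian manifold is a quadruple $(M,g,Q,P)$ where $M$ is a supermanifold of dimension $n|1$ ($n\ge 1$), $g$ is a degenerate (even) metric on $M$, $Q\in\mathrm{Vect}(M)$ is a non-singular odd vector field (i.e. its value in $T_mM$ is nonzero at every point $m\in|M|$) with $[Q,Q]=2P$ for an even vector field $P$, and $\ker(g)=\mathrm{Span}\{Q\}$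 (the $C^\infty(M)$-span). It is part of the setting that the rank of the kernel is constant, equal to $0|1$ (at every point $m\in |M|$ the bilinear form induced by $g$ on $T_mM$ has kernel of dimension $0|1$), and that around every point of $|M|$ there are Shander coordinates $(x^a,t,\tau)$, with $x^a,t$ even and $\tau$ odd, in which $Q=\partial_\tau+\tau\partial_t$ and $P=\partial_t$. An affine connection on $M$ is a parity-preserving map $\nabla:\mathrm{Vect}(M)\times\mathrm{Vect}(M)\to\mathrm{Vect}(M)$, $(X,Y)\mapsto\nabla_XY$, that is biadditive, satisfies $\nabla_{fX}Y=f\nabla_XY$ and $\nabla_X(fY)=X(f)Y+(-1)^{\widetilde X\widetilde f}f\nabla_XY$ for $f\in C^\infty(M)$. *)

theory Defs
  imports "HOL-Analysis.Analysis" "HOL-Algebra.Module" "HOL-Library.Z2"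
begin

section \<open>Superalgebras\<close>

definition real_ring :: "real ring" where
  "real_ring = \<lparr>carrier = UNIV, monoid.mult = (*), one = 1, zero = 0, add = (+)\<rparr>"

text \<open>The Koszul sign \<open>(-1)\<^bsup>pq\<^esup>\<close> of two parities.\<close>

definition psign :: "bit \<Rightarrow> bit \<Rightarrow> real" where
  "psign p q = (if p = 1 \<and> q = 1 then - 1 else 1)"

text \<open>Unital associative supercommutative real superalgebras; \<open>G 0\<close> and \<open>G 1\<close> are the
  even and the odd part. The zero algebra is allowed, since it occurs as the algebra of
  sections over the empty set.\<close>

definition superalgebra :: "(real, 's) module \<Rightarrow> (bit \<Rightarrow> 's set) \<Rightarrow> bool" where
  "superalgebra A G \<longleftrightarrow>
     Ring.ring A \<and> Module.module real_ring A \<and>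
     (\<forall>c. \<forall>x\<in>carrier A. \<forall>y\<in>carrier A.
        (c \<odot>\<^bsub>A\<^esub> x) \<otimes>\<^bsub>A\<^esub> y = c \<odot>\<^bsub>A\<^esub> (x \<otimes>\<^bsub>A\<^esub> y) \<and>
        x \<otimes>\<^bsub>A\<^esub> (c \<odot>\<^bsub>A\<^esub> y) = c \<odot>\<^bsub>A\<^esub> (x \<otimes>\<^bsub>A\<^esub> y)) \<and>
     (\<forall>p. submodule (G p) real_ring A) \<and>
     (\<forall>x\<in>carrier A. \<exists>!(y, z). y \<in> G 0 \<and> z \<in> G 1 \<and> x = y \<oplus>\<^bsub>A\<^esub> z) \<and>
     (\<forall>p q. \<forall>x\<in>G p. \<forall>y\<in>G q.
        x \<otimes>\<^bsub>A\<^esub> y \<in> G (p + q) \<and> x \<otimes>\<^bsub>A\<^esub> y = psign p q \<odot>\<^bsub>A\<^esub> (y \<otimes>\<^bsub>A\<^esub> x))"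

definition superalgebra_hom ::
    "(real, 's) module \<Rightarrow> (bit \<Rightarrow> 's set) \<Rightarrow> (real, 't) module \<Rightarrow> (bit \<Rightarrow> 't set) \<Rightarrow> ('s \<Rightarrow> 't) set"
  where
  "superalgebra_hom A G B H =
     {h \<in> ring_hom A B. (\<forall>c. \<forall>x\<in>carrier A. h (c \<odot>\<^bsub>A\<^esub> x) = c \<odot>\<^bsub>B\<^esub> h x) \<and> (\<forall>p. h ` G p \<subseteq> H p)}"


section \<open>Superspaces\<close>

text \<open>The data of a sheaf \<open>\<O>\<close> of superalgebras on a topological space, which is the type \<open>'a\<close>:
  the section algebras \<open>\<O>(U)\<close>, their homogeneous parts, and the restriction
  maps \<open>\<O>(U) \<rightarrow> \<O>(V)\<close>. Only open sets \<open>V \<subseteq> U\<close> matter.\<close>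

record ('a, 's) superspace =
  sections :: "'a set \<Rightarrow> (real, 's) module"
  homog :: "'a set \<Rightarrow> bit \<Rightarrow> 's set"
  res :: "'a set \<Rightarrow> 'a set \<Rightarrow> 's \<Rightarrow> 's"

definition superalgebra_sheaf :: "('a::topological_space, 's) superspace \<Rightarrow> bool" where
  "superalgebra_sheaf M \<longleftrightarrow>
     (\<forall>U. open U \<longrightarrow> superalgebra (sections M U) (homog M U)) \<and>
     (\<forall>U V. open U \<and> open V \<and> V \<subseteq> U \<longrightarrow>
        res M U V \<in> superalgebra_hom (sections M U) (homog M U) (sections M V) (homog M V)) \<and>
     (\<forall>U. open U \<longrightarrow> (\<forall>f\<in>carrier (sections M U). res M U U f = f)) \<and>
     (\<forall>U V W. open U \<and> open V \<and> open W \<and> W \<subseteq> V \<and> V \<subseteq> U \<longrightarrow>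
        (\<forall>f\<in>carrier (sections M U). res M V W (res M U V f) = res M U W f)) \<and>
     (\<forall>\<U> s. (\<forall>U\<in>\<U>. open U \<and> s U \<in> carrier (sections M U)) \<and>
        (\<forall>U\<in>\<U>. \<forall>V\<in>\<U>. res M U (U \<inter> V) (s U) = res M V (U \<inter> V) (s V)) \<longrightarrow>
        (\<exists>!f. f \<in> carrier (sections M (\<Union>\<U>)) \<and> (\<forall>U\<in>\<U>. res M (\<Union>\<U>) U f = s U)))"

text \<open>The value \<open>f(m)\<close> of a section is the unique real number \<open>r\<close> for which \<open>f - r\<close> is not
  invertible in any neighbourhood of \<open>m\<close>.\<close>

definition pt_value :: "('a::topological_space, 's) superspace \<Rightarrow> 'a \<Rightarrow> 'a set \<Rightarrow> 's \<Rightarrow> real" where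
  "pt_value M m U f = (THE r. \<forall>W. open W \<and> m \<in> W \<and> W \<subseteq> U \<longrightarrow>
     res M U W f \<ominus>\<^bsub>sections M W\<^esub> (r \<odot>\<^bsub>sections M W\<^esub> \<one>\<^bsub>sections M W\<^esub>) \<notin> Units (sections M W))"


section \<open>The model superspace \<open>\<real>\<^bsup>n|q\<^esup>\<close>\<close>

definition partial_deriv :: "'n::finite \<Rightarrow> (real^'n \<Rightarrow> real) \<Rightarrow> real^'n \<Rightarrow> real" where
  "partial_deriv i f x = frechet_derivative f (at x) (axis i 1)"

primrec Ck_on :: "nat \<Rightarrow> (real^'n::finite) set \<Rightarrow> (real^'n \<Rightarrow> real) \<Rightarrow> bool" where
  "Ck_on 0 U f \<longleftrightarrow> continuous_on U f"
| "Ck_on (Suc k) U f \<longleftrightarrow> (\<forall>x\<in>U. f differentiable (at x)) \<and> (\<forall>i. Ck_on k U (partial_deriv i f))"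

definition smooth_on :: "(real^'n::finite) set \<Rightarrow> (real^'n \<Rightarrow> real) \<Rightarrow> bool" where
  "smooth_on U f \<longleftrightarrow> (\<forall>k. Ck_on k U f)"

text \<open>A section \<open>\<Sum>\<^sub>S f\<^sub>S \<theta>\<^sup>S\<close> of \<open>C\<^sup>\<infinity>(U) \<otimes> \<Lambda>(\<theta>\<^sub>0,\<dots>,\<theta>\<^bsub>q-1\<^esub>)\<close> is represented by its coefficients
  \<open>f\<^sub>S\<close>, extended by 0 outside \<open>U\<close>, where \<open>S \<subseteq> {..<q}\<close> and \<open>\<theta>\<^sup>S\<close> is the product of the \<open>\<theta>\<^sub>j\<close>, \<open>j \<in> S\<close>,
  in increasing order; \<open>\<theta>\<^sup>A \<theta>\<^sup>B = shuffle_sign A B \<theta>\<^bsup>A \<union> B\<^esup>\<close> for disjoint \<open>A\<close> and \<open>B\<close>.\<close>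

type_synonym 'n ssection = "nat set \<Rightarrow> real^'n \<Rightarrow> real"

definition shuffle_sign :: "nat set \<Rightarrow> nat set \<Rightarrow> real" where
  "shuffle_sign A B = (- 1) ^ card {(a, b). a \<in> A \<and> b \<in> B \<and> b < a}"

definition model_sections :: "nat \<Rightarrow> (real^'n::finite) set \<Rightarrow> (real, 'n ssection) module" where
  "model_sections q U =
     \<lparr>carrier = {f. (\<forall>S. smooth_on U (f S)) \<and> (\<forall>S x. \<not> S \<subseteq> {..<q} \<or> x \<notin> U \<longrightarrow> f S x = 0)},
      monoid.mult = (\<lambda>f g S x. \<Sum>A\<in>Pow S. shuffle_sign A (S - A) * f A x * g (S - A) x),
      one = (\<lambda>S x. if S = {} \<and> x \<in> U then 1 else 0),
      zero = (\<lambda>S x. 0),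
      add = (\<lambda>f g S x. f S x + g S x),
      smult = (\<lambda>c f S x. c * f S x)\<rparr>"

definition model_superspace :: "nat \<Rightarrow> (real^'n::finite, 'n ssection) superspace" where
  "model_superspace q =
     \<lparr>sections = model_sections q,
      homog = (\<lambda>U p. {f \<in> carrier (model_sections q U). \<forall>S x. of_nat (card S) \<noteq> p \<longrightarrow> f S x = 0}),
      res = (\<lambda>U V f S x. if x \<in> V then f S x else 0)\<rparr>"

definition model_theta :: "nat \<Rightarrow> (real^'n::finite) set \<Rightarrow> 'n ssection" where
  "model_theta j U = (\<lambda>S x. if S = {j} \<and> x \<in> U then 1 else 0)"

definition model_deriv_even :: "'n::finite \<Rightarrow> (real^'n) set \<Rightarrow> 'n ssection \<Rightarrow> 'n ssection" where
  "model_deriv_even i U f = (\<lambda>S x. if x \<in> U then partial_deriv i (f S) x else 0)"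

text \<open>The left derivative \<open>\<partial>/\<partial>\<theta>\<^sub>j\<close>.\<close>

definition model_deriv_odd :: "nat \<Rightarrow> (real^'n::finite) set \<Rightarrow> 'n ssection \<Rightarrow> 'n ssection" where
  "model_deriv_odd j U f =
     (\<lambda>S x. if j \<in> S then 0 else (- 1) ^ card {i\<in>S. i < j} * f (insert j S) x)"


section \<open>Supermanifolds\<close>

text \<open>A chart with domain \<open>V\<close> is an isomorphism of superspaces from \<open>(V, \<O>|\<^sub>V)\<close> to an open
  subspace of the model: a homeomorphism \<open>\<phi>\<close> of \<open>V\<close> onto an open set, and pullback
  isomorphisms \<open>\<Phi> W\<close> from the model sections over \<open>\<phi>(W)\<close> to \<open>\<O>(W)\<close>.\<close>

definition superchart ::
    "nat \<Rightarrow> ('a::topological_space, 's) superspace \<Rightarrow> 'a set \<Rightarrow> ('a \<Rightarrow> real^'n::finite) \<Rightarrow>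
     ('a set \<Rightarrow> 'n ssection \<Rightarrow> 's) \<Rightarrow> bool"
  where
  "superchart q M V \<phi> \<Phi> \<longleftrightarrow>
     open V \<and> open (\<phi> ` V) \<and> (\<exists>\<psi>. homeomorphism V (\<phi> ` V) \<phi> \<psi>) \<and>
     (\<forall>W. open W \<and> W \<subseteq> V \<longrightarrow>
        \<Phi> W \<in> superalgebra_hom (model_sections q (\<phi> ` W)) (homog (model_superspace q) (\<phi> ` W))
               (sections M W) (homog M W) \<and>
        bij_betw (\<Phi> W) (carrier (model_sections q (\<phi> ` W))) (carrier (sections M W))) \<and>
     (\<forall>W W'. open W \<and> W \<subseteq> V \<and> open W' \<and> W' \<subseteq> W \<longrightarrow>
        (\<forall>f\<in>carrier (model_sections q (\<phi> ` W)).
           res M W W' (\<Phi> W f) = \<Phi> W' (res (model_superspace q) (\<phi> ` W) (\<phi> ` W') f)))"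

text \<open>Supermanifolds of dimension \<open>n|q\<close>, where \<open>n = CARD('n)\<close>. That the stalks are local rings
  follows from the local model.\<close>

definition supermanifold ::
    "'n::finite itself \<Rightarrow> nat \<Rightarrow> ('a::{t2_space,second_countable_topology}, 's) superspace \<Rightarrow> bool"
  where
  "supermanifold n q M \<longleftrightarrow>
     superalgebra_sheaf M \<and>
     (\<forall>m. \<exists>V (\<phi> :: 'a \<Rightarrow> real^'n) \<Phi>. m \<in> V \<and> superchart q M V \<phi> \<Phi>)"


section \<open>Vector fields\<close>

text \<open>A vector field over \<open>U\<close> is a superderivation of the sheaf \<open>\<O>|\<^sub>U\<close>, that is, a family of
  superderivations of \<open>\<O>(W)\<close>, for \<open>W \<subseteq> U\<close> open, compatible with restrictions. So that
  equality of vector fields is equality of HOL functions, the families are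
  made \<open>undefined\<close> outside their proper domain by \<open>vext\<close>. On a vector field, \<open>vext M V\<close> is
  restriction to \<open>V\<close>.\<close>

type_synonym ('a, 's) vfield = "'a set \<Rightarrow> 's \<Rightarrow> 's"

definition vext ::
    "('a::topological_space, 's) superspace \<Rightarrow> 'a set \<Rightarrow> ('a, 's) vfield \<Rightarrow> ('a, 's) vfield" where
  "vext M U X = (\<lambda>W f. if open W \<and> W \<subseteq> U \<and> f \<in> carrier (sections M W) then X W f else undefined)"

definition vzero :: "('a::topological_space, 's) superspace \<Rightarrow> 'a set \<Rightarrow> ('a, 's) vfield" where
  "vzero M U = vext M U (\<lambda>W f. \<zero>\<^bsub>sections M W\<^esub>)"

definition vadd ::
    "('a::topological_space, 's) superspace \<Rightarrow> 'a set \<Rightarrow> ('a, 's) vfield \<Rightarrow> ('a, 's) vfield \<Rightarrow>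
     ('a, 's) vfield" where
  "vadd M U X Y = vext M U (\<lambda>W f. X W f \<oplus>\<^bsub>sections M W\<^esub> Y W f)"

definition vscale ::
    "('a::topological_space, 's) superspace \<Rightarrow> 'a set \<Rightarrow> 's \<Rightarrow> ('a, 's) vfield \<Rightarrow> ('a, 's) vfield" where
  "vscale M U h X = vext M U (\<lambda>W f. res M U W h \<otimes>\<^bsub>sections M W\<^esub> X W f)"

text \<open>The graded commutator of vector fields \<open>X\<close> and \<open>Y\<close> of parity \<open>p\<close> and \<open>q\<close>.\<close>

definition vbracket ::
    "('a::topological_space, 's) superspace \<Rightarrow> 'a set \<Rightarrow> bit \<Rightarrow> bit \<Rightarrow>
     ('a, 's) vfield \<Rightarrow> ('a, 's) vfield \<Rightarrow> ('a, 's) vfield" where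
  "vbracket M U p q X Y =
     vext M U (\<lambda>W f. X W (Y W f) \<ominus>\<^bsub>sections M W\<^esub> (psign p q \<odot>\<^bsub>sections M W\<^esub> Y W (X W f)))"

definition vect_hom :: "('a::topological_space, 's) superspace \<Rightarrow> 'a set \<Rightarrow> bit \<Rightarrow> ('a, 's) vfield set"
  where
  "vect_hom M U p =
     {X. vext M U X = X \<and>
       (\<forall>W. open W \<and> W \<subseteq> U \<longrightarrow>
          (\<forall>f\<in>carrier (sections M W). X W f \<in> carrier (sections M W)) \<and>
          (\<forall>f\<in>carrier (sections M W). \<forall>h\<in>carrier (sections M W).
             X W (f \<oplus>\<^bsub>sections M W\<^esub> h) = X W f \<oplus>\<^bsub>sections M W\<^esub> X W h) \<and>
          (\<forall>c. \<forall>f\<in>carrier (sections M W).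
             X W (c \<odot>\<^bsub>sections M W\<^esub> f) = c \<odot>\<^bsub>sections M W\<^esub> X W f) \<and>
          (\<forall>r. \<forall>f\<in>homog M W r. X W f \<in> homog M W (p + r)) \<and>
          (\<forall>r. \<forall>f\<in>homog M W r. \<forall>h\<in>carrier (sections M W).
             X W (f \<otimes>\<^bsub>sections M W\<^esub> h) =
               (X W f \<otimes>\<^bsub>sections M W\<^esub> h) \<oplus>\<^bsub>sections M W\<^esub>
               (psign p r \<odot>\<^bsub>sections M W\<^esub> (f \<otimes>\<^bsub>sections M W\<^esub> X W h)))) \<and>
       (\<forall>W W'. open W \<and> W \<subseteq> U \<and> open W' \<and> W' \<subseteq> W \<longrightarrow>
          (\<forall>f\<in>carrier (sections M W). X W' (res M W W' f) = res M W W' (X W f)))}"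

definition vect :: "('a::topological_space, 's) superspace \<Rightarrow> 'a set \<Rightarrow> ('a, 's) vfield set" where
  "vect M U = {vadd M U X Y | X Y. X \<in> vect_hom M U 0 \<and> Y \<in> vect_hom M U 1}"

abbreviation Cinf :: "('a::topological_space, 's) superspace \<Rightarrow> (real, 's) module" where
  "Cinf M \<equiv> sections M UNIV"

abbreviation Vect :: "('a::topological_space, 's) superspace \<Rightarrow> ('a, 's) vfield set" where
  "Vect M \<equiv> vect M UNIV"

definition chart_deriv ::
    "nat \<Rightarrow> ('a::topological_space, 's) superspace \<Rightarrow> 'a set \<Rightarrow> ('a \<Rightarrow> real^'n::finite) \<Rightarrow>
     ('a set \<Rightarrow> 'n ssection \<Rightarrow> 's) \<Rightarrow> ((real^'n) set \<Rightarrow> 'n ssection \<Rightarrow> 'n ssection) \<Rightarrow> ('a, 's) vfield"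
  where
  "chart_deriv q M V \<phi> \<Phi> D =
     vext M V (\<lambda>W f. \<Phi> W (D (\<phi> ` W) (inv_into (carrier (model_sections q (\<phi> ` W))) (\<Phi> W) f)))"

definition d_even where "d_even q M V \<phi> \<Phi> i = chart_deriv q M V \<phi> \<Phi> (model_deriv_even i)"

definition d_odd where "d_odd q M V \<phi> \<Phi> j = chart_deriv q M V \<phi> \<Phi> (model_deriv_odd j)"

definition odd_coord ::
    "'a set \<Rightarrow> ('a \<Rightarrow> real^'n::finite) \<Rightarrow> ('a set \<Rightarrow> 'n ssection \<Rightarrow> 's) \<Rightarrow> nat \<Rightarrow> 's" where
  "odd_coord V \<phi> \<Phi> j = \<Phi> V (model_theta j (\<phi> ` V))"


section \<open>Tangent spaces\<close>

text \<open>\<open>T\<^sub>mM\<close> consists of the derivations at \<open>m\<close> of the stalk \<open>\<O>\<^sub>m\<close>. A linear form on the stalk is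
  encoded as a compatible family of linear forms on \<open>\<O>(W)\<close>, for \<open>W\<close> an open neighbourhood
  of \<open>m\<close>, continued by 0. No sign is needed in the Leibniz rule, as odd sections
  have value 0.\<close>

definition tangent_space ::
    "('a::topological_space, 's) superspace \<Rightarrow> 'a \<Rightarrow> ('a set \<Rightarrow> 's \<Rightarrow> real) set" where
  "tangent_space M m =
     {v. (\<forall>W f. \<not> (open W \<and> m \<in> W \<and> f \<in> carrier (sections M W)) \<longrightarrow> v W f = 0) \<and>
       (\<forall>W. open W \<and> m \<in> W \<longrightarrow>
          (\<forall>f\<in>carrier (sections M W). \<forall>h\<in>carrier (sections M W).
             v W (f \<oplus>\<^bsub>sections M W\<^esub> h) = v W f + v W h \<and>
             v W (f \<otimes>\<^bsub>sections M W\<^esub> h) = v W f * pt_value M m W h + pt_value M m W f * v W h) \<and>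
          (\<forall>c. \<forall>f\<in>carrier (sections M W). v W (c \<odot>\<^bsub>sections M W\<^esub> f) = c * v W f)) \<and>
       (\<forall>W W'. open W \<and> open W' \<and> m \<in> W' \<and> W' \<subseteq> W \<longrightarrow>
          (\<forall>f\<in>carrier (sections M W). v W' (res M W W' f) = v W f))}"

text \<open>Homogeneous tangent vectors: parity is that of a linear map to \<open>\<real>\<close>, which is purely even.\<close>

definition tangent_hom ::
    "('a::topological_space, 's) superspace \<Rightarrow> 'a \<Rightarrow> bit \<Rightarrow> ('a set \<Rightarrow> 's \<Rightarrow> real) set" where
  "tangent_hom M m p =
     {v \<in> tangent_space M m. \<forall>W r. open W \<and> m \<in> W \<and> r \<noteq> p \<longrightarrow> (\<forall>f\<in>homog M W r. v W f = 0)}"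

definition vect_value ::
    "('a::topological_space, 's) superspace \<Rightarrow> 'a \<Rightarrow> 'a set \<Rightarrow> ('a, 's) vfield \<Rightarrow> 'a set \<Rightarrow> 's \<Rightarrow> real" where
  "vect_value M m U X = (\<lambda>W f. if open W \<and> m \<in> W \<and> f \<in> carrier (sections M W)
     then pt_value M m (W \<inter> U) (X (W \<inter> U) (res M W (W \<inter> U) f)) else 0)"

definition nonsingular :: "('a::topological_space, 's) superspace \<Rightarrow> ('a, 's) vfield \<Rightarrow> bool" where
  "nonsingular M X \<longleftrightarrow> (\<forall>m. vect_value M m UNIV X \<noteq> (\<lambda>W f. 0))"


section \<open>Metrics\<close>

text \<open>A rank 2 covariant tensor is a family of pairings \<open>g U X Y = \<langle>X|Y\<rangle>\<close> of the vector fields over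
  the open sets \<open>U\<close>, compatible with restrictions.\<close>

type_synonym ('a, 's) pairing = "'a set \<Rightarrow> ('a, 's) vfield \<Rightarrow> ('a, 's) vfield \<Rightarrow> 's"

definition metric :: "('a::topological_space, 's) superspace \<Rightarrow> ('a, 's) pairing \<Rightarrow> bool" where
  "metric M g \<longleftrightarrow>
     (\<forall>U. open U \<longrightarrow>
        (\<forall>X\<in>vect M U. \<forall>Y\<in>vect M U. g U X Y \<in> carrier (sections M U)) \<and>
        (\<forall>p q. \<forall>X\<in>vect_hom M U p. \<forall>Y\<in>vect_hom M U q.
           g U X Y \<in> homog M U (p + q) \<and> g U X Y = psign p q \<odot>\<^bsub>sections M U\<^esub> g U Y X) \<and>
        (\<forall>f\<in>carrier (sections M U). \<forall>X\<in>vect M U. \<forall>Y\<in>vect M U. \<forall>Z\<in>vect M U.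
           g U (vadd M U (vscale M U f X) Y) Z =
             (f \<otimes>\<^bsub>sections M U\<^esub> g U X Z) \<oplus>\<^bsub>sections M U\<^esub> g U Y Z \<and>
           g U X (vadd M U Y Z) = g U X Y \<oplus>\<^bsub>sections M U\<^esub> g U X Z)) \<and>
     (\<forall>U V. open U \<and> open V \<and> V \<subseteq> U \<longrightarrow>
        (\<forall>X\<in>vect M U. \<forall>Y\<in>vect M U. res M U V (g U X Y) = g V (vext M V X) (vext M V Y)))"

definition metric_kernel ::
    "('a::topological_space, 's) superspace \<Rightarrow> ('a, 's) pairing \<Rightarrow> ('a, 's) vfield set" where
  "metric_kernel M g = {X \<in> Vect M. \<forall>Y\<in>Vect M. g UNIV X Y = \<zero>\<^bsub>Cinf M\<^esub>}"

definition degenerate :: "('a::topological_space, 's) superspace \<Rightarrow> ('a, 's) pairing \<Rightarrow> bool" where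
  "degenerate M g \<longleftrightarrow> metric_kernel M g \<noteq> {vzero M UNIV}"

text \<open>The bilinear form induced on \<open>T\<^sub>mM\<close>: extend \<open>v\<close> and \<open>w\<close> to vector fields
  near \<open>m\<close> and take the value of their pairing at \<open>m\<close>.\<close>

definition metric_at ::
    "('a::topological_space, 's) superspace \<Rightarrow> ('a, 's) pairing \<Rightarrow> 'a \<Rightarrow>
     ('a set \<Rightarrow> 's \<Rightarrow> real) \<Rightarrow> ('a set \<Rightarrow> 's \<Rightarrow> real) \<Rightarrow> real" where
  "metric_at M g m v w =
     (THE r. \<exists>U X Y. open U \<and> m \<in> U \<and> X \<in> vect M U \<and> Y \<in> vect M U \<and>
        vect_value M m U X = v \<and> vect_value M m U Y = w \<and> r = pt_value M m U (g U X Y))"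

definition metric_kernel_at ::
    "('a::topological_space, 's) superspace \<Rightarrow> ('a, 's) pairing \<Rightarrow> 'a \<Rightarrow> ('a set \<Rightarrow> 's \<Rightarrow> real) set"
  where
  "metric_kernel_at M g m =
     {v \<in> tangent_space M m. \<forall>w\<in>tangent_space M m. metric_at M g m v w = 0}"

text \<open>The kernel at \<open>m\<close> has dimension \<open>0|1\<close>: it has a basis consisting of one odd vector.\<close>

definition kernel_dim_0_1 ::
    "('a::topological_space, 's) superspace \<Rightarrow> ('a, 's) pairing \<Rightarrow> 'a \<Rightarrow> bool" where
  "kernel_dim_0_1 M g m \<longleftrightarrow>
     (\<exists>v\<in>tangent_hom M m 1. v \<noteq> (\<lambda>W f. 0) \<and>
        metric_kernel_at M g m = {(\<lambda>W f. c * v W f) | c. True})"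


section \<open>Super-null Riemannian manifolds\<close>

text \<open>Shander coordinates: the even coordinates of the chart are \<open>x\<^sup>a\<close> and \<open>t\<close>, the latter being
  the one with index \<open>k\<close>; the only odd coordinate \<open>\<tau>\<close> has index 0.\<close>

definition shander_chart ::
    "('a::topological_space, 's) superspace \<Rightarrow> ('a, 's) vfield \<Rightarrow> ('a, 's) vfield \<Rightarrow> 'a set \<Rightarrow>
     ('a \<Rightarrow> real^'n::finite) \<Rightarrow> ('a set \<Rightarrow> 'n ssection \<Rightarrow> 's) \<Rightarrow> 'n \<Rightarrow> bool" where
  "shander_chart M Q P V \<phi> \<Phi> k \<longleftrightarrow>
     superchart 1 M V \<phi> \<Phi> \<and>
     vext M V Q = vadd M V (d_odd 1 M V \<phi> \<Phi> 0)
                           (vscale M V (odd_coord V \<phi> \<Phi> 0) (d_even 1 M V \<phi> \<Phi> k)) \<and>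
     vext M V P = d_even 1 M V \<phi> \<Phi> k"

definition super_null_riemannian ::
    "'n::finite itself \<Rightarrow> ('a::{t2_space,second_countable_topology}, 's) superspace \<Rightarrow>
     ('a, 's) pairing \<Rightarrow> ('a, 's) vfield \<Rightarrow> ('a, 's) vfield \<Rightarrow> bool" where
  "super_null_riemannian n M g Q P \<longleftrightarrow>
     supermanifold n 1 M \<and>
     metric M g \<and> degenerate M g \<and>
     Q \<in> vect_hom M UNIV 1 \<and> nonsingular M Q \<and>
     P \<in> vect_hom M UNIV 0 \<and> vbracket M UNIV 1 1 Q Q = vadd M UNIV P P \<and>
     metric_kernel M g = {vscale M UNIV f Q | f. f \<in> carrier (Cinf M)} \<and>
     (\<forall>m. kernel_dim_0_1 M g m) \<and>
     (\<forall>m. \<exists>V (\<phi> :: 'a \<Rightarrow> real^'n) \<Phi> k. m \<in> V \<and> shander_chart M Q P V \<phi> \<Phi> k)"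


section \<open>Affine connections\<close>

definition affine_connection ::
    "('a::topological_space, 's) superspace \<Rightarrow>
     (('a, 's) vfield \<Rightarrow> ('a, 's) vfield \<Rightarrow> ('a, 's) vfield) \<Rightarrow> bool" where
  "affine_connection M D \<longleftrightarrow>
     (\<forall>X\<in>Vect M. \<forall>Y\<in>Vect M. D X Y \<in> Vect M) \<and>
     (\<forall>p q. \<forall>X\<in>vect_hom M UNIV p. \<forall>Y\<in>vect_hom M UNIV q. D X Y \<in> vect_hom M UNIV (p + q)) \<and>
     (\<forall>X\<in>Vect M. \<forall>Y\<in>Vect M. \<forall>Z\<in>Vect M.
        D (vadd M UNIV X Y) Z = vadd M UNIV (D X Z) (D Y Z) \<and>
        D X (vadd M UNIV Y Z) = vadd M UNIV (D X Y) (D X Z)) \<and>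
     (\<forall>f\<in>carrier (Cinf M). \<forall>X\<in>Vect M. \<forall>Y\<in>Vect M.
        D (vscale M UNIV f X) Y = vscale M UNIV f (D X Y)) \<and>
     (\<forall>p r. \<forall>X\<in>vect_hom M UNIV p. \<forall>f\<in>homog M UNIV r. \<forall>Y\<in>Vect M.
        D X (vscale M UNIV f Y) =
          vadd M UNIV (vscale M UNIV (X UNIV f) Y)
                      (vscale M UNIV (psign p r \<odot>\<^bsub>Cinf M\<^esub> f) (D X Y)))"

end

(* The vector fields d/dx_1, ..., d/dx_n, Q form a frame over the domain of a Shander chart, because
   Q(tau) = 1. The flat connection of this frame satisfies the claim over the chart domain. The
   conditions on a connection are preserved by affine combinations, so a partition of unity glues
   the flat connections of countably many charts.
   As there is one odd dimension, a section has at each point m of a chart i a value ev i m in the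
   dual numbers R[eps], where eps is the value of tau. A section is determined by these values, so
   identities between sections or vector fields are checked in the dual numbers.
   That a vector field is determined by its values on the coordinates is Hadamard's lemma. *)

theory Submission
  imports Defs
begin

text \<open>In the frame e_k of a chart the flat connection sends (X, Y) to sum_k X(c_k) e_k, where
  the c_k are the components of Y. The components of Q are the constants 1 and 0, which every vector
  field annihilates. In the Leibniz rule of the glued connection, the term X(u) Y appears once per
  chart and is recovered because the weights sum to 1. The frame fields live only over a chart
  domain, and their weighted versions have to be extended by zero. A vector field is a compatible
  family of maps on the sections over all open sets, so this is done one section at a time: the
  values of the result are prescribed by a formula, and a section with these values is glued from
  local ones. The dual numbers form an ordinary commutative ring, since a product of two odd values
  vanishes; most sign bookkeeping thereby becomes a parity condition on values. The value of a
  section depends on the chart, while partial derivatives are computed in the chart they belong to.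
  Such a computation is turned into an equality of sections, which then holds for the values in all
  charts.\<close>

subsection \<open>Smooth functions\<close>

lemma partial_deriv_eqI:
  "(f has_derivative f') (at x) \<Longrightarrow> partial_deriv i f x = f' (axis i 1)"
  unfolding partial_deriv_def using frechet_derivative_at by metis

lemma partial_deriv_cong:
  assumes "open U" "x \<in> U" "\<And>y. y \<in> U \<Longrightarrow> f y = g y" "f differentiable (at x)"
  shows "partial_deriv i f x = partial_deriv i g x"
proof -
  have d: "(f has_derivative frechet_derivative f (at x)) (at x)"
    using assms(4) frechet_derivative_works by blast
  have "(g has_derivative frechet_derivative f (at x)) (at x)"
    using has_derivative_transform_within_open[OF d assms(1,2)] assms(3) by blast
  then show ?thesis
    using d partial_deriv_eqI by metis
qed

lemma differentiable_cong_open: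
  assumes "open U" "x \<in> U" "\<And>y. y \<in> U \<Longrightarrow> f y = g y" "f differentiable (at x)"
  shows "g differentiable (at x)"
  using assms has_derivative_transform_within_open unfolding differentiable_def by meson

lemma Ck_on_cong:
  assumes "open U" "\<And>x. x \<in> U \<Longrightarrow> f x = g x" "Ck_on k U f"
  shows "Ck_on k U g"
  using assms(2,3)
proof (induction k arbitrary: f g)
  case 0
  then show ?case by (metis Ck_on.simps(1) continuous_on_cong)
next
  case (Suc k)
  have "g differentiable (at x)" if "x \<in> U" for x
    using differentiable_cong_open[OF \<open>open U\<close> that, of f g] Suc.prems that by auto
  moreover have "Ck_on k U (partial_deriv i g)" for i
  proof (rule Suc.IH)
    show "Ck_on k U (partial_deriv i f)" using Suc.prems by simp
    show "partial_deriv i f x = partial_deriv i g x" if "x \<in> U" for x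
      using partial_deriv_cong[OF \<open>open U\<close> that, of f g] Suc.prems that by auto
  qed
  ultimately show ?case by simp
qed

lemma Ck_on_subset: "Ck_on k U f \<Longrightarrow> V \<subseteq> U \<Longrightarrow> Ck_on k V f"
  by (induction k arbitrary: f) (auto intro: continuous_on_subset)

lemma Ck_on_continuous: "Ck_on k U f \<Longrightarrow> continuous_on U f"
  by (cases k) (auto intro!: differentiable_imp_continuous_on
      simp: differentiable_on_def differentiable_at_withinI)

lemma Ck_on_Suc_imp: "Ck_on (Suc k) U f \<Longrightarrow> Ck_on k U f"
proof (induction k arbitrary: f)
  case 0
  then show ?case using Ck_on_continuous[of "Suc 0" U f] by (simp del: Ck_on.simps(2))
next
  case (Suc k)
  then show ?case by (metis Ck_on.simps(2))
qed

text \<open>Any explicit derivative may stand in for \<open>partial_deriv\<close>, because on an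
  open set the class \<open>Ck_on k U\<close> depends only on the values on U.\<close>

lemma Ck_on_SucI:
  assumes "open U" "\<And>x. x \<in> U \<Longrightarrow> (f has_derivative f' x) (at x)"
    "\<And>i. Ck_on k U (\<lambda>x. f' x (axis i 1))"
  shows "Ck_on (Suc k) U f"
proof -
  have "Ck_on k U (partial_deriv i f)" for i
    using Ck_on_cong[OF assms(1) _ assms(3)] partial_deriv_eqI[OF assms(2)] by metis
  moreover have "f differentiable (at x)" if "x \<in> U" for x
    using assms(2)[OF that] differentiableI by blast
  ultimately show ?thesis by simp
qed

lemma has_derivative_frechet:
  "Ck_on (Suc k) U f \<Longrightarrow> x \<in> U \<Longrightarrow> (f has_derivative frechet_derivative f (at x)) (at x)"
  using frechet_derivative_works by auto

lemma Ck_on_const: "open U \<Longrightarrow> Ck_on k U (\<lambda>x. c)"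
proof (induction k arbitrary: c)
  case (Suc k)
  show ?case by (rule Ck_on_SucI[where f' = "\<lambda>_ _. 0"]) (use Suc in auto)
qed auto

lemma Ck_on_add: "open U \<Longrightarrow> Ck_on k U f \<Longrightarrow> Ck_on k U g \<Longrightarrow> Ck_on k U (\<lambda>x. f x + g x)"
proof (induction k arbitrary: f g)
  case (Suc k)
  show ?case
    by (rule Ck_on_SucI[where f' = "\<lambda>x h. frechet_derivative f (at x) h + frechet_derivative g (at x) h"])
      (use Suc in \<open>auto intro!: has_derivative_add has_derivative_frechet simp: partial_deriv_def[symmetric]\<close>)
qed (auto intro: continuous_on_add)

lemma Ck_on_mult: "open U \<Longrightarrow> Ck_on k U f \<Longrightarrow> Ck_on k U g \<Longrightarrow> Ck_on k U (\<lambda>x. f x * g x)"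
proof (induction k arbitrary: f g)
  case (Suc k)
  have "Ck_on k U f" "Ck_on k U g" using Suc.prems Ck_on_Suc_imp by auto
  then show ?case
    by (intro Ck_on_SucI[where f' = "\<lambda>x h. f x * frechet_derivative g (at x) h + frechet_derivative f (at x) h * g x"])
      (use Suc in \<open>auto intro!: has_derivative_mult Ck_on_add has_derivative_frechet simp: partial_deriv_def[symmetric]\<close>)
qed (auto intro: continuous_on_mult)

lemma Ck_on_sum:
  "open U \<Longrightarrow> (\<And>i. i \<in> I \<Longrightarrow> Ck_on k U (f i)) \<Longrightarrow> Ck_on k U (\<lambda>x. \<Sum>i\<in>I. f i x)"
  by (induction I rule: infinite_finite_induct) (auto intro: Ck_on_const Ck_on_add)

lemma Ck_on_coord: "open U \<Longrightarrow> Ck_on k U (\<lambda>x. x $ l)"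
proof (induction k)
  case (Suc k)
  show ?case by (rule Ck_on_SucI[where f' = "\<lambda>_ h. h $ l"])
      (use Suc.prems in \<open>auto intro!: Ck_on_const bounded_linear_imp_has_derivative bounded_linear_vec_nth\<close>)
qed (auto intro!: continuous_intros)

text \<open>The outer function comes with all its derivatives, \<open>F (Suc j)\<close> being the
  derivative of \<open>F j\<close>. The chain rule replaces \<open>F j\<close> by
  \<open>F (Suc j)\<close>, so the induction on k has to cover all j at once.\<close>

lemma Ck_on_compose_real:
  assumes F: "\<And>j s. (F j has_real_derivative F (Suc j) s) (at s)" and "open U"
  shows "Ck_on k U p \<Longrightarrow> Ck_on k U (\<lambda>x. F j (p x))"
proof (induction k arbitrary: j p)
  case 0
  have "continuous_on UNIV (F j)" using F DERIV_continuous_on by blast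
  then show ?case using 0 continuous_on_compose2 by fastforce
next
  case (Suc k)
  show ?case
  proof (rule Ck_on_SucI[where f' = "\<lambda>x h. F (Suc j) (p x) * frechet_derivative p (at x) h", OF \<open>open U\<close>])
    fix x assume "x \<in> U"
    then have "(p has_derivative frechet_derivative p (at x)) (at x)"
      using Suc.prems has_derivative_frechet by blast
    from has_derivative_compose[OF this, of "F j" "(*) (F (Suc j) (p x))"]
    show "((\<lambda>x. F j (p x)) has_derivative (\<lambda>h. F (Suc j) (p x) * frechet_derivative p (at x) h)) (at x)"
      using F by (simp add: has_field_derivative_def)
  next
    fix i
    have "Ck_on k U p" using Suc.prems Ck_on_Suc_imp by blast
    moreover have "Ck_on k U (partial_deriv i p)" using Suc.prems by simp
    ultimately show "Ck_on k U (\<lambda>x. F (Suc j) (p x) * frechet_derivative p (at x) (axis i 1))"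
      using Ck_on_mult[OF \<open>open U\<close> Suc.IH] unfolding partial_deriv_def by blast
  qed
qed

section \<open>Closure properties of smooth functions\<close>

lemma smooth_on_cong:
  "open U \<Longrightarrow> (\<And>x. x \<in> U \<Longrightarrow> f x = g x) \<Longrightarrow> smooth_on U f \<Longrightarrow> smooth_on U g"
  unfolding smooth_on_def using Ck_on_cong by blast

lemma smooth_on_subset: "smooth_on U f \<Longrightarrow> V \<subseteq> U \<Longrightarrow> smooth_on V f"
  unfolding smooth_on_def using Ck_on_subset by blast

lemma smooth_on_const: "open U \<Longrightarrow> smooth_on U (\<lambda>x. c)"
  unfolding smooth_on_def using Ck_on_const by blast

lemma smooth_on_coord: "open U \<Longrightarrow> smooth_on U (\<lambda>x. x $ l)"
  unfolding smooth_on_def using Ck_on_coord by blast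

lemma smooth_on_add: "open U \<Longrightarrow> smooth_on U f \<Longrightarrow> smooth_on U g \<Longrightarrow> smooth_on U (\<lambda>x. f x + g x)"
  unfolding smooth_on_def using Ck_on_add by blast

lemma smooth_on_mult: "open U \<Longrightarrow> smooth_on U f \<Longrightarrow> smooth_on U g \<Longrightarrow> smooth_on U (\<lambda>x. f x * g x)"
  unfolding smooth_on_def using Ck_on_mult by blast

lemma smooth_on_sum:
  "open U \<Longrightarrow> (\<And>i. i \<in> I \<Longrightarrow> smooth_on U (f i)) \<Longrightarrow> smooth_on U (\<lambda>x. \<Sum>i\<in>I. f i x)"
  unfolding smooth_on_def by (auto intro: Ck_on_sum)

lemma smooth_on_partial_deriv: "smooth_on U f \<Longrightarrow> smooth_on U (partial_deriv i f)"
  unfolding smooth_on_def by (metis Ck_on.simps(2))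

lemma smooth_on_differentiable: "smooth_on U f \<Longrightarrow> x \<in> U \<Longrightarrow> f differentiable (at x)"
  unfolding smooth_on_def by (metis Ck_on.simps(2))

subsection \<open>Bump functions\<close>

text \<open>The functions p(1/x) exp(-1/x), extended by 0 to x <= 0, form a class closed under
  differentiation; p = 1 gives the classical flat function.\<close>

definition flat_exp :: "real poly \<Rightarrow> real \<Rightarrow> real" where
  "flat_exp p x = (if x > 0 then poly p (1 / x) * exp (- (1 / x)) else 0)"

lemma poly_div_exp_tendsto_0: "((\<lambda>y. poly p y / exp y) \<longlongrightarrow> (0::real)) at_top"
proof -
  have "((\<lambda>y. \<Sum>i\<le>degree p. coeff p i * (y ^ i / exp y)) \<longlongrightarrow> (\<Sum>i\<le>degree p. coeff p i * 0)) at_top"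
    by (intro tendsto_intros tendsto_power_div_exp_0)
  then show ?thesis
    by (simp add: poly_altdef sum_divide_distrib)
qed

text \<open>With y = 1/x, the derivative of p(y) exp(-y) with respect to x is y^2 (p - p')(y)
  exp(-y), and \<open>monom 1 2\<close> is y^2. At 0 the one-sided difference quotients tend to 0
  because exp dominates every polynomial.\<close>

lemma flat_exp_derivative:
  "(flat_exp p has_real_derivative flat_exp (monom 1 2 * (p - pderiv p)) x) (at x)"
proof -
  consider "x > 0" | "x < 0" | "x = 0" by linarith
  then show ?thesis
  proof cases
    case 1
    have "((\<lambda>x. poly p (1 / x) * exp (- (1 / x))) has_real_derivative
        flat_exp (monom 1 2 * (p - pderiv p)) x) (at x)"
      using 1
      by (auto intro!: derivative_eq_intros DERIV_chain2[OF poly_DERIV]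
          simp: flat_exp_def poly_monom field_simps power2_eq_square)
    then show ?thesis
      by (rule DERIV_cong_ev[THEN iffD1, rotated 3])
        (use 1 in \<open>auto simp: flat_exp_def eventually_nhds intro!: exI[of _ "{0<..}"]\<close>)
  next
    case 2
    have "((\<lambda>x. 0) has_real_derivative flat_exp (monom 1 2 * (p - pderiv p)) x) (at x)"
      using 2 by (auto simp: flat_exp_def)
    then show ?thesis
      by (rule DERIV_cong_ev[THEN iffD1, rotated 3])
        (use 2 in \<open>auto simp: flat_exp_def eventually_nhds intro!: exI[of _ "{..<0}"]\<close>)
  next
    case 3
    \<comment> \<open>The quotient of p(1/h) exp(-1/h) by h is y p(y) / exp y with y = 1/h, and
      \<open>pCons 0 p\<close> is the polynomial y p(y).\<close>
    have "((\<lambda>h. poly (pCons 0 p) (1 / h) / exp (1 / h)) \<longlongrightarrow> 0) (at_right 0)"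
      using filterlim_compose[OF poly_div_exp_tendsto_0[of "pCons 0 p"] filterlim_inverse_at_top_right]
      by (simp add: inverse_eq_divide del: poly_pCons)
    then have "((\<lambda>h. flat_exp p h / h) \<longlongrightarrow> 0) (at_right 0)"
      by (rule Lim_transform_eventually)
        (auto simp: eventually_at_right[of 0 1] flat_exp_def exp_minus field_simps intro!: exI[of _ 1])
    moreover have "((\<lambda>h. flat_exp p h / h) \<longlongrightarrow> 0) (at_left 0)"
      by (rule Lim_transform_eventually[of "\<lambda>_. 0"])
        (auto simp: eventually_at_left[of "-1" 0] flat_exp_def intro!: exI[of _ "-1"])
    ultimately have "((\<lambda>h. flat_exp p h / h) \<longlongrightarrow> 0) (at 0)"
      using filterlim_split_at by blast
    then show ?thesis using 3 by (simp add: DERIV_def flat_exp_def)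
  qed
qed

lemma flat_exp_sequence:
  fixes p :: "real poly"
  obtains F where "F 0 = flat_exp p" "\<And>j s. (F j has_real_derivative F (Suc j) s) (at s)"
proof
  let ?F = "\<lambda>j. flat_exp (((\<lambda>p. monom 1 2 * (p - pderiv p)) ^^ j) p)"
  show "?F 0 = flat_exp p" by simp
  show "(?F j has_real_derivative ?F (Suc j) s) (at s)" for j s
    using flat_exp_derivative by simp
qed

lemma smooth_on_flat_exp: "open U \<Longrightarrow> smooth_on U f \<Longrightarrow> smooth_on U (\<lambda>x. flat_exp p (f x))"
  using flat_exp_sequence[of p] Ck_on_compose_real unfolding smooth_on_def by metis

text \<open>The composition \<open>e (e 1 - e s)\<close>, where \<open>e s = exp (-1/s)\<close> for \<open>s > 0\<close>, is constant for
  \<open>s \<le> 0\<close> and vanishes for \<open>s \<ge> 1\<close>.\<close>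

lemma smooth_bump:
  fixes a :: "real^'n::finite"
  assumes "r > 0"
  obtains b where "smooth_on UNIV b" "\<And>x. x \<in> ball a r \<Longrightarrow> b x = 1" "\<And>x. x \<notin> ball a (2 * r) \<Longrightarrow> b x = 0"
proof
  define e where "e = flat_exp 1"
  \<comment> \<open>This is (|x - a|^2 - r^2) / (3 r^2), which is at most 0 for |x - a| <= r and at
    least 1 for |x - a| >= 2 r, since (4 r^2 - r^2) / (3 r^2) = 1. It is written as a polynomial in
    the coordinates so that the closure rules for smooth functions apply.\<close>
  define s where "s x = (\<Sum>i\<in>UNIV. (x $ i + (- a $ i)) * (x $ i + (- a $ i))) * (1 / (3 * r\<^sup>2)) + (- 1 / 3)" for x :: "real^'n"
  have s: "s x = ((dist a x)\<^sup>2 - r\<^sup>2) / (3 * r\<^sup>2)" for x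
    using assms unfolding s_def dist_commute[of a] dist_norm norm_vec_def L2_set_def
    by (simp add: sum_nonneg power2_eq_square[symmetric] power2_commute[of "a $ _"] diff_divide_distrib)
  \<comment> \<open>The constant value for s <= 0 is \<open>e (e 1)\<close>, so dividing by it
    normalises the bump to 1 on the inner ball.\<close>
  let ?b = "\<lambda>x. e (e 1 + (- 1) * e (s x)) * (1 / e (e 1))"
  have e_pos: "e x > 0" if "x > 0" for x using that by (simp add: e_def flat_exp_def)
  have e_0: "e x = 0" if "x \<le> 0" for x using that by (simp add: e_def flat_exp_def)
  have "smooth_on UNIV s"
    unfolding s_def by (intro smooth_on_add smooth_on_mult smooth_on_sum smooth_on_const smooth_on_coord) auto
  then show "smooth_on UNIV ?b"
    unfolding e_def by (intro smooth_on_add smooth_on_mult smooth_on_flat_exp smooth_on_const) auto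
  show "?b x = 1" if "x \<in> ball a r" for x
  proof -
    have "(dist a x)\<^sup>2 \<le> r\<^sup>2" using that by (intro power_mono) auto
    then have "s x \<le> 0" using assms by (simp add: s divide_nonpos_pos)
    then show ?thesis using e_0[of "s x"] e_pos[of 1] e_pos[of "e 1"] by simp
  qed
  show "?b x = 0" if "x \<notin> ball a (2 * r)" for x
  proof -
    have "(2 * r)\<^sup>2 \<le> (dist a x)\<^sup>2" using that assms by (intro power_mono) auto
    then have "1 \<le> s x" using assms by (simp add: s field_simps)
    then have "e 1 \<le> e (s x)"
      unfolding e_def flat_exp_def by simp
    then show ?thesis using e_0 by simp
  qed
qed

subsection \<open>Hadamard's lemma\<close>

lemma frechet_derivative_partials:
  assumes "f differentiable (at x)"
  shows "frechet_derivative f (at x) h = (\<Sum>i\<in>UNIV. partial_deriv i f x * h $ i)"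
proof -
  have "linear (frechet_derivative f (at x))"
    using assms frechet_derivative_works has_derivative_linear by blast
  then have "frechet_derivative f (at x) (\<Sum>i\<in>UNIV. h $ i *\<^sub>R axis i 1) =
      (\<Sum>i\<in>UNIV. h $ i * frechet_derivative f (at x) (axis i 1))"
    by (simp add: linear_sum linear_cmul)
  moreover have "(\<Sum>i\<in>UNIV. h $ i *\<^sub>R axis i 1) = h"
    using basis_expansion[of h] by (simp add: scalar_mult_eq_scaleR)
  ultimately show ?thesis by (simp add: partial_deriv_def mult.commute)
qed

lemma segment_in_ball:
  fixes a :: "'b::real_normed_vector"
  assumes "x \<in> ball a r" "t \<in> {0..1}"
  shows "a + t *\<^sub>R (x - a) \<in> ball a r"
proof -
  have "t * norm (x - a) \<le> 1 * norm (x - a)"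
    using assms by (intro mult_right_mono) auto
  then show ?thesis using assms by (auto simp: dist_norm norm_minus_commute)
qed

lemma continuous_on_segment_weighted:
  fixes f :: "'b::real_normed_vector \<Rightarrow> real"
  assumes "continuous_on (ball a r) f"
  shows "continuous_on (ball a r \<times> {0..1}) (\<lambda>(x, t). t ^ j * f (a + t *\<^sub>R (x - a)))"
proof -
  have "continuous_on (ball a r \<times> {0..1}) (\<lambda>z. f (a + snd z *\<^sub>R (fst z - a)))"
  proof (rule continuous_on_compose2[OF assms])
    show "(\<lambda>z. a + snd z *\<^sub>R (fst z - a)) ` (ball a r \<times> {0..1}) \<subseteq> ball a r"
      using segment_in_ball by fastforce
  qed (intro continuous_intros)
  then show ?thesis
    unfolding case_prod_unfold by (intro continuous_intros)
qed

text \<open>Differentiation under the integral sign brings out a factor t from the inner map a + t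
  (x - a). Each partial derivative is therefore an integral of the same kind, with weight t^(j+1)
  and \<open>partial_deriv i f\<close> in place of f, and the weight has to vary in the
  induction.\<close>

lemma Ck_on_segment_integral:
  fixes a :: "real^'n::finite"
  shows "Ck_on k (ball a r) f \<Longrightarrow>
    Ck_on k (ball a r) (\<lambda>x. integral {0..1} (\<lambda>t. t ^ j * f (a + t *\<^sub>R (x - a))))"
proof (induction k arbitrary: j f)
  case 0
  then have "continuous_on (ball a r) (\<lambda>x. integral (cbox 0 1) (\<lambda>t. t ^ j * f (a + t *\<^sub>R (x - a))))"
    using integral_continuous_on_param[of "ball a r" 0 1 "\<lambda>x t. t ^ j * f (a + t *\<^sub>R (x - a))"]
      continuous_on_segment_weighted[of a r f j] by simp
  then show ?case by simp
next
  case (Suc k)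
  \<comment> \<open>The derivative of the integrand in x as a bounded linear map, the form required
    by \<open>leibniz_rule\<close>; \<open>blinfun_inner_left (axis i 1)\<close> is the i-th
    coordinate form.\<close>
  define f' where "f' x t = (\<Sum>i\<in>UNIV. (t ^ Suc j * partial_deriv i f (a + t *\<^sub>R (x - a))) *\<^sub>R
    blinfun_inner_left (axis i (1::real)))" for x :: "real^'n" and t :: real
  have cont: "continuous_on (ball a r) f" "\<And>i. continuous_on (ball a r) (partial_deriv i f)"
    using Suc.prems Ck_on_continuous by (blast, metis Ck_on.simps(2))
  have slice: "continuous_on {0..1} (\<lambda>t. t ^ j * h (a + t *\<^sub>R (x - a)))"
    if "continuous_on (ball a r) h" "x \<in> ball a r" for h :: "real^'n \<Rightarrow> real" and x j
  proof -
    have "continuous_on {0..1} (\<lambda>t. (x, t))" by (intro continuous_intros)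
    from continuous_on_compose2[OF continuous_on_segment_weighted[OF that(1), of j] this] that(2)
    show ?thesis by (simp add: image_subset_iff)
  qed
  have contf': "continuous_on (ball a r \<times> cbox 0 1) (\<lambda>(x, t). f' x t)"
    unfolding f'_def case_prod_unfold
    using continuous_on_segment_weighted[OF cont(2), of 0]
    by (intro continuous_intros) (simp add: case_prod_unfold)
  have slice': "continuous_on {0..1} (f' x)" if "x \<in> ball a r" for x
  proof -
    have "continuous_on {0..1} (\<lambda>t. (x, t))" by (intro continuous_intros)
    from continuous_on_compose2[OF contf' this] that
    show ?thesis by (simp add: image_subset_iff)
  qed
  have "((\<lambda>x. integral (cbox 0 1) (\<lambda>t. t ^ j * f (a + t *\<^sub>R (x - a)))) has_derivative
      blinfun_apply (integral (cbox 0 1) (f' x))) (at x within ball a r)" if x: "x \<in> ball a r" for x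
  proof (rule leibniz_rule[OF _ _ contf' x])
    fix y t assume y: "y \<in> ball a r" and t: "t \<in> cbox 0 (1::real)"
    let ?z = "a + t *\<^sub>R (y - a)"
    have z: "?z \<in> ball a r" using segment_in_ball y t by auto
    have "((\<lambda>y. a + t *\<^sub>R (y - a)) has_derivative (\<lambda>h. t *\<^sub>R h)) (at y)"
      by (auto intro!: derivative_eq_intros)
    from has_derivative_compose[OF this has_derivative_frechet[OF Suc.prems z]]
    have "((\<lambda>y. f (a + t *\<^sub>R (y - a))) has_derivative (\<lambda>h. frechet_derivative f (at ?z) (t *\<^sub>R h))) (at y)" .
    from has_derivative_mult_right[OF this, of "t ^ j"]
    have "((\<lambda>y. t ^ j * f (a + t *\<^sub>R (y - a))) has_derivative
        (\<lambda>h. t ^ j * frechet_derivative f (at ?z) (t *\<^sub>R h))) (at y)" .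
    moreover have "(\<lambda>h. t ^ j * frechet_derivative f (at ?z) (t *\<^sub>R h)) = blinfun_apply (f' y t)"
      using Suc.prems z
      by (auto simp: frechet_derivative_partials f'_def blinfun.sum_left blinfun.scaleR_left
          inner_axis sum_distrib_left intro!: ext sum.cong)
    ultimately show "((\<lambda>y. t ^ j * f (a + t *\<^sub>R (y - a))) has_derivative blinfun_apply (f' y t)) (at y within ball a r)"
      by - (rule has_derivative_at_withinI, simp)
  next
    fix y assume "y \<in> ball a r"
    then show "(\<lambda>t. t ^ j * f (a + t *\<^sub>R (y - a))) integrable_on cbox 0 1"
      unfolding cbox_interval by (rule integrable_continuous_interval[OF slice[OF cont(1)]])
  qed auto
  then have d: "((\<lambda>x. integral {0..1} (\<lambda>t. t ^ j * f (a + t *\<^sub>R (x - a)))) has_derivative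
      blinfun_apply (integral {0..1} (f' x))) (at x)" if "x \<in> ball a r" for x
    using that by (simp add: at_within_open[of _ "ball a r"])
  show ?case
  proof (rule Ck_on_SucI[OF _ d])
    fix i
    have ck: "Ck_on k (ball a r) (\<lambda>x. integral {0..1} (\<lambda>t. t ^ Suc j * partial_deriv i f (a + t *\<^sub>R (x - a))))"
      by (rule Suc.IH) (use Suc.prems in simp)
    have eq: "integral {0..1} (\<lambda>t. t ^ Suc j * partial_deriv i f (a + t *\<^sub>R (x - a))) =
        blinfun_apply (integral {0..1} (f' x)) (axis i 1)" if "x \<in> ball a r" for x
    proof -
      have "f' x integrable_on {0..1}"
        using slice'[OF that] integrable_continuous_interval by blast
      then have "blinfun_apply (integral {0..1} (f' x)) (axis i 1) = integral {0..1} (\<lambda>t. blinfun_apply (f' x t) (axis i 1))"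
        by (rule blinfun_apply_integral)
      also have "(\<lambda>t. blinfun_apply (f' x t) (axis i 1)) = (\<lambda>t. t ^ Suc j * partial_deriv i f (a + t *\<^sub>R (x - a)))"
        by (auto simp: f'_def blinfun.sum_left blinfun.scaleR_left inner_axis_axis if_distrib cong: if_cong)
      finally show ?thesis by simp
    qed
    show "Ck_on k (ball a r) (\<lambda>x. blinfun_apply (integral {0..1} (f' x)) (axis i 1))"
      by (rule Ck_on_cong[OF open_ball eq ck])
  qed auto
qed

text \<open>The derivative of f is integrated along the segment from a to x. The coefficient
  \<open>G i\<close> is the mean of \<open>partial_deriv i f\<close> over that segment, hence smooth
  in x, and at x = a it is the mean of a constant.\<close>

lemma hadamard:
  fixes a :: "real^'n::finite"
  assumes f: "smooth_on (ball a r) f" and "r > 0"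
  obtains G where "\<And>i. smooth_on (ball a r) (G i)" "\<And>i. G i a = partial_deriv i f a"
    "\<And>x. x \<in> ball a r \<Longrightarrow> f x = f a + (\<Sum>i\<in>UNIV. (x $ i - a $ i) * G i x)"
proof
  let ?G = "\<lambda>i x. integral {0..1} (\<lambda>t. partial_deriv i f (a + t *\<^sub>R (x - a)))"
  show "smooth_on (ball a r) (?G i)" for i
    using Ck_on_segment_integral[of _ a r "partial_deriv i f" 0] smooth_on_partial_deriv[OF f]
    unfolding smooth_on_def by simp
  show "?G i a = partial_deriv i f a" for i by simp
  fix x assume x: "x \<in> ball a r"
  have dseg: "((\<lambda>t. f (a + t *\<^sub>R (x - a))) has_vector_derivative
      (\<Sum>i\<in>UNIV. partial_deriv i f (a + t *\<^sub>R (x - a)) * (x $ i - a $ i))) (at t within {0..1})"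
    if t: "t \<in> {0..1}" for t
  proof -
    let ?z = "a + t *\<^sub>R (x - a)"
    have df: "f differentiable (at ?z)"
      using smooth_on_differentiable[OF f segment_in_ball[OF x t]] .
    have "((\<lambda>t. a + t *\<^sub>R (x - a)) has_derivative (\<lambda>h. h *\<^sub>R (x - a))) (at t)"
      by (auto intro!: derivative_eq_intros)
    from has_derivative_compose[OF this df[unfolded frechet_derivative_works]]
    have "((\<lambda>t. f (a + t *\<^sub>R (x - a))) has_derivative (\<lambda>h. frechet_derivative f (at ?z) (h *\<^sub>R (x - a)))) (at t)" .
    moreover have "(\<lambda>h. frechet_derivative f (at ?z) (h *\<^sub>R (x - a))) =
        (\<lambda>h. h *\<^sub>R (\<Sum>i\<in>UNIV. partial_deriv i f ?z * (x $ i - a $ i)))"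
      by (auto simp: frechet_derivative_partials[OF df] sum_distrib_left intro!: ext sum.cong)
    ultimately show ?thesis
      unfolding has_vector_derivative_def by - (rule has_derivative_at_withinI, simp)
  qed
  have "((\<lambda>t. \<Sum>i\<in>UNIV. partial_deriv i f (a + t *\<^sub>R (x - a)) * (x $ i - a $ i)) has_integral f x - f a) {0..1}"
    using fundamental_theorem_of_calculus[where f = "\<lambda>t. f (a + t *\<^sub>R (x - a))" and a = 0 and b = 1] dseg
    by fastforce
  moreover have "((\<lambda>t. \<Sum>i\<in>UNIV. partial_deriv i f (a + t *\<^sub>R (x - a)) * (x $ i - a $ i)) has_integral
      (\<Sum>i\<in>UNIV. ?G i x * (x $ i - a $ i))) {0..1}"
  proof (intro has_integral_sum has_integral_mult_left integrable_integral integrable_continuous_interval)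
    fix i
    have "continuous_on (ball a r) (partial_deriv i f)"
      using smooth_on_partial_deriv[OF f] Ck_on_continuous unfolding smooth_on_def by blast
    then show "continuous_on {0..1} (\<lambda>t. partial_deriv i f (a + t *\<^sub>R (x - a)))"
      by (rule continuous_on_compose2) (use segment_in_ball[OF x] in \<open>auto intro!: continuous_intros\<close>)
  qed auto
  ultimately have "f x - f a = (\<Sum>i\<in>UNIV. ?G i x * (x $ i - a $ i))"
    by (rule has_integral_unique)
  then show "f x = f a + (\<Sum>i\<in>UNIV. (x $ i - a $ i) * ?G i x)"
    by (simp add: mult.commute)
qed

subsection \<open>Dual numbers\<close>

datatype dual = Dual (body: real) (soul: real)

instantiation dual :: comm_ring_1
begin

definition "0 = Dual 0 0"
definition "1 = Dual 1 0"
definition "x + y = Dual (body x + body y) (soul x + soul y)"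
definition "- x = Dual (- body x) (- soul x)"
definition "x - y = Dual (body x - body y) (soul x - soul y)"
definition "x * y = Dual (body x * body y) (body x * soul y + soul x * body y)"

instance
  by standard (auto simp: zero_dual_def one_dual_def plus_dual_def uminus_dual_def
      minus_dual_def times_dual_def algebra_simps dual.expand)

end

instantiation dual :: real_algebra_1
begin

definition "c *\<^sub>R x = Dual (c * body x) (c * soul x)"

instance
  by standard (auto simp: scaleR_dual_def plus_dual_def times_dual_def algebra_simps dual.expand)

end

lemma body_simps [simp]:
  "body 0 = 0" "body 1 = 1" "body (x + y) = body x + body y" "body (- x) = - body x"
  "body (x - y) = body x - body y" "body (x * y) = body x * body y" "body (c *\<^sub>R x) = c * body x"
  by (simp_all add: zero_dual_def one_dual_def plus_dual_def uminus_dual_def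
      minus_dual_def times_dual_def scaleR_dual_def)

lemma soul_simps [simp]:
  "soul 0 = 0" "soul 1 = 0" "soul (x + y) = soul x + soul y" "soul (- x) = - soul x"
  "soul (x - y) = soul x - soul y" "soul (x * y) = body x * soul y + soul x * body y"
  "soul (c *\<^sub>R x) = c * soul x"
  by (simp_all add: zero_dual_def one_dual_def plus_dual_def uminus_dual_def
      minus_dual_def times_dual_def scaleR_dual_def)

lemma body_sum [simp]: "body (sum f I) = (\<Sum>i\<in>I. body (f i))"
  by (induction I rule: infinite_finite_induct) auto

lemma soul_sum [simp]: "soul (sum f I) = (\<Sum>i\<in>I. soul (f i))"
  by (induction I rule: infinite_finite_induct) auto

lemma dual_eq_iff: "x = y \<longleftrightarrow> body x = body y \<and> soul x = soul y"
  by (cases x; cases y) auto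

text \<open>The possible values of a homogeneous section: an even section has no term in tau, and an
  odd one consists of that term alone.\<close>

definition dual_hom :: "bit \<Rightarrow> dual set" where
  "dual_hom p = {d. if p = 0 then soul d = 0 else body d = 0}"

lemma dual_hom_0 [simp]: "0 \<in> dual_hom p"
  by (simp add: dual_hom_def)

lemma dual_hom_mult: "c \<in> dual_hom p \<Longrightarrow> d \<in> dual_hom r \<Longrightarrow> c * d \<in> dual_hom (p + r)"
  by (cases p; cases r) (auto simp: dual_hom_def)

lemma dual_hom_sum: "(\<And>i. i \<in> I \<Longrightarrow> f i \<in> dual_hom p) \<Longrightarrow> sum f I \<in> dual_hom p"
  by (auto simp: dual_hom_def)

lemma psign_0 [simp]: "psign p 0 = 1" "psign 0 p = 1"
  by (simp_all add: psign_def)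

text \<open>A product of two odd dual numbers vanishes, hence the Koszul sign is immaterial.\<close>

lemma psign_dual_hom:
  assumes "c \<in> dual_hom (p + s)" "d \<in> dual_hom r"
  shows "psign s r *\<^sub>R (c * d) = psign p r *\<^sub>R (c * d)"
  using assms by (cases p; cases s; cases r) (auto simp: dual_hom_def psign_def dual.expand)

subsection \<open>Superalgebras\<close>

lemma superalgebraD:
  assumes "superalgebra A G"
  shows superalgebra_ring: "Ring.ring A"
    and superalgebra_smult_closed: "x \<in> carrier A \<Longrightarrow> c \<odot>\<^bsub>A\<^esub> x \<in> carrier A"
    and superalgebra_homog_subset: "G p \<subseteq> carrier A"
    and superalgebra_homog_zero: "\<zero>\<^bsub>A\<^esub> \<in> G p"
    and superalgebra_decomp: "x \<in> carrier A \<Longrightarrow> \<exists>!(y, z). y \<in> G 0 \<and> z \<in> G 1 \<and> x = y \<oplus>\<^bsub>A\<^esub> z"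
proof -
  show "Ring.ring A" using assms by (simp add: superalgebra_def)
  have m: "Module.module real_ring A" and s: "submodule (G p) real_ring A" for p
    using assms by (auto simp: superalgebra_def)
  show "x \<in> carrier A \<Longrightarrow> c \<odot>\<^bsub>A\<^esub> x \<in> carrier A"
    using module.smult_closed[OF m, of c x] by (simp add: real_ring_def)
  have sg: "subgroup (G p) (add_monoid A)"
    using s[of p] unfolding submodule_def by simp
  show "G p \<subseteq> carrier A" using subgroup.subset[OF sg] by simp
  show "\<zero>\<^bsub>A\<^esub> \<in> G p" using subgroup.one_closed[OF sg] by simp
  show "x \<in> carrier A \<Longrightarrow> \<exists>!(y, z). y \<in> G 0 \<and> z \<in> G 1 \<and> x = y \<oplus>\<^bsub>A\<^esub> z"
    using assms by (simp add: superalgebra_def)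
qed

lemma superalgebra_decomp_unique:
  assumes "superalgebra A G" "y \<in> G 0" "z \<in> G 1" "y' \<in> G 0" "z' \<in> G 1" "y \<oplus>\<^bsub>A\<^esub> z = y' \<oplus>\<^bsub>A\<^esub> z'"
  shows "y = y'" "z = z'"
proof -
  have "y \<oplus>\<^bsub>A\<^esub> z \<in> carrier A"
    using assms superalgebra_ring superalgebra_homog_subset ring.ring_simprules(1) by (metis subsetD)
  then have "\<exists>!(u, v). u \<in> G 0 \<and> v \<in> G 1 \<and> y \<oplus>\<^bsub>A\<^esub> z = u \<oplus>\<^bsub>A\<^esub> v"
    using superalgebra_decomp[OF assms(1)] by blast
  then obtain w where w: "\<And>v. (case v of (u, v) \<Rightarrow> u \<in> G 0 \<and> v \<in> G 1 \<and> y \<oplus>\<^bsub>A\<^esub> z = u \<oplus>\<^bsub>A\<^esub> v) \<Longrightarrow> v = w"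
    by blast
  have "(y, z) = w" "(y', z') = w"
    using w[of "(y, z)"] w[of "(y', z')"] assms by auto
  then show "y = y'" "z = z'" by auto
qed

lemma superalgebra_homD:
  assumes "h \<in> superalgebra_hom A G B H"
  shows "h \<in> ring_hom A B" "x \<in> carrier A \<Longrightarrow> h (c \<odot>\<^bsub>A\<^esub> x) = c \<odot>\<^bsub>B\<^esub> h x"
    "x \<in> G p \<Longrightarrow> h x \<in> H p"
  using assms unfolding superalgebra_hom_def by (simp_all add: image_subset_iff)

lemma superchartD:
  assumes "superchart q M V \<phi> \<Phi>"
  shows "open V" "open (\<phi> ` V)" "\<exists>\<psi>. homeomorphism V (\<phi> ` V) \<phi> \<psi>"
    "open W \<Longrightarrow> W \<subseteq> V \<Longrightarrow> \<Phi> W \<in> superalgebra_hom (model_sections q (\<phi> ` W))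
       (homog (model_superspace q) (\<phi> ` W)) (sections M W) (homog M W)"
    "open W \<Longrightarrow> W \<subseteq> V \<Longrightarrow> bij_betw (\<Phi> W) (carrier (model_sections q (\<phi> ` W))) (carrier (sections M W))"
    "open W \<Longrightarrow> W \<subseteq> V \<Longrightarrow> open W' \<Longrightarrow> W' \<subseteq> W \<Longrightarrow> f \<in> carrier (model_sections q (\<phi> ` W)) \<Longrightarrow>
       res M W W' (\<Phi> W f) = \<Phi> W' (res (model_superspace q) (\<phi> ` W) (\<phi> ` W') f)"
  using assms by (simp_all add: superchart_def)

subsection \<open>The model with one odd coordinate\<close>

declare One_nat_def [simp del] add_bit_eq_xor [simp del]

text \<open>The section u + v tau over U.\<close>

definition model1 :: "(real^'n::finite) set \<Rightarrow> (real^'n \<Rightarrow> real) \<Rightarrow> (real^'n \<Rightarrow> real) \<Rightarrow> 'n ssection" where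
  "model1 U u v = (\<lambda>S x. if x \<in> U then (if S = {} then u x else if S = {0} then v x else 0) else 0)"

lemma subset_lessThan_1: "S \<subseteq> {..<1::nat} \<longleftrightarrow> S = {} \<or> S = {0}"
  by (auto simp: lessThan_Suc subset_singleton_iff One_nat_def)

lemma model1_carrier [simp]:
  "open U \<Longrightarrow> smooth_on U u \<Longrightarrow> smooth_on U v \<Longrightarrow> model1 U u v \<in> carrier (model_sections 1 U)"
proof -
  assume a: "open U" "smooth_on U u" "smooth_on U v"
  have "smooth_on U (model1 U u v S)" for S
    by (rule smooth_on_cong[OF a(1), of "if S = {} then u else if S = {0} then v else (\<lambda>_. 0)"])
      (use a in \<open>auto simp: model1_def smooth_on_const\<close>)
  moreover have "model1 U u v S x = 0" if "\<not> S \<subseteq> {..<1} \<or> x \<notin> U" for S x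
    using that unfolding subset_lessThan_1 by (auto simp: model1_def)
  ultimately show ?thesis
    unfolding model_sections_def by auto
qed

lemma model_sections_cases:
  assumes "h \<in> carrier (model_sections 1 U)"
  shows "smooth_on U (h S)" "h = model1 U (h {}) (h {0})"
proof -
  show "smooth_on U (h S)" using assms by (simp add: model_sections_def)
  have z: "h S x = 0" if "\<not> S \<subseteq> {..<1} \<or> x \<notin> U" for S x
    using assms that by (simp add: model_sections_def)
  show "h = model1 U (h {}) (h {0})"
  proof (intro ext)
    fix S x
    show "h S x = model1 U (h {}) (h {0}) S x"
      using z[of S x] unfolding subset_lessThan_1 by (auto simp: model1_def)
  qed
qed

lemma model_sections_eqI:
  assumes "h \<in> carrier (model_sections 1 U)" "h' \<in> carrier (model_sections 1 U)"
    "\<And>x. x \<in> U \<Longrightarrow> h {} x = h' {} x" "\<And>x. x \<in> U \<Longrightarrow> h {0} x = h' {0} x"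
  shows "h = h'"
proof -
  have "model1 U (h {}) (h {0}) = model1 U (h' {}) (h' {0})"
    using assms(3,4) by (auto simp: model1_def intro!: ext)
  then show ?thesis using model_sections_cases(2)[OF assms(1)] model_sections_cases(2)[OF assms(2)] by simp
qed

lemma model1_nth [simp]:
  "x \<in> U \<Longrightarrow> model1 U u v {} x = u x" "x \<in> U \<Longrightarrow> model1 U u v {0} x = v x"
  by (auto simp: model1_def)

lemma shuffle_sign_empty [simp]: "shuffle_sign {} B = 1" "shuffle_sign A {} = 1"
  by (simp_all add: shuffle_sign_def)

lemma model_mult_nth:
  "(h \<otimes>\<^bsub>model_sections q U\<^esub> h') {} x = h {} x * h' {} x"
  "(h \<otimes>\<^bsub>model_sections q U\<^esub> h') {0} x = h {} x * h' {0} x + h {0} x * h' {} x"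
proof -
  have "Pow {0::nat} = {{}, {0}}" by auto
  then show "(h \<otimes>\<^bsub>model_sections q U\<^esub> h') {0} x = h {} x * h' {0} x + h {0} x * h' {} x"
    by (simp add: model_sections_def)
qed (simp add: model_sections_def)

lemma model_add_nth: "(h \<oplus>\<^bsub>model_sections q U\<^esub> h') S x = h S x + h' S x"
  by (simp add: model_sections_def)

lemma model_closed:
  assumes "open U" "h \<in> carrier (model_sections 1 U)" "h' \<in> carrier (model_sections 1 U)"
  shows model_mult_closed: "h \<otimes>\<^bsub>model_sections 1 U\<^esub> h' \<in> carrier (model_sections 1 U)"
    and model_add_closed: "h \<oplus>\<^bsub>model_sections 1 U\<^esub> h' \<in> carrier (model_sections 1 U)"
    and model_smult_closed: "c \<odot>\<^bsub>model_sections 1 U\<^esub> h \<in> carrier (model_sections 1 U)"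
proof -
  note sm = model_sections_cases(1)[OF assms(2)] model_sections_cases(1)[OF assms(3)]
  have z: "h S x = 0" "h' S x = 0" if "\<not> S \<subseteq> {..<1} \<or> x \<notin> U" for S x
    using assms that by (simp_all add: model_sections_def)
  let ?m = "model1 U (\<lambda>x. h {} x * h' {} x) (\<lambda>x. h {} x * h' {0} x + h {0} x * h' {} x)"
  have "(h \<otimes>\<^bsub>model_sections 1 U\<^esub> h') S x = ?m S x" for S x
  proof (cases "S \<subseteq> {..<1} \<and> x \<in> U")
    case True
    then have "S = {} \<or> S = {0}" using subset_lessThan_1 by blast
    moreover have "x \<in> U" using True by blast
    ultimately show ?thesis
      by (elim disjE) (simp_all only: model_mult_nth model1_nth)
  next
    case False
    \<comment> \<open>If S contains an index other than 0, that index lies in A or in S - A, so one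
      factor of the summand is a coefficient outside the allowed index sets.\<close>
    have "h A x = 0 \<or> h' (S - A) x = 0" if "A \<in> Pow S" for A
      using z[of A x] z[of "S - A" x] False that by blast
    then have "(h \<otimes>\<^bsub>model_sections 1 U\<^esub> h') S x = 0"
      unfolding model_sections_def by (auto intro!: sum.neutral)
    moreover have "?m S x = 0" using False unfolding subset_lessThan_1 by (auto simp: model1_def)
    ultimately show ?thesis by simp
  qed
  then have "h \<otimes>\<^bsub>model_sections 1 U\<^esub> h' = ?m" by blast
  then show "h \<otimes>\<^bsub>model_sections 1 U\<^esub> h' \<in> carrier (model_sections 1 U)"
    using sm by (auto intro!: model1_carrier smooth_on_add smooth_on_mult \<open>open U\<close>)
  have "smooth_on U (\<lambda>x. h S x + h' S x)" "smooth_on U (\<lambda>x. c * h S x)" for S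
    using sm by (auto intro!: smooth_on_add smooth_on_mult smooth_on_const \<open>open U\<close>)
  then show "h \<oplus>\<^bsub>model_sections 1 U\<^esub> h' \<in> carrier (model_sections 1 U)"
    "c \<odot>\<^bsub>model_sections 1 U\<^esub> h \<in> carrier (model_sections 1 U)"
    using z unfolding model_sections_def by auto
qed

lemma model_res_closed:
  assumes "h \<in> carrier (model_sections 1 U)" "open U'" "U' \<subseteq> U"
  shows "res (model_superspace 1) U U' h \<in> carrier (model_sections 1 U')"
proof -
  have "smooth_on U' (res (model_superspace 1) U U' h S)" for S
    by (rule smooth_on_cong[OF assms(2), of "h S"])
      (use model_sections_cases(1)[OF assms(1), of S] assms(3) in \<open>auto simp: model_superspace_def intro: smooth_on_subset\<close>)
  then show ?thesis
    using assms unfolding model_superspace_def model_sections_def by auto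
qed

lemma model_res_nth: "x \<in> U' \<Longrightarrow> res (model_superspace q) U U' h S x = h S x"
  by (simp add: model_superspace_def)

lemma model1_homog:
  assumes "open U" "smooth_on U u"
  shows "model1 U u (\<lambda>x. 0) \<in> homog (model_superspace 1) U 0"
    and "model1 U (\<lambda>x. 0) u \<in> homog (model_superspace 1) U 1"
proof -
  have "smooth_on U (\<lambda>x. 0)" using assms(1) by (rule smooth_on_const)
  then have c: "model1 U u (\<lambda>x. 0) \<in> carrier (model_sections 1 U)" "model1 U (\<lambda>x. 0) u \<in> carrier (model_sections 1 U)"
    using assms by simp_all
  show "model1 U u (\<lambda>x. 0) \<in> homog (model_superspace 1) U 0"
    using c(1) unfolding model_superspace_def by (auto simp: model1_def)
  show "model1 U (\<lambda>x. 0) u \<in> homog (model_superspace 1) U 1"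
    using c(2) unfolding model_superspace_def by (auto simp: model1_def)
qed

subsection \<open>Evaluation of sections at points of an atlas\<close>

text \<open>The order of the indices in \<open>nat\<close> matters for the partition of unity, where
  products run over all earlier charts and sums are cut off at an index.\<close>

locale superatlas =
  fixes M :: "('a::topological_space, 's) superspace"
    and V :: "nat \<Rightarrow> 'a set"
    and \<phi> :: "nat \<Rightarrow> 'a \<Rightarrow> real^'n::finite"
    and \<Phi> :: "nat \<Rightarrow> 'a set \<Rightarrow> 'n ssection \<Rightarrow> 's"
  assumes sheaf: "superalgebra_sheaf M"
    and chart: "superchart 1 M (V i) (\<phi> i) (\<Phi> i)"
    and cover: "(\<Union>i. V i) = UNIV"
begin

abbreviation sec :: "'a set \<Rightarrow> 's set" where "sec W \<equiv> carrier (sections M W)"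

lemma open_V [simp]: "open (V i)"
  by (rule superchartD(1)[OF chart])

lemma superalgebra_sec: "open W \<Longrightarrow> superalgebra (sections M W) (homog M W)"
  using sheaf[unfolded superalgebra_sheaf_def, THEN conjunct1] by blast

lemmas ring_sec = superalgebra_ring[OF superalgebra_sec]
  and smult_sec = superalgebra_smult_closed[OF superalgebra_sec]
  and homog_zero = superalgebra_homog_zero[OF superalgebra_sec]
  and homog_decomp = superalgebra_decomp[OF superalgebra_sec]

lemma homog_sec: "open W \<Longrightarrow> f \<in> homog M W p \<Longrightarrow> f \<in> sec W"
  using superalgebra_homog_subset[OF superalgebra_sec] by blast

lemma sec_closed:
  assumes "open W" "f \<in> sec W" "h \<in> sec W"
  shows "f \<oplus>\<^bsub>sections M W\<^esub> h \<in> sec W" "f \<otimes>\<^bsub>sections M W\<^esub> h \<in> sec W" "f \<ominus>\<^bsub>sections M W\<^esub> h \<in> sec W"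
  using ring.ring_simprules(1,4,5)[OF ring_sec] assms by blast+

lemma sec_zero_one: "open W \<Longrightarrow> \<zero>\<^bsub>sections M W\<^esub> \<in> sec W" "open W \<Longrightarrow> \<one>\<^bsub>sections M W\<^esub> \<in> sec W"
  using ring.ring_simprules(2,6)[OF ring_sec] by blast+

lemma res_hom:
  assumes "open U" "open W" "W \<subseteq> U"
  shows "res M U W \<in> superalgebra_hom (sections M U) (homog M U) (sections M W) (homog M W)"
  using sheaf[unfolded superalgebra_sheaf_def, THEN conjunct2, THEN conjunct1] assms by blast

lemma res_ring_hom:
  assumes "open U" "open W" "W \<subseteq> U"
  shows "res M U W \<in> ring_hom (sections M U) (sections M W)"
  by (rule superalgebra_homD(1)[OF res_hom[OF assms]])

lemma res_sec: "open U \<Longrightarrow> open W \<Longrightarrow> W \<subseteq> U \<Longrightarrow> f \<in> sec U \<Longrightarrow> res M U W f \<in> sec W"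
  using ring_hom_closed[OF res_ring_hom] by blast

lemma res_homog: "open U \<Longrightarrow> open W \<Longrightarrow> W \<subseteq> U \<Longrightarrow> f \<in> homog M U p \<Longrightarrow> res M U W f \<in> homog M W p"
  by (rule superalgebra_homD(3)[OF res_hom])

lemma res_id: "open U \<Longrightarrow> f \<in> sec U \<Longrightarrow> res M U U f = f"
  using sheaf[unfolded superalgebra_sheaf_def, THEN conjunct2, THEN conjunct2, THEN conjunct1] by blast

lemma res_res:
  "open U \<Longrightarrow> open W \<Longrightarrow> open W' \<Longrightarrow> W' \<subseteq> W \<Longrightarrow> W \<subseteq> U \<Longrightarrow> f \<in> sec U \<Longrightarrow>
    res M W W' (res M U W f) = res M U W' f"
  using sheaf[unfolded superalgebra_sheaf_def, THEN conjunct2, THEN conjunct2, THEN conjunct2, THEN conjunct1]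
  by blast

lemma sheaf_glue:
  assumes "\<And>U. U \<in> \<U> \<Longrightarrow> open U" "\<And>U. U \<in> \<U> \<Longrightarrow> s U \<in> sec U"
    "\<And>U U'. U \<in> \<U> \<Longrightarrow> U' \<in> \<U> \<Longrightarrow> res M U (U \<inter> U') (s U) = res M U' (U \<inter> U') (s U')"
  shows "\<exists>!f. f \<in> sec (\<Union>\<U>) \<and> (\<forall>U\<in>\<U>. res M (\<Union>\<U>) U f = s U)"
proof -
  have "(\<forall>U\<in>\<U>. open U \<and> s U \<in> sec U) \<and>
      (\<forall>U\<in>\<U>. \<forall>U'\<in>\<U>. res M U (U \<inter> U') (s U) = res M U' (U \<inter> U') (s U'))"
    using assms by blast
  then show ?thesis
    by (rule sheaf[unfolded superalgebra_sheaf_def, THEN conjunct2, THEN conjunct2, THEN conjunct2,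
          THEN conjunct2, rule_format])
qed

lemma sheaf_eqI:
  assumes U: "\<And>U. U \<in> \<U> \<Longrightarrow> open U" and fh: "f \<in> sec (\<Union>\<U>)" "h \<in> sec (\<Union>\<U>)"
    and eq: "\<And>U. U \<in> \<U> \<Longrightarrow> res M (\<Union>\<U>) U f = res M (\<Union>\<U>) U h"
  shows "f = h"
proof -
  have o: "open (\<Union>\<U>)" using U by blast
  have "\<exists>!k. k \<in> sec (\<Union>\<U>) \<and> (\<forall>U\<in>\<U>. res M (\<Union>\<U>) U k = res M (\<Union>\<U>) U f)"
  proof (rule sheaf_glue)
    fix W W' assume W: "W \<in> \<U>" "W' \<in> \<U>"
    then have "open W" "open W'" "open (W \<inter> W')" "W \<subseteq> \<Union>\<U>" "W' \<subseteq> \<Union>\<U>" using U by auto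
    then show "res M W (W \<inter> W') (res M (\<Union>\<U>) W f) = res M W' (W \<inter> W') (res M (\<Union>\<U>) W' f)"
      using o fh by (simp add: res_res)
  qed (use U o fh in \<open>auto intro!: res_sec\<close>)
  then show ?thesis using fh eq by (metis (mono_tags, lifting))
qed

section \<open>Sections in coordinates\<close>

definition loc :: "nat \<Rightarrow> 'a set \<Rightarrow> 's \<Rightarrow> 'n ssection" where
  "loc i W f = inv_into (carrier (model_sections 1 (\<phi> i ` W))) (\<Phi> i W) f"

lemma open_chart_image:
  assumes W: "open W" "W \<subseteq> V i"
  shows "open (\<phi> i ` W)"
proof -
  obtain \<psi> where h: "homeomorphism (V i) (\<phi> i ` V i) (\<phi> i) \<psi>" and o: "open (\<phi> i ` V i)"
    using superchartD(2,3)[OF chart[of i]] by blast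
  have "openin (top_of_set (V i)) W" using W by (simp add: openin_open_eq)
  then have "openin (top_of_set (\<phi> i ` V i)) (\<phi> i ` W)"
    using homeomorphism_imp_open_map[OF h] by blast
  then show ?thesis using o openin_open_eq by blast
qed

context
  fixes i :: nat and W :: "'a set"
  assumes W: "open W" "W \<subseteq> V i"
begin

lemma chart_hom:
  "\<Phi> i W \<in> superalgebra_hom (model_sections 1 (\<phi> i ` W)) (homog (model_superspace 1) (\<phi> i ` W))
     (sections M W) (homog M W)"
  by (rule superchartD(4)[OF chart W])

lemma chart_bij: "bij_betw (\<Phi> i W) (carrier (model_sections 1 (\<phi> i ` W))) (sec W)"
  by (rule superchartD(5)[OF chart W])

lemma chart_sec: "h \<in> carrier (model_sections 1 (\<phi> i ` W)) \<Longrightarrow> \<Phi> i W h \<in> sec W"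
  using chart_bij bij_betwE by blast

lemma loc_chart: "h \<in> carrier (model_sections 1 (\<phi> i ` W)) \<Longrightarrow> loc i W (\<Phi> i W h) = h"
  unfolding loc_def using chart_bij bij_betw_inv_into_left by metis

lemma chart_loc: "f \<in> sec W \<Longrightarrow> \<Phi> i W (loc i W f) = f"
  unfolding loc_def using chart_bij bij_betw_inv_into_right by metis

lemma loc_carrier: "f \<in> sec W \<Longrightarrow> loc i W f \<in> carrier (model_sections 1 (\<phi> i ` W))"
  unfolding loc_def using chart_bij bij_betw_imp_surj_on inv_into_into by metis

lemma loc_add: "f \<in> sec W \<Longrightarrow> h \<in> sec W \<Longrightarrow>
    loc i W (f \<oplus>\<^bsub>sections M W\<^esub> h) = loc i W f \<oplus>\<^bsub>model_sections 1 (\<phi> i ` W)\<^esub> loc i W h"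
proof -
  assume fh: "f \<in> sec W" "h \<in> sec W"
  note c = loc_carrier[OF fh(1)] loc_carrier[OF fh(2)]
  have "\<Phi> i W (loc i W f \<oplus>\<^bsub>model_sections 1 (\<phi> i ` W)\<^esub> loc i W h) = f \<oplus>\<^bsub>sections M W\<^esub> h"
    using ring_hom_add[OF superalgebra_homD(1)[OF chart_hom] c] by (simp add: chart_loc fh)
  then show ?thesis
    using loc_chart[OF model_add_closed[OF open_chart_image[OF W] c]] by simp
qed

lemma loc_mult: "f \<in> sec W \<Longrightarrow> h \<in> sec W \<Longrightarrow>
    loc i W (f \<otimes>\<^bsub>sections M W\<^esub> h) = loc i W f \<otimes>\<^bsub>model_sections 1 (\<phi> i ` W)\<^esub> loc i W h"
proof -
  assume fh: "f \<in> sec W" "h \<in> sec W"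
  note c = loc_carrier[OF fh(1)] loc_carrier[OF fh(2)]
  have "\<Phi> i W (loc i W f \<otimes>\<^bsub>model_sections 1 (\<phi> i ` W)\<^esub> loc i W h) = f \<otimes>\<^bsub>sections M W\<^esub> h"
    using ring_hom_mult[OF superalgebra_homD(1)[OF chart_hom] c] by (simp add: chart_loc fh)
  then show ?thesis
    using loc_chart[OF model_mult_closed[OF open_chart_image[OF W] c]] by simp
qed

lemma loc_smult: "f \<in> sec W \<Longrightarrow>
    loc i W (c \<odot>\<^bsub>sections M W\<^esub> f) = c \<odot>\<^bsub>model_sections 1 (\<phi> i ` W)\<^esub> loc i W f"
proof -
  assume f: "f \<in> sec W"
  have "\<Phi> i W (c \<odot>\<^bsub>model_sections 1 (\<phi> i ` W)\<^esub> loc i W f) = c \<odot>\<^bsub>sections M W\<^esub> \<Phi> i W (loc i W f)"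
    by (rule superalgebra_homD(2)[OF chart_hom loc_carrier[OF f]])
  then have "c \<odot>\<^bsub>sections M W\<^esub> f = \<Phi> i W (c \<odot>\<^bsub>model_sections 1 (\<phi> i ` W)\<^esub> loc i W f)"
    using f chart_loc by simp
  then show ?thesis
    using loc_chart[OF model_smult_closed[OF open_chart_image[OF W] loc_carrier[OF f] loc_carrier[OF f]]]
    by simp
qed

lemma loc_one: "x \<in> \<phi> i ` W \<Longrightarrow> loc i W \<one>\<^bsub>sections M W\<^esub> S x = (if S = {} then 1 else 0)"
proof -
  assume x: "x \<in> \<phi> i ` W"
  have one: "\<one>\<^bsub>model_sections 1 (\<phi> i ` W)\<^esub> = model1 (\<phi> i ` W) (\<lambda>x. 1) (\<lambda>x. 0)"
    by (auto simp: model_sections_def model1_def intro!: ext)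
  have "\<Phi> i W \<one>\<^bsub>model_sections 1 (\<phi> i ` W)\<^esub> = \<one>\<^bsub>sections M W\<^esub>"
    using superalgebra_homD(1)[OF chart_hom] ring_hom_one by blast
  moreover have "\<one>\<^bsub>model_sections 1 (\<phi> i ` W)\<^esub> \<in> carrier (model_sections 1 (\<phi> i ` W))"
    unfolding one by (intro model1_carrier open_chart_image[OF W] smooth_on_const)
  ultimately have "loc i W \<one>\<^bsub>sections M W\<^esub> = model1 (\<phi> i ` W) (\<lambda>x. 1) (\<lambda>x. 0)"
    using loc_chart one by metis
  then show ?thesis using x by (simp add: model1_def)
qed

lemma loc_res:
  assumes "f \<in> sec W" "open W'" "W' \<subseteq> W" "x \<in> \<phi> i ` W'"
  shows "loc i W' (res M W W' f) S x = loc i W f S x"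
proof -
  have oW': "open (\<phi> i ` W')" using open_chart_image assms W by blast
  let ?h = "res (model_superspace 1) (\<phi> i ` W) (\<phi> i ` W') (loc i W f)"
  have "?h \<in> carrier (model_sections 1 (\<phi> i ` W'))"
    using model_res_closed loc_carrier[OF assms(1)] oW' assms(3) by blast
  moreover have "res M W W' (\<Phi> i W (loc i W f)) = \<Phi> i W' ?h"
    by (rule superchartD(6)[OF chart W assms(2,3) loc_carrier[OF assms(1)]])
  moreover have "bij_betw (\<Phi> i W') (carrier (model_sections 1 (\<phi> i ` W'))) (sec W')"
    using superchartD(5)[OF chart assms(2)] assms(3) W by blast
  ultimately have "loc i W' (res M W W' f) = ?h"
    unfolding loc_def using chart_loc[OF assms(1)] bij_betw_inv_into_left loc_def by metis
  then show ?thesis using assms(4) by (simp add: model_res_nth)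
qed

end

text \<open>Restriction to \<open>W \<inter> V i\<close> gives a value for every open W, inside the
  chart domain or not. With the default 0 the rules for sums, products and scalars hold without a
  condition on m; the rule for the unit needs \<open>m \<in> W\<close> and
  \<open>m \<in> V i\<close>.\<close>

definition ev :: "nat \<Rightarrow> 'a \<Rightarrow> 'a set \<Rightarrow> 's \<Rightarrow> dual" where
  "ev i m W f = (if m \<in> W \<and> m \<in> V i
     then Dual (loc i (W \<inter> V i) (res M W (W \<inter> V i) f) {} (\<phi> i m))
               (loc i (W \<inter> V i) (res M W (W \<inter> V i) f) {0} (\<phi> i m))
     else 0)"

lemma ev_outside: "m \<notin> W \<or> m \<notin> V i \<Longrightarrow> ev i m W f = 0"
  by (auto simp: ev_def)

lemma ev_chart:
  assumes "open W" "W \<subseteq> V i" "m \<in> W" "f \<in> sec W"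
  shows "ev i m W f = Dual (loc i W f {} (\<phi> i m)) (loc i W f {0} (\<phi> i m))"
proof -
  have "W \<inter> V i = W" using assms by blast
  then show ?thesis using assms res_id by (auto simp: ev_def)
qed

context
  fixes W :: "'a set"
  assumes W: "open W"
begin

lemma ev_add:
  assumes "f \<in> sec W" "h \<in> sec W"
  shows "ev i m W (f \<oplus>\<^bsub>sections M W\<^esub> h) = ev i m W f + ev i m W h"
proof -
  let ?W = "W \<inter> V i"
  have o: "open ?W" "?W \<subseteq> V i" "?W \<subseteq> W" using W by auto
  have "res M W ?W (f \<oplus>\<^bsub>sections M W\<^esub> h) = res M W ?W f \<oplus>\<^bsub>sections M ?W\<^esub> res M W ?W h"
    using ring_hom_add[OF res_ring_hom] W o assms by blast
  then show ?thesis
    using loc_add[OF o(1,2)] res_sec[OF W o(1,3)] assms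
    by (auto simp: ev_def plus_dual_def model_add_nth zero_dual_def)
qed

lemma ev_mult:
  assumes "f \<in> sec W" "h \<in> sec W"
  shows "ev i m W (f \<otimes>\<^bsub>sections M W\<^esub> h) = ev i m W f * ev i m W h"
proof -
  let ?W = "W \<inter> V i"
  have o: "open ?W" "?W \<subseteq> V i" "?W \<subseteq> W" using W by auto
  have "res M W ?W (f \<otimes>\<^bsub>sections M W\<^esub> h) = res M W ?W f \<otimes>\<^bsub>sections M ?W\<^esub> res M W ?W h"
    using ring_hom_mult[OF res_ring_hom] W o assms by blast
  then show ?thesis
    using loc_mult[OF o(1,2)] res_sec[OF W o(1,3)] assms
    by (auto simp: ev_def times_dual_def model_mult_nth zero_dual_def)
qed

lemma ev_smult:
  assumes "f \<in> sec W"
  shows "ev i m W (c \<odot>\<^bsub>sections M W\<^esub> f) = c *\<^sub>R ev i m W f"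
proof -
  let ?W = "W \<inter> V i"
  have o: "open ?W" "?W \<subseteq> V i" "?W \<subseteq> W" using W by auto
  have "res M W ?W (c \<odot>\<^bsub>sections M W\<^esub> f) = c \<odot>\<^bsub>sections M ?W\<^esub> res M W ?W f"
    by (rule superalgebra_homD(2)[OF res_hom[OF W o(1,3)] assms])
  then show ?thesis
    using loc_smult[OF o(1,2)] res_sec[OF W o(1,3)] assms
    by (auto simp: ev_def scaleR_dual_def model_sections_def zero_dual_def)
qed

lemma ev_zero [simp]: "ev i m W \<zero>\<^bsub>sections M W\<^esub> = 0"
proof -
  interpret R: ring "sections M W" using ring_sec[OF W] .
  have "ev i m W \<zero>\<^bsub>sections M W\<^esub> = ev i m W \<zero>\<^bsub>sections M W\<^esub> + ev i m W \<zero>\<^bsub>sections M W\<^esub>"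
    using ev_add[of "\<zero>\<^bsub>sections M W\<^esub>" "\<zero>\<^bsub>sections M W\<^esub>" i m] by simp
  then show ?thesis by simp
qed

lemma ev_minus:
  assumes "f \<in> sec W" "h \<in> sec W"
  shows "ev i m W (f \<ominus>\<^bsub>sections M W\<^esub> h) = ev i m W f - ev i m W h"
proof -
  interpret R: ring "sections M W" using ring_sec[OF W] .
  have "(f \<ominus>\<^bsub>sections M W\<^esub> h) \<oplus>\<^bsub>sections M W\<^esub> h = f"
    using assms by (simp add: R.minus_eq R.a_assoc R.l_neg)
  then show ?thesis
    using ev_add[of "f \<ominus>\<^bsub>sections M W\<^esub> h" h i m] assms by (simp add: algebra_simps)
qed

lemma ev_one: "m \<in> W \<Longrightarrow> m \<in> V i \<Longrightarrow> ev i m W \<one>\<^bsub>sections M W\<^esub> = 1"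
proof -
  assume m: "m \<in> W" "m \<in> V i"
  let ?W = "W \<inter> V i"
  have o: "open ?W" "?W \<subseteq> V i" "?W \<subseteq> W" using W by auto
  have "res M W ?W \<one>\<^bsub>sections M W\<^esub> = \<one>\<^bsub>sections M ?W\<^esub>"
    using ring_hom_one[OF res_ring_hom] W o by blast
  then show ?thesis
    using loc_one[OF o(1,2), of "\<phi> i m"] m by (auto simp: ev_def one_dual_def)
qed

lemma ev_res:
  assumes "f \<in> sec W" "open W'" "W' \<subseteq> W"
  shows "ev i m W' (res M W W' f) = (if m \<in> W' then ev i m W f else 0)"
proof (cases "m \<in> W' \<and> m \<in> V i")
  case True
  let ?W = "W \<inter> V i" and ?W' = "W' \<inter> V i"
  have o: "open ?W" "?W \<subseteq> V i" "?W \<subseteq> W" "open ?W'" "?W' \<subseteq> ?W" "?W' \<subseteq> W'" "?W' \<subseteq> W"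
    using W assms by auto
  have "res M W' ?W' (res M W W' f) = res M W ?W' f"
    using res_res[OF W assms(2) o(4,6) assms(3,1)] .
  also have "\<dots> = res M ?W ?W' (res M W ?W f)"
    using res_res[OF W o(1,4,5,3) assms(1)] by simp
  finally have "loc i ?W' (res M W' ?W' (res M W W' f)) S (\<phi> i m) = loc i ?W (res M W ?W f) S (\<phi> i m)" for S
    using loc_res[OF o(1,2) res_sec[OF W o(1,3) assms(1)] o(4,5)] True by simp
  then show ?thesis using True assms by (auto simp: ev_def)
qed (auto simp: ev_outside)

end

section \<open>Sections are determined by their values and glued from them\<close>

lemma sec_eq_chartI:
  assumes "open W" "W \<subseteq> V i" "f \<in> sec W" "h \<in> sec W" "\<And>m. m \<in> W \<Longrightarrow> ev i m W f = ev i m W h"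
  shows "f = h"
proof -
  have "loc i W f = loc i W h"
    using ev_chart[OF assms(1,2)] assms(3-5)
    by (intro model_sections_eqI[of _ "\<phi> i ` W"] loc_carrier assms) force+
  then show ?thesis using chart_loc[OF assms(1,2)] assms(3,4) by metis
qed

text \<open>The bijectivity of the charts gives the equality over each
  \<open>W \<inter> V i\<close>, and the uniqueness clause of the sheaf axiom gives it over
  W.\<close>

lemma sec_eqI:
  assumes W: "open W" and fh: "f \<in> sec W" "h \<in> sec W" and eq: "\<And>i m. ev i m W f = ev i m W h"
  shows "f = h"
proof (rule sheaf_eqI[of "range (\<lambda>i. W \<inter> V i)"])
  have U: "\<Union> (range (\<lambda>i. W \<inter> V i)) = W" using cover by blast
  show "f \<in> sec (\<Union> (range (\<lambda>i. W \<inter> V i)))" "h \<in> sec (\<Union> (range (\<lambda>i. W \<inter> V i)))"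
    unfolding U using fh by auto
  fix U assume "U \<in> range (\<lambda>i. W \<inter> V i)"
  then obtain i where i: "U = W \<inter> V i" by blast
  then show oU: "open U" using W by auto
  show "res M (\<Union> (range (\<lambda>i. W \<inter> V i))) U f = res M (\<Union> (range (\<lambda>i. W \<inter> V i))) U h"
    unfolding U by (rule sec_eq_chartI[OF oU, of i]) (use i oU W fh eq in \<open>auto intro!: res_sec simp: ev_res\<close>)
qed

text \<open>A chart is only known to map homogeneous model sections to homogeneous sections, and the
  converse is needed here. The coordinate expression h is split into its even and odd parts; their
  images give the decomposition of the section, which is unique, so the image of the part of the
  wrong parity is zero and that part vanishes.\<close>

lemma ev_homog:
  assumes W: "open W" and f: "f \<in> homog M W p"
  shows "ev i m W f \<in> dual_hom p"
proof (cases "m \<in> W \<and> m \<in> V i")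
  case True
  let ?W = "W \<inter> V i"
  let ?U = "\<phi> i ` ?W"
  have o: "open ?W" "?W \<subseteq> V i" "?W \<subseteq> W" using W by auto
  define f' where "f' = res M W ?W f"
  have f': "f' \<in> homog M ?W p" "f' \<in> sec ?W"
    using res_homog[OF W o(1,3) f] homog_sec[OF o(1)] by (auto simp: f'_def)
  define h where "h = loc i ?W f'"
  have hc: "h \<in> carrier (model_sections 1 ?U)"
    unfolding h_def using loc_carrier o f' by blast
  have oU: "open ?U" using open_chart_image[OF o(1,2)] .
  let ?h0 = "model1 ?U (h {}) (\<lambda>x. 0)" and ?h1 = "model1 ?U (\<lambda>x. 0) (h {0})"
  have h01: "?h0 \<in> homog (model_superspace 1) ?U 0" "?h1 \<in> homog (model_superspace 1) ?U 1"
    using model1_homog[OF oU] model_sections_cases(1)[OF hc] by blast+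
  have hc01: "?h0 \<in> carrier (model_sections 1 ?U)" "?h1 \<in> carrier (model_sections 1 ?U)"
    using oU model_sections_cases(1)[OF hc] by (auto simp: smooth_on_const)
  have "h = ?h0 \<oplus>\<^bsub>model_sections 1 ?U\<^esub> ?h1"
    by (rule model_sections_eqI[OF hc model_add_closed]) (use oU hc01 in \<open>auto simp: model_add_nth\<close>)
  moreover have "\<Phi> i ?W \<in> ring_hom (model_sections 1 ?U) (sections M ?W)"
    by (rule superalgebra_homD(1)[OF chart_hom[OF o(1,2)]])
  ultimately have f'_eq: "f' = \<Phi> i ?W ?h0 \<oplus>\<^bsub>sections M ?W\<^esub> \<Phi> i ?W ?h1"
    using ring_hom_add hc01 chart_loc[OF o(1,2) f'(2)] h_def by metis
  have ph: "\<Phi> i ?W ?h0 \<in> homog M ?W 0" "\<Phi> i ?W ?h1 \<in> homog M ?W 1"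
    using superalgebra_homD(3)[OF chart_hom[OF o(1,2)]] h01 by blast+
  interpret R: ring "sections M ?W" using ring_sec[OF o(1)] .
  have x: "\<phi> i m \<in> ?U" using True by blast
  have z: "loc i ?W \<zero>\<^bsub>sections M ?W\<^esub> {} (\<phi> i m) = 0" "loc i ?W \<zero>\<^bsub>sections M ?W\<^esub> {0} (\<phi> i m) = 0"
    using ev_zero[OF o(1), of i m] ev_chart[OF o(1,2), of m "\<zero>\<^bsub>sections M ?W\<^esub>"] True
    by (auto simp: zero_dual_def)
  have "if p = 0 then h {0} (\<phi> i m) = 0 else h {} (\<phi> i m) = 0"
  proof (cases "p = 0")
    case 0: True
    then have "f' \<oplus>\<^bsub>sections M ?W\<^esub> \<zero>\<^bsub>sections M ?W\<^esub> = \<Phi> i ?W ?h0 \<oplus>\<^bsub>sections M ?W\<^esub> \<Phi> i ?W ?h1"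
      using f' f'_eq by simp
    then have "\<zero>\<^bsub>sections M ?W\<^esub> = \<Phi> i ?W ?h1"
      using superalgebra_decomp_unique(2)[OF superalgebra_sec[OF o(1)]] f' 0 ph homog_zero[OF o(1)] by metis
    then show ?thesis using loc_chart[OF o(1,2) hc01(2)] z x 0 by (metis model1_nth(2))
  next
    case False
    then have 1: "p = 1" by simp
    then have "\<zero>\<^bsub>sections M ?W\<^esub> \<oplus>\<^bsub>sections M ?W\<^esub> f' = \<Phi> i ?W ?h0 \<oplus>\<^bsub>sections M ?W\<^esub> \<Phi> i ?W ?h1"
      using f' f'_eq by simp
    then have "\<zero>\<^bsub>sections M ?W\<^esub> = \<Phi> i ?W ?h0"
      using superalgebra_decomp_unique(1)[OF superalgebra_sec[OF o(1)]] f' 1 ph homog_zero[OF o(1)] by metis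
    then show ?thesis using loc_chart[OF o(1,2) hc01(1)] z x 1 by (metis model1_nth(1) zero_neq_one)
  qed
  then show ?thesis
    using True by (auto simp: ev_def dual_hom_def h_def f'_def)
qed (auto simp: ev_outside)

text \<open>Existence of sections with prescribed values is a local question: local solutions have
  equal values on overlaps, hence are equal there, and the sheaf axiom glues them.\<close>

lemma ev_glue:
  assumes W: "open W"
    and locally: "\<And>m. m \<in> W \<Longrightarrow> \<exists>N h. open N \<and> m \<in> N \<and> N \<subseteq> W \<and> h \<in> sec N \<and>
      (\<forall>i. \<forall>m'\<in>N. m' \<in> V i \<longrightarrow> ev i m' N h = u i m')"
  shows "\<exists>h\<in>sec W. \<forall>i. \<forall>m\<in>W. m \<in> V i \<longrightarrow> ev i m W h = u i m"
proof -
  define good where "good N h \<longleftrightarrow> open N \<and> N \<subseteq> W \<and> h \<in> sec N \<and> 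
      (\<forall>i. \<forall>m'\<in>N. m' \<in> V i \<longrightarrow> ev i m' N h = u i m')" for N h
  define \<U> where "\<U> = {N. \<exists>h. good N h}"
  define s where "s N = (SOME h. good N h)" for N
  have s: "good N (s N)" if "N \<in> \<U>" for N
    using that unfolding \<U>_def s_def by (auto intro: someI_ex)
  have U: "\<Union>\<U> = W"
  proof
    show "\<Union>\<U> \<subseteq> W" unfolding \<U>_def good_def by auto
    show "W \<subseteq> \<Union>\<U>"
    proof
      fix m assume "m \<in> W"
      then obtain N h where "good N h" "m \<in> N" using locally[of m] unfolding good_def by auto
      then show "m \<in> \<Union>\<U>" unfolding \<U>_def by auto
    qed
  qed
  have "\<exists>!f. f \<in> sec (\<Union>\<U>) \<and> (\<forall>U\<in>\<U>. res M (\<Union>\<U>) U f = s U)"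
  proof (rule sheaf_glue)
    fix N N' assume N: "N \<in> \<U>" "N' \<in> \<U>"
    note sN = s[OF N(1), unfolded good_def] and sN' = s[OF N(2), unfolded good_def]
    have o: "open (N \<inter> N')" using sN sN' by auto
    show "res M N (N \<inter> N') (s N) = res M N' (N \<inter> N') (s N')"
    proof (rule sec_eqI[OF o])
      fix i m
      show "ev i m (N \<inter> N') (res M N (N \<inter> N') (s N)) = ev i m (N \<inter> N') (res M N' (N \<inter> N') (s N'))"
        using sN sN' o by (cases "m \<in> N \<inter> N' \<and> m \<in> V i") (auto simp: ev_res ev_outside)
    qed (use sN sN' o in \<open>auto intro!: res_sec\<close>)
  qed (use s in \<open>auto simp: good_def\<close>)
  then obtain f where f: "f \<in> sec W" "\<And>N. N \<in> \<U> \<Longrightarrow> res M W N f = s N"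
    unfolding U by blast
  have "ev i m W f = u i m" if m: "m \<in> W" "m \<in> V i" for i m
  proof -
    obtain N where N: "N \<in> \<U>" "m \<in> N" using m(1) U by blast
    note sN = s[OF N(1), unfolded good_def]
    have "ev i m W f = ev i m N (res M W N f)" using ev_res[OF W f(1)] sN N by simp
    also have "\<dots> = u i m" using f(2)[OF N(1)] sN N m by simp
    finally show ?thesis .
  qed
  then show ?thesis using f(1) by blast
qed

text \<open>Finite sums of sections are used only through their values, so a section with the summed
  values is all that is required.\<close>

lemma ev_sum_exists:
  assumes W: "open W" and "finite I" "\<And>j. j \<in> I \<Longrightarrow> s j \<in> sec W"
  shows "\<exists>h\<in>sec W. \<forall>i m. ev i m W h = (\<Sum>j\<in>I. ev i m W (s j))"
  using assms(2,3)
proof (induction I)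
  case empty
  then show ?case using sec_zero_one(1)[OF W] ev_zero[OF W] by (intro bexI[of _ "\<zero>\<^bsub>sections M W\<^esub>"]) auto
next
  case (insert j I)
  then obtain h where "h \<in> sec W" "\<forall>i m. ev i m W h = (\<Sum>j\<in>I. ev i m W (s j))" by auto
  then show ?case using insert W
    by (intro bexI[of _ "s j \<oplus>\<^bsub>sections M W\<^esub> h"]) (auto simp: ev_add sec_closed)
qed

end

subsection \<open>Vector fields\<close>

lemma vext_apply: "open W \<Longrightarrow> W \<subseteq> U \<Longrightarrow> f \<in> carrier (sections M W) \<Longrightarrow> vext M U X W f = X W f"
  by (simp add: vext_def)

lemma vadd_apply: "open W \<Longrightarrow> W \<subseteq> U \<Longrightarrow> f \<in> carrier (sections M W) \<Longrightarrow>
    vadd M U X Y W f = X W f \<oplus>\<^bsub>sections M W\<^esub> Y W f"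
  by (simp add: vadd_def vext_apply)

lemma vscale_apply: "open W \<Longrightarrow> W \<subseteq> U \<Longrightarrow> f \<in> carrier (sections M W) \<Longrightarrow>
    vscale M U h X W f = res M U W h \<otimes>\<^bsub>sections M W\<^esub> X W f"
  by (simp add: vscale_def vext_apply)

lemma vzero_apply: "open W \<Longrightarrow> W \<subseteq> U \<Longrightarrow> f \<in> carrier (sections M W) \<Longrightarrow>
    vzero M U W f = \<zero>\<^bsub>sections M W\<^esub>"
  by (simp add: vzero_def vext_apply)

lemma vext_eqI:
  assumes "vext M U X = X" "vext M U Y = Y"
    "\<And>W f. open W \<Longrightarrow> W \<subseteq> U \<Longrightarrow> f \<in> carrier (sections M W) \<Longrightarrow> X W f = Y W f"
  shows "X = Y"
proof -
  have "vext M U X = vext M U Y" using assms(3) by (auto simp: vext_def intro!: ext)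
  then show ?thesis using assms(1,2) by simp
qed

lemma vext_vext [simp]: "vext M U (vext M U X) = vext M U X"
  by (auto simp: vext_def intro!: ext)

lemma vext_vadd [simp]: "vext M U (vadd M U X Y) = vadd M U X Y"
  by (simp add: vadd_def)

lemma vext_vscale [simp]: "vext M U (vscale M U h X) = vscale M U h X"
  by (simp add: vscale_def)

lemma vext_vzero [simp]: "vext M U (vzero M U) = vzero M U"
  by (simp add: vzero_def)

lemma vect_homD:
  assumes "X \<in> vect_hom M U p"
  shows "vext M U X = X"
    and "open W \<Longrightarrow> W \<subseteq> U \<Longrightarrow> f \<in> carrier (sections M W) \<Longrightarrow> X W f \<in> carrier (sections M W)"
    and "open W \<Longrightarrow> W \<subseteq> U \<Longrightarrow> f \<in> carrier (sections M W) \<Longrightarrow> h \<in> carrier (sections M W) \<Longrightarrow>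
      X W (f \<oplus>\<^bsub>sections M W\<^esub> h) = X W f \<oplus>\<^bsub>sections M W\<^esub> X W h"
    and "open W \<Longrightarrow> W \<subseteq> U \<Longrightarrow> f \<in> carrier (sections M W) \<Longrightarrow>
      X W (c \<odot>\<^bsub>sections M W\<^esub> f) = c \<odot>\<^bsub>sections M W\<^esub> X W f"
    and "open W \<Longrightarrow> W \<subseteq> U \<Longrightarrow> f \<in> homog M W r \<Longrightarrow> X W f \<in> homog M W (p + r)"
    and "open W \<Longrightarrow> W \<subseteq> U \<Longrightarrow> f \<in> homog M W r \<Longrightarrow> h \<in> carrier (sections M W) \<Longrightarrow>
      X W (f \<otimes>\<^bsub>sections M W\<^esub> h) = (X W f \<otimes>\<^bsub>sections M W\<^esub> h) \<oplus>\<^bsub>sections M W\<^esub>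
        (psign p r \<odot>\<^bsub>sections M W\<^esub> (f \<otimes>\<^bsub>sections M W\<^esub> X W h))"
    and "open W \<Longrightarrow> W \<subseteq> U \<Longrightarrow> open W' \<Longrightarrow> W' \<subseteq> W \<Longrightarrow> f \<in> carrier (sections M W) \<Longrightarrow>
      X W' (res M W W' f) = res M W W' (X W f)"
proof -
  note h = assms[unfolded vect_hom_def mem_Collect_eq]
  note h2 = h[THEN conjunct2, THEN conjunct1, THEN spec, THEN mp, OF conjI]
  note h3 = h[THEN conjunct2, THEN conjunct2, THEN spec, THEN spec, THEN mp, OF conjI]
  show "vext M U X = X" using h by (rule conjunct1)
  assume W: "open W" "W \<subseteq> U"
  note hW = h2[OF W]
  show "f \<in> carrier (sections M W) \<Longrightarrow> X W f \<in> carrier (sections M W)"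
    using hW[THEN conjunct1] by (rule bspec)
  show "f \<in> carrier (sections M W) \<Longrightarrow> h \<in> carrier (sections M W) \<Longrightarrow>
      X W (f \<oplus>\<^bsub>sections M W\<^esub> h) = X W f \<oplus>\<^bsub>sections M W\<^esub> X W h"
    using hW[THEN conjunct2, THEN conjunct1] by blast
  show "f \<in> carrier (sections M W) \<Longrightarrow> X W (c \<odot>\<^bsub>sections M W\<^esub> f) = c \<odot>\<^bsub>sections M W\<^esub> X W f"
    using hW[THEN conjunct2, THEN conjunct2, THEN conjunct1, THEN spec] by (rule bspec)
  show "f \<in> homog M W r \<Longrightarrow> X W f \<in> homog M W (p + r)"
    using hW[THEN conjunct2, THEN conjunct2, THEN conjunct2, THEN conjunct1, THEN spec] by (rule bspec)
  show "f \<in> homog M W r \<Longrightarrow> h \<in> carrier (sections M W) \<Longrightarrow>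
      X W (f \<otimes>\<^bsub>sections M W\<^esub> h) = (X W f \<otimes>\<^bsub>sections M W\<^esub> h) \<oplus>\<^bsub>sections M W\<^esub>
        (psign p r \<odot>\<^bsub>sections M W\<^esub> (f \<otimes>\<^bsub>sections M W\<^esub> X W h))"
    using hW[THEN conjunct2, THEN conjunct2, THEN conjunct2, THEN conjunct2, THEN spec] by blast
  show "open W' \<Longrightarrow> W' \<subseteq> W \<Longrightarrow> f \<in> carrier (sections M W) \<Longrightarrow>
      X W' (res M W W' f) = res M W W' (X W f)"
    using h3[OF W(1) conjI, OF W(2) conjI] by blast
qed

lemma vect_homI:
  assumes "vext M U X = X"
    and "\<And>W f. open W \<Longrightarrow> W \<subseteq> U \<Longrightarrow> f \<in> carrier (sections M W) \<Longrightarrow> X W f \<in> carrier (sections M W)"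
    and "\<And>W f h. open W \<Longrightarrow> W \<subseteq> U \<Longrightarrow> f \<in> carrier (sections M W) \<Longrightarrow> h \<in> carrier (sections M W) \<Longrightarrow>
      X W (f \<oplus>\<^bsub>sections M W\<^esub> h) = X W f \<oplus>\<^bsub>sections M W\<^esub> X W h"
    and "\<And>W f c. open W \<Longrightarrow> W \<subseteq> U \<Longrightarrow> f \<in> carrier (sections M W) \<Longrightarrow>
      X W (c \<odot>\<^bsub>sections M W\<^esub> f) = c \<odot>\<^bsub>sections M W\<^esub> X W f"
    and "\<And>W f r. open W \<Longrightarrow> W \<subseteq> U \<Longrightarrow> f \<in> homog M W r \<Longrightarrow> X W f \<in> homog M W (p + r)"
    and "\<And>W f h r. open W \<Longrightarrow> W \<subseteq> U \<Longrightarrow> f \<in> homog M W r \<Longrightarrow> h \<in> carrier (sections M W) \<Longrightarrow>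
      X W (f \<otimes>\<^bsub>sections M W\<^esub> h) = (X W f \<otimes>\<^bsub>sections M W\<^esub> h) \<oplus>\<^bsub>sections M W\<^esub>
        (psign p r \<odot>\<^bsub>sections M W\<^esub> (f \<otimes>\<^bsub>sections M W\<^esub> X W h))"
    and "\<And>W W' f. open W \<Longrightarrow> W \<subseteq> U \<Longrightarrow> open W' \<Longrightarrow> W' \<subseteq> W \<Longrightarrow> f \<in> carrier (sections M W) \<Longrightarrow>
      X W' (res M W W' f) = res M W W' (X W f)"
  shows "X \<in> vect_hom M U p"
  unfolding vect_hom_def mem_Collect_eq
  by (intro conjI allI ballI impI; (elim conjE)?; rule assms; assumption)

section \<open>Sum and product rules for partial derivatives\<close>

lemma partial_deriv_add:
  "f differentiable (at x) \<Longrightarrow> g differentiable (at x) \<Longrightarrow>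
    partial_deriv i (\<lambda>x. f x + g x) x = partial_deriv i f x + partial_deriv i g x"
  unfolding partial_deriv_def[of i f] partial_deriv_def[of i g]
  by (rule partial_deriv_eqI) (intro has_derivative_add; simp add: frechet_derivative_works)

lemma partial_deriv_mult:
  "f differentiable (at x) \<Longrightarrow> g differentiable (at x) \<Longrightarrow>
    partial_deriv i (\<lambda>x. f x * g x) x = f x * partial_deriv i g x + partial_deriv i f x * g x"
  unfolding partial_deriv_def[of i f] partial_deriv_def[of i g]
  by (rule partial_deriv_eqI) (intro has_derivative_mult; simp add: frechet_derivative_works)

lemma partial_deriv_const: "partial_deriv i (\<lambda>x. c) x = 0"
  by (rule partial_deriv_eqI) simp

context superatlas
begin

text \<open>The charts in I suffice to compare sections over the open subsets of U. This covers two
  situations at once: global objects are compared in all charts, and objects over a single chart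
  domain in that chart alone, which is the only one where their values are computed.\<close>

definition determining :: "nat set \<Rightarrow> 'a set \<Rightarrow> bool" where
  "determining I U \<longleftrightarrow> (\<forall>W f h. open W \<longrightarrow> W \<subseteq> U \<longrightarrow> f \<in> sec W \<longrightarrow> h \<in> sec W \<longrightarrow>
     (\<forall>i\<in>I. \<forall>m\<in>W. m \<in> V i \<longrightarrow> ev i m W f = ev i m W h) \<longrightarrow> f = h)"

lemma determining_UNIV: "determining UNIV U"
  unfolding determining_def using sec_eqI ev_outside by (metis UNIV_I)

lemma determining_chart: "U \<subseteq> V j \<Longrightarrow> determining {j} U"
  unfolding determining_def using sec_eq_chartI by blast

lemma determiningD:
  "determining I U \<Longrightarrow> open W \<Longrightarrow> W \<subseteq> U \<Longrightarrow> f \<in> sec W \<Longrightarrow> h \<in> sec W \<Longrightarrow>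
    (\<And>i m. i \<in> I \<Longrightarrow> m \<in> W \<Longrightarrow> m \<in> V i \<Longrightarrow> ev i m W f = ev i m W h) \<Longrightarrow> f = h"
  unfolding determining_def by simp

text \<open>The component of f of the wrong parity has value zero in the determining charts, so it
  is the zero section.\<close>

lemma homogI:
  assumes I: "determining I U" and W: "open W" "W \<subseteq> U" and f: "f \<in> sec W"
    and ev: "\<And>i m. i \<in> I \<Longrightarrow> m \<in> W \<Longrightarrow> m \<in> V i \<Longrightarrow> ev i m W f \<in> dual_hom p"
  shows "f \<in> homog M W p"
proof -
  obtain y z where yz: "y \<in> homog M W 0" "z \<in> homog M W 1" "f = y \<oplus>\<^bsub>sections M W\<^esub> z"
    using homog_decomp[OF W(1) f] by blast
  have yzc: "y \<in> sec W" "z \<in> sec W" using yz homog_sec W by auto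
  have evy: "ev i m W y \<in> dual_hom 0" and evz: "ev i m W z \<in> dual_hom 1" for i m
    using ev_homog W yz by auto
  have evf: "ev i m W f = ev i m W y + ev i m W z" for i m using ev_add[OF W(1)] yz yzc by simp
  interpret R: ring "sections M W" using ring_sec[OF W(1)] .
  show "f \<in> homog M W p"
  proof (cases "p = 0")
    case 0: True
    have "z = \<zero>\<^bsub>sections M W\<^esub>"
    proof (rule determiningD[OF I W yzc(2)])
      fix i m assume "i \<in> I" "m \<in> W" "m \<in> V i"
      then show "ev i m W z = ev i m W \<zero>\<^bsub>sections M W\<^esub>"
        using evf[of i m] evz[of i m] evy[of i m] ev[of i m] 0 W by (auto simp: dual_hom_def dual_eq_iff)
    qed simp
    then show ?thesis using yz yzc 0 by simp
  next
    case False
    then have 1: "p = 1" by simp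
    have "y = \<zero>\<^bsub>sections M W\<^esub>"
    proof (rule determiningD[OF I W yzc(1)])
      fix i m assume "i \<in> I" "m \<in> W" "m \<in> V i"
      then show "ev i m W y = ev i m W \<zero>\<^bsub>sections M W\<^esub>"
        using evf[of i m] evz[of i m] evy[of i m] ev[of i m] 1 W by (auto simp: dual_hom_def dual_eq_iff)
    qed simp
    then show ?thesis using yz yzc 1 by simp
  qed
qed

text \<open>The laws of a superderivation are equations between sections and statements about their
  parity, so they may be checked on the values in a determining family of charts.\<close>

lemma vect_hom_evI:
  assumes I: "determining I U" and ext: "vext M U X = X"
    and closed: "\<And>W f. open W \<Longrightarrow> W \<subseteq> U \<Longrightarrow> f \<in> sec W \<Longrightarrow> X W f \<in> sec W"
    and add: "\<And>W f h i m. open W \<Longrightarrow> W \<subseteq> U \<Longrightarrow> f \<in> sec W \<Longrightarrow> h \<in> sec W \<Longrightarrow> i \<in> I \<Longrightarrow> m \<in> W \<Longrightarrow> m \<in> V i \<Longrightarrow>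
      ev i m W (X W (f \<oplus>\<^bsub>sections M W\<^esub> h)) = ev i m W (X W f) + ev i m W (X W h)"
    and smult: "\<And>W f c i m. open W \<Longrightarrow> W \<subseteq> U \<Longrightarrow> f \<in> sec W \<Longrightarrow> i \<in> I \<Longrightarrow> m \<in> W \<Longrightarrow> m \<in> V i \<Longrightarrow>
      ev i m W (X W (c \<odot>\<^bsub>sections M W\<^esub> f)) = c *\<^sub>R ev i m W (X W f)"
    and hom: "\<And>W f r i m. open W \<Longrightarrow> W \<subseteq> U \<Longrightarrow> f \<in> homog M W r \<Longrightarrow> i \<in> I \<Longrightarrow> m \<in> W \<Longrightarrow> m \<in> V i \<Longrightarrow>
      ev i m W (X W f) \<in> dual_hom (p + r)"
    and leibniz: "\<And>W f h r i m. open W \<Longrightarrow> W \<subseteq> U \<Longrightarrow> f \<in> homog M W r \<Longrightarrow> h \<in> sec W \<Longrightarrow> i \<in> I \<Longrightarrow> m \<in> W \<Longrightarrow> m \<in> V i \<Longrightarrow>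
      ev i m W (X W (f \<otimes>\<^bsub>sections M W\<^esub> h)) =
        ev i m W (X W f) * ev i m W h + psign p r *\<^sub>R (ev i m W f * ev i m W (X W h))"
    and res: "\<And>W W' f i m. open W \<Longrightarrow> W \<subseteq> U \<Longrightarrow> open W' \<Longrightarrow> W' \<subseteq> W \<Longrightarrow> f \<in> sec W \<Longrightarrow> i \<in> I \<Longrightarrow> m \<in> W' \<Longrightarrow> m \<in> V i \<Longrightarrow>
      ev i m W' (X W' (res M W W' f)) = ev i m W (X W f)"
  shows "X \<in> vect_hom M U p"
proof (rule vect_homI[OF ext closed])
  fix W assume W: "open W" "W \<subseteq> U"
  note ops = sec_closed[OF W(1)] smult_sec[OF W(1)]
  show "X W (f \<oplus>\<^bsub>sections M W\<^esub> h) = X W f \<oplus>\<^bsub>sections M W\<^esub> X W h"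
    if "f \<in> sec W" "h \<in> sec W" for f h
    by (rule determiningD[OF I W]) (use that W in \<open>simp_all add: closed ops add ev_add\<close>)
  show "X W (c \<odot>\<^bsub>sections M W\<^esub> f) = c \<odot>\<^bsub>sections M W\<^esub> X W f"
    if "f \<in> sec W" for c f
    by (rule determiningD[OF I W]) (use that W in \<open>simp_all add: closed ops smult ev_smult\<close>)
  show "X W f \<in> homog M W (p + r)" if "f \<in> homog M W r" for f r
    by (rule homogI[OF I W closed[OF W homog_sec[OF W(1) that]] hom[OF W that]])
  show "X W (f \<otimes>\<^bsub>sections M W\<^esub> h) = (X W f \<otimes>\<^bsub>sections M W\<^esub> h) \<oplus>\<^bsub>sections M W\<^esub>
        (psign p r \<odot>\<^bsub>sections M W\<^esub> (f \<otimes>\<^bsub>sections M W\<^esub> X W h))"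
    if "f \<in> homog M W r" "h \<in> sec W" for f h r
    by (rule determiningD[OF I W])
      (use that W homog_sec[OF W(1) that(1)] in \<open>simp_all add: closed ops leibniz ev_add ev_mult ev_smult\<close>)
  fix W' assume W': "open W'" "W' \<subseteq> W"
  have W'U: "W' \<subseteq> U" using W W' by blast
  show "X W' (res M W W' f) = res M W W' (X W f)" if "f \<in> sec W" for f
    by (rule determiningD[OF I W'(1) W'U])
      (use that W W' W'U in \<open>simp_all add: closed res_sec res ev_res\<close>)
qed

lemma vect_hom_ev:
  assumes X: "X \<in> vect_hom M U p" and W: "open W" "W \<subseteq> U" and f: "f \<in> sec W"
  shows ev_hom_homog: "f \<in> homog M W r \<Longrightarrow> ev i m W (X W f) \<in> dual_hom (p + r)"
    and ev_hom_leibniz: "f \<in> homog M W r \<Longrightarrow> h \<in> sec W \<Longrightarrow> ev i m W (X W (f \<otimes>\<^bsub>sections M W\<^esub> h)) =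
        ev i m W (X W f) * ev i m W h + psign p r *\<^sub>R (ev i m W f * ev i m W (X W h))"
proof -
  show "f \<in> homog M W r \<Longrightarrow> ev i m W (X W f) \<in> dual_hom (p + r)"
    using vect_homD(5)[OF X W] ev_homog[OF W(1)] by blast
  assume fh: "f \<in> homog M W r" "h \<in> sec W"
  note c = vect_homD(2)[OF X W f] vect_homD(2)[OF X W fh(2)]
  show "ev i m W (X W (f \<otimes>\<^bsub>sections M W\<^esub> h)) =
        ev i m W (X W f) * ev i m W h + psign p r *\<^sub>R (ev i m W f * ev i m W (X W h))"
    using vect_homD(6)[OF X W fh] c f fh W(1)
    by (simp add: ev_add ev_mult ev_smult sec_closed smult_sec)
qed

lemma vzero_hom: "open U \<Longrightarrow> vzero M U \<in> vect_hom M U p"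
  by (rule vect_hom_evI[OF determining_UNIV])
    (simp_all add: vzero_apply sec_zero_one sec_closed smult_sec res_sec homog_sec subset_trans)

text \<open>The zero field has both parities and serves as the missing component.\<close>

lemma vect_hom_vect: "open U \<Longrightarrow> X \<in> vect_hom M U p \<Longrightarrow> X \<in> vect M U"
proof -
  assume U: "open U" and X: "X \<in> vect_hom M U p"
  have z: "vadd M U X (vzero M U) = X" "vadd M U (vzero M U) X = X"
    by (rule vext_eqI[where M = M and U = U],
        simp, simp add: vect_homD(1)[OF X], insert X,
        simp add: vadd_apply vzero_apply ring.ring_simprules(2,8,15)[OF ring_sec] vect_homD(2)[OF X])+
  show ?thesis
  proof (cases "p = 0")
    case True
    then show ?thesis using X z(1) vzero_hom[OF U, of 1] unfolding vect_def
      by (intro CollectI exI[of _ X] exI[of _ "vzero M U"]) simp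
  next
    case False
    then show ?thesis using X z(2) vzero_hom[OF U, of 0] unfolding vect_def
      by (intro CollectI exI[of _ "vzero M U"] exI[of _ X]) simp
  qed
qed

lemma vectE:
  assumes "X \<in> vect M U"
  obtains X0 X1 where "X0 \<in> vect_hom M U 0" "X1 \<in> vect_hom M U 1" "X = vadd M U X0 X1"
  using assms unfolding vect_def by blast

lemma vect_sec:
  assumes "X \<in> vect M U" "open W" "W \<subseteq> U" "f \<in> sec W"
  shows "X W f \<in> sec W"
  using assms(1) by (elim vectE) (simp add: assms vadd_apply sec_closed vect_homD(2))

text \<open>These rules pass to a sum of an even and an odd field. The Leibniz rule has different
  signs for the two parts, so it is stated for homogeneous fields only.\<close>

lemma vect_ev:
  assumes X: "X \<in> vect M U" and W: "open W" "W \<subseteq> U" and f: "f \<in> sec W"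
  shows ev_vect_add: "h \<in> sec W \<Longrightarrow> ev i m W (X W (f \<oplus>\<^bsub>sections M W\<^esub> h)) = ev i m W (X W f) + ev i m W (X W h)"
    and ev_vect_smult: "ev i m W (X W (c \<odot>\<^bsub>sections M W\<^esub> f)) = c *\<^sub>R ev i m W (X W f)"
    and ev_vect_res: "open W' \<Longrightarrow> W' \<subseteq> W \<Longrightarrow> ev i m W' (X W' (res M W W' f)) = (if m \<in> W' then ev i m W (X W f) else 0)"
proof -
  obtain X0 X1 where X01: "X0 \<in> vect_hom M U 0" "X1 \<in> vect_hom M U 1" "X = vadd M U X0 X1"
    using X by (rule vectE)
  note D0 = vect_homD[OF X01(1)] and D1 = vect_homD[OF X01(2)]
  note simps = X01(3) vadd_apply ev_add ev_smult ev_res D0(2-4,7) D1(2-4,7) sec_closed smult_sec res_sec scaleR_add_right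
  show "ev i m W (X W (f \<oplus>\<^bsub>sections M W\<^esub> h)) = ev i m W (X W f) + ev i m W (X W h)" if "h \<in> sec W"
    using W f that by (simp add: simps)
  show "ev i m W (X W (c \<odot>\<^bsub>sections M W\<^esub> f)) = c *\<^sub>R ev i m W (X W f)"
    using W f by (simp add: simps)
  show "ev i m W' (X W' (res M W W' f)) = (if m \<in> W' then ev i m W (X W f) else 0)"
    if "open W'" "W' \<subseteq> W"
    using W f that subset_trans[OF that(2) W(2)] by (simp add: simps)
qed

lemma ev_vect_minus:
  assumes "X \<in> vect M U" "open W" "W \<subseteq> U" "f \<in> sec W" "h \<in> sec W"
  shows "ev i m W (X W (f \<ominus>\<^bsub>sections M W\<^esub> h)) = ev i m W (X W f) - ev i m W (X W h)"
proof -
  interpret R: ring "sections M W" using ring_sec[OF assms(2)] .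
  have "(f \<ominus>\<^bsub>sections M W\<^esub> h) \<oplus>\<^bsub>sections M W\<^esub> h = f"
    using assms by (simp add: R.minus_eq R.a_assoc R.l_neg)
  then show ?thesis
    using ev_vect_add[OF assms(1-3), of "f \<ominus>\<^bsub>sections M W\<^esub> h" h i m] assms by (simp add: algebra_simps)
qed

lemma ev_vect_zero:
  assumes "X \<in> vect M U" "open W" "W \<subseteq> U"
  shows "ev i m W (X W \<zero>\<^bsub>sections M W\<^esub>) = 0"
proof -
  interpret R: ring "sections M W" using ring_sec[OF assms(2)] .
  show ?thesis using ev_vect_add[OF assms R.zero_closed R.zero_closed, of i m] by simp
qed

lemma one_homog: "open W \<Longrightarrow> \<one>\<^bsub>sections M W\<^esub> \<in> homog M W 0"
proof (rule homogI[OF determining_UNIV, of _ W])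
  fix i m assume "open W" "m \<in> W" "m \<in> V i"
  then show "ev i m W \<one>\<^bsub>sections M W\<^esub> \<in> dual_hom 0"
    by (simp add: ev_one dual_hom_def)
qed (auto simp: sec_zero_one)

text \<open>From 1 = 1 * 1 the Leibniz rule gives X(1) = 2 X(1).\<close>

lemma ev_vect_hom_one:
  assumes X: "X \<in> vect_hom M U p" and W: "open W" "W \<subseteq> U"
  shows "ev i m W (X W \<one>\<^bsub>sections M W\<^esub>) = 0"
proof (cases "m \<in> W \<and> m \<in> V i")
  case True
  interpret R: ring "sections M W" using ring_sec[OF W(1)] .
  have "ev i m W (X W (\<one>\<^bsub>sections M W\<^esub> \<otimes>\<^bsub>sections M W\<^esub> \<one>\<^bsub>sections M W\<^esub>)) =
      ev i m W (X W \<one>\<^bsub>sections M W\<^esub>) + ev i m W (X W \<one>\<^bsub>sections M W\<^esub>)"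
    unfolding ev_hom_leibniz[OF X W R.one_closed one_homog[OF W(1)] R.one_closed]
    using True by (simp add: ev_one[OF W(1)] del: R.l_one R.r_one)
  then show ?thesis by (simp only: R.l_one[OF R.one_closed] add_cancel_right_right)
qed (auto simp: ev_outside)

lemma ev_vect_one:
  assumes X: "X \<in> vect M U" and W: "open W" "W \<subseteq> U"
  shows "ev i m W (X W \<one>\<^bsub>sections M W\<^esub>) = 0"
proof -
  obtain X0 X1 where X01: "X0 \<in> vect_hom M U 0" "X1 \<in> vect_hom M U 1" "X = vadd M U X0 X1"
    using X by (rule vectE)
  then show ?thesis
    using W sec_zero_one[OF W(1)] vect_homD(2)[OF X01(1)] vect_homD(2)[OF X01(2)]
    by (simp add: vadd_apply ev_add ev_vect_hom_one)
qed

text \<open>The values in the determining charts identify h with the sum as a section. The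
  conclusion therefore holds for the values in every chart, not only in those of I.\<close>

lemma ev_vect_sum:
  assumes X: "X \<in> vect M U" and W: "open W" "W \<subseteq> U" and "finite L"
    and s: "\<And>l. l \<in> L \<Longrightarrow> s l \<in> sec W" and I: "determining I W"
    and h: "h \<in> sec W" "\<And>i m. i \<in> I \<Longrightarrow> m \<in> W \<Longrightarrow> m \<in> V i \<Longrightarrow> ev i m W h = (\<Sum>l\<in>L. ev i m W (s l))"
  shows "ev i m W (X W h) = (\<Sum>l\<in>L. ev i m W (X W (s l)))"
  using \<open>finite L\<close> s h
proof (induction L arbitrary: h)
  case empty
  have "h = \<zero>\<^bsub>sections M W\<^esub>"
    by (rule determiningD[OF I W(1)]) (use empty W in \<open>auto simp: sec_zero_one\<close>)
  then show ?case using ev_vect_zero[OF X W] by simp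
next
  case (insert l L)
  obtain h' where h': "h' \<in> sec W" "\<And>i m. ev i m W h' = (\<Sum>l\<in>L. ev i m W (s l))"
    using ev_sum_exists[OF W(1) insert.hyps(1), of s] insert.prems(1) by auto
  have sl: "s l \<in> sec W" using insert.prems by simp
  have "h = s l \<oplus>\<^bsub>sections M W\<^esub> h'"
    by (rule determiningD[OF I W(1)])
      (use insert.prems insert.hyps h' sl W in \<open>auto simp: sec_closed ev_add\<close>)
  then show ?case
    using insert.IH[OF _ h'(1)] insert.prems(1) insert.hyps h' sl
    by (simp add: ev_vect_add[OF X W])
qed

subsection \<open>Coordinate vector fields\<close>

lemma loc_mult_fun:
  assumes "open W" "W \<subseteq> V j" "f \<in> sec W" "h \<in> sec W"
  shows "loc j W (f \<otimes>\<^bsub>sections M W\<^esub> h) {} = (\<lambda>x. loc j W f {} x * loc j W h {} x)"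
    "loc j W (f \<otimes>\<^bsub>sections M W\<^esub> h) {0} =
       (\<lambda>x. loc j W f {} x * loc j W h {0} x + loc j W f {0} x * loc j W h {} x)"
  using loc_mult[OF assms] by (auto simp: model_mult_nth)

lemma loc_add_fun:
  assumes "open W" "W \<subseteq> V j" "f \<in> sec W" "h \<in> sec W"
  shows "loc j W (f \<oplus>\<^bsub>sections M W\<^esub> h) S = (\<lambda>x. loc j W f S x + loc j W h S x)"
  using loc_add[OF assms] by (auto simp: model_add_nth)

lemma loc_smult_fun:
  assumes "open W" "W \<subseteq> V j" "f \<in> sec W"
  shows "loc j W (c \<odot>\<^bsub>sections M W\<^esub> f) S = (\<lambda>x. c * loc j W f S x)"
  using loc_smult[OF assms] by (simp add: model_sections_def)

lemma loc_smooth: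
  assumes "open W" "W \<subseteq> V j" "f \<in> sec W"
  shows "smooth_on (\<phi> j ` W) (loc j W f S)"
  using loc_carrier[OF assms] model_sections_cases(1) by blast

lemma loc_differentiable:
  assumes "open W" "W \<subseteq> V j" "f \<in> sec W" "m \<in> W"
  shows "loc j W f S differentiable (at (\<phi> j m))"
  using smooth_on_differentiable[OF loc_smooth[OF assms(1-3)]] assms(4) by blast

abbreviation coord_vf :: "nat \<Rightarrow> 'n \<Rightarrow> ('a, 's) vfield" where
  "coord_vf j l \<equiv> d_even 1 M (V j) (\<phi> j) (\<Phi> j) l"

lemma coord_vf:
  assumes W: "open W" "W \<subseteq> V j" and f: "f \<in> sec W"
  shows coord_vf_sec: "coord_vf j l W f \<in> sec W"
    and ev_coord_vf: "m \<in> W \<Longrightarrow> ev j m W (coord_vf j l W f) =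
      Dual (partial_deriv l (loc j W f {}) (\<phi> j m)) (partial_deriv l (loc j W f {0}) (\<phi> j m))"
proof -
  let ?U = "\<phi> j ` W" and ?h = "loc j W f"
  let ?d = "model1 ?U (partial_deriv l (?h {})) (partial_deriv l (?h {0}))"
  have oU: "open ?U" using open_chart_image[OF W] .
  have hc: "?h \<in> carrier (model_sections 1 ?U)" using loc_carrier[OF W f] .
  have dc: "?d \<in> carrier (model_sections 1 ?U)"
    using oU loc_smooth[OF W f] smooth_on_partial_deriv by (intro model1_carrier) blast+
  have "model_deriv_even l ?U ?h = ?d"
  proof (intro ext)
    fix S x
    show "model_deriv_even l ?U ?h S x = ?d S x"
    proof (cases "S = {} \<or> S = {0}")
      case True
      then show ?thesis by (auto simp: model_deriv_even_def model1_def)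
    next
      case False
      then have "?h S = (\<lambda>x. 0)"
        using model_sections_cases(2)[OF hc] by (auto simp: model1_def fun_eq_iff)
      then show ?thesis using False by (simp add: model_deriv_even_def model1_def partial_deriv_const)
    qed
  qed
  then have eq: "coord_vf j l W f = \<Phi> j W ?d"
    using W f by (simp add: d_even_def chart_deriv_def vext_apply loc_def)
  show "coord_vf j l W f \<in> sec W"
    unfolding eq using chart_sec[OF W dc] .
  show "ev j m W (coord_vf j l W f) =
      Dual (partial_deriv l (?h {}) (\<phi> j m)) (partial_deriv l (?h {0}) (\<phi> j m))" if "m \<in> W"
    unfolding eq using ev_chart[OF W that chart_sec[OF W dc]] loc_chart[OF W dc] that by simp
qed

lemma coord_vf_hom: "coord_vf j l \<in> vect_hom M (V j) 0"
proof (rule vect_hom_evI[OF determining_chart[OF order_refl]])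
  show "vext M (V j) (coord_vf j l) = coord_vf j l"
    by (simp add: d_even_def chart_deriv_def)
next
  fix W W' f i m assume a: "open W" "W \<subseteq> V j" "open W'" "W' \<subseteq> W" "f \<in> sec W" "i \<in> {j}" "m \<in> W'"
  have W': "W' \<subseteq> V j" using a by blast
  have r: "res M W W' f \<in> sec W'" using a by (simp add: res_sec)
  have "partial_deriv l (loc j W' (res M W W' f) S) (\<phi> j m) = partial_deriv l (loc j W f S) (\<phi> j m)" for S
  proof (rule partial_deriv_cong)
    show "open (\<phi> j ` W')" using open_chart_image[OF a(3) W'] .
    show "\<phi> j m \<in> \<phi> j ` W'" using a by blast
    show "loc j W' (res M W W' f) S y = loc j W f S y" if "y \<in> \<phi> j ` W'" for y
      using loc_res[OF a(1,2,5,3,4) that] .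
    show "loc j W' (res M W W' f) S differentiable at (\<phi> j m)"
      using loc_differentiable[OF a(3) W' r a(7)] .
  qed
  then show "ev i m W' (coord_vf j l W' (res M W W' f)) = ev i m W (coord_vf j l W f)"
    using a ev_coord_vf[OF a(3) W' r a(7)] ev_coord_vf[OF a(1,2,5)] by auto
next
  fix W f r i m assume a: "open W" "W \<subseteq> V j" "f \<in> homog M W r" "i \<in> {j}" "m \<in> W"
  have f: "f \<in> sec W" using homog_sec[OF a(1,3)] .
  \<comment> \<open>A coefficient that vanishes on all of W has derivative zero. Applied to the
    coefficient of the wrong parity of a homogeneous f, this shows that d/dx_l is even.\<close>
  have d0: "partial_deriv l (loc j W f S) (\<phi> j m) = 0" if "\<And>m'. m' \<in> W \<Longrightarrow> loc j W f S (\<phi> j m') = 0" for S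
  proof -
    have "partial_deriv l (loc j W f S) (\<phi> j m) = partial_deriv l (\<lambda>_. 0) (\<phi> j m)"
      by (rule partial_deriv_cong[OF open_chart_image[OF a(1,2)]])
        (use that a loc_differentiable[OF a(1,2) f a(5)] in auto)
    then show ?thesis by (simp add: partial_deriv_const)
  qed
  have hom: "Dual (loc j W f {} (\<phi> j m')) (loc j W f {0} (\<phi> j m')) \<in> dual_hom r" if "m' \<in> W" for m'
    using ev_homog[OF a(1,3), of j m'] ev_chart[OF a(1,2) that f] by simp
  have i: "i = j" using a(4) by simp
  show "ev i m W (coord_vf j l W f) \<in> dual_hom (0 + r)"
  proof (cases "r = 0")
    case True
    then have "partial_deriv l (loc j W f {0}) (\<phi> j m) = 0"
      using hom by (intro d0) (simp add: dual_hom_def)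
    then show ?thesis using True ev_coord_vf[OF a(1,2) f a(5)] by (simp add: dual_hom_def i)
  next
    case False
    then have "partial_deriv l (loc j W f {}) (\<phi> j m) = 0"
      using hom by (intro d0) (simp add: dual_hom_def)
    then show ?thesis using False ev_coord_vf[OF a(1,2) f a(5)] by (simp add: dual_hom_def i)
  qed
next
  fix W f h i m assume a: "open W" "W \<subseteq> V j" "f \<in> sec W" "h \<in> sec W" "i \<in> {j}" "m \<in> W"
  then show "ev i m W (coord_vf j l W (f \<oplus>\<^bsub>sections M W\<^esub> h)) =
      ev i m W (coord_vf j l W f) + ev i m W (coord_vf j l W h)"
    by (simp add: ev_coord_vf sec_closed loc_add_fun loc_differentiable partial_deriv_add plus_dual_def)
next
  fix W f c i m assume a: "open W" "W \<subseteq> V j" "f \<in> sec W" "i \<in> {j}" "m \<in> W"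
  then show "ev i m W (coord_vf j l W (c \<odot>\<^bsub>sections M W\<^esub> f)) = c *\<^sub>R ev i m W (coord_vf j l W f)"
    by (simp add: ev_coord_vf smult_sec loc_smult_fun loc_differentiable partial_deriv_mult
        partial_deriv_const scaleR_dual_def)
next
  fix W f h r i m assume a: "open W" "W \<subseteq> V j" "f \<in> homog M W r" "h \<in> sec W" "i \<in> {j}" "m \<in> W"
  have f: "f \<in> sec W" using homog_sec[OF a(1,3)] .
  have "(\<lambda>x. loc j W u S x * loc j W v S' x) differentiable (at (\<phi> j m))" if "u \<in> sec W" "v \<in> sec W" for u v S S'
    using differentiable_mult[OF loc_differentiable[OF a(1,2) that(1) a(6)] loc_differentiable[OF a(1,2) that(2) a(6)]] .
  then show "ev i m W (coord_vf j l W (f \<otimes>\<^bsub>sections M W\<^esub> h)) =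
      ev i m W (coord_vf j l W f) * ev i m W h + psign 0 r *\<^sub>R (ev i m W f * ev i m W (coord_vf j l W h))"
    using a f by (simp add: ev_coord_vf sec_closed loc_mult_fun loc_differentiable partial_deriv_add
        partial_deriv_mult plus_dual_def times_dual_def ev_chart[of W j m f] ev_chart[of W j m h] algebra_simps)
qed (rule coord_vf_sec)

end

text \<open>The type \<open>'n option\<close> serves twice as the set of even indices with one extra
  element: for the constant term of Hadamard's expansion and for the odd field of a frame.\<close>

lemma sum_option: "(\<Sum>k\<in>UNIV. g k) = g None + (\<Sum>l\<in>UNIV. g (Some (l::'l::finite)))"
  by (simp add: UNIV_option_conv sum.reindex)

section \<open>Vector fields in terms of their values on the coordinates\<close>

context superatlas
begin

definition function_section :: "nat \<Rightarrow> 'a set \<Rightarrow> (real^'n \<Rightarrow> real) \<Rightarrow> 's" where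
  "function_section j W u = \<Phi> j W (model1 (\<phi> j ` W) u (\<lambda>x. 0))"

abbreviation coord :: "nat \<Rightarrow> 'n \<Rightarrow> 's" where
  "coord j l \<equiv> function_section j (V j) (\<lambda>x. x $ l)"

abbreviation theta :: "nat \<Rightarrow> 's" where
  "theta j \<equiv> odd_coord (V j) (\<phi> j) (\<Phi> j) 0"

lemma function_section:
  assumes W: "open W" "W \<subseteq> V j" and u: "smooth_on (\<phi> j ` W) u"
  shows function_section_sec: "function_section j W u \<in> sec W"
    and function_section_homog: "function_section j W u \<in> homog M W 0"
    and ev_function_section: "m \<in> W \<Longrightarrow> ev j m W (function_section j W u) = Dual (u (\<phi> j m)) 0"
proof -
  note o = open_chart_image[OF W]
  have c: "model1 (\<phi> j ` W) u (\<lambda>x. 0) \<in> carrier (model_sections 1 (\<phi> j ` W))"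
    using o u by (simp add: smooth_on_const)
  show s: "function_section j W u \<in> sec W"
    unfolding function_section_def by (rule chart_sec[OF W c])
  show "function_section j W u \<in> homog M W 0"
    unfolding function_section_def
    by (rule superalgebra_homD(3)[OF chart_hom[OF W] model1_homog(1)[OF o u]])
  show "ev j m W (function_section j W u) = Dual (u (\<phi> j m)) 0" if "m \<in> W"
    using ev_chart[OF W that s] loc_chart[OF W c] that unfolding function_section_def by simp
qed

lemma coord_section:
  shows coord_sec: "coord j l \<in> sec (V j)"
    and coord_homog: "coord j l \<in> homog M (V j) 0"
    and ev_coord: "m \<in> V j \<Longrightarrow> ev j m (V j) (coord j l) = Dual (\<phi> j m $ l) 0"
proof -
  have "smooth_on (\<phi> j ` V j) (\<lambda>x. x $ l)"
    using open_chart_image[OF open_V order_refl] by (rule smooth_on_coord)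
  note fs = function_section[OF open_V order_refl this]
  show "coord j l \<in> sec (V j)" "coord j l \<in> homog M (V j) 0"
    "m \<in> V j \<Longrightarrow> ev j m (V j) (coord j l) = Dual (\<phi> j m $ l) 0"
    using fs by auto
qed

lemma theta_section:
  shows theta_sec: "theta j \<in> sec (V j)"
    and theta_homog: "theta j \<in> homog M (V j) 1"
    and loc_theta: "loc j (V j) (theta j) = model1 (\<phi> j ` V j) (\<lambda>x. 0) (\<lambda>x. 1)"
    and ev_theta: "m \<in> V j \<Longrightarrow> ev j m (V j) (theta j) = Dual 0 1"
proof -
  note W = open_V order_refl
  note o = open_chart_image[OF W, of j]
  have eq: "theta j = \<Phi> j (V j) (model1 (\<phi> j ` V j) (\<lambda>x. 0) (\<lambda>x. 1))"
    unfolding odd_coord_def by (rule arg_cong[of _ _ "\<Phi> j (V j)"]) (auto simp: model_theta_def model1_def intro!: ext)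
  have c: "model1 (\<phi> j ` V j) (\<lambda>x. 0) (\<lambda>x. 1) \<in> carrier (model_sections 1 (\<phi> j ` V j))"
    using o by (simp add: smooth_on_const)
  show s: "theta j \<in> sec (V j)"
    unfolding eq by (rule chart_sec[OF W c])
  show "theta j \<in> homog M (V j) 1"
    unfolding eq
    by (rule superalgebra_homD(3)[OF chart_hom[OF W] model1_homog(2)[OF o smooth_on_const[OF o]]])
  show l: "loc j (V j) (theta j) = model1 (\<phi> j ` V j) (\<lambda>x. 0) (\<lambda>x. 1)"
    unfolding eq by (rule loc_chart[OF W c])
  show "ev j m (V j) (theta j) = Dual 0 1" if "m \<in> V j"
    using ev_chart[OF W that s] l that by simp
qed

text \<open>The chain rule at the centre a of a coordinate ball. Hadamard's lemma writes u as u(a) +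
  sum_l (x_l - a_l) G_l; Y annihilates the constant, and in the Leibniz rule for the products the
  factor x_l - a_l has value 0 at m, which leaves Y(x_l) times G_l(a), the partial
  derivative.\<close>

lemma ev_vect_function:
  assumes Y: "Y \<in> vect_hom M U p" and U: "open U" "V j \<subseteq> U"
    and N: "open N" "N \<subseteq> V j" "\<phi> j ` N = ball (\<phi> j m) r" and m: "m \<in> N"
    and u: "smooth_on (\<phi> j ` N) u"
  shows "ev j m N (Y N (function_section j N u)) =
    (\<Sum>l\<in>UNIV. ev j m (V j) (Y (V j) (coord j l)) * Dual (partial_deriv l u (\<phi> j m)) 0)"
proof -
  let ?a = "\<phi> j m" and ?one = "\<one>\<^bsub>sections M N\<^esub>"
  have NU: "N \<subseteq> U" and mV: "m \<in> V j" using N U m by auto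
  have Yv: "Y \<in> vect M U" using vect_hom_vect[OF U(1) Y] .
  have "r > 0" using N(3) m by (metis ball_eq_empty empty_iff image_is_empty not_le)
  then obtain G where G: "\<And>i. smooth_on (ball ?a r) (G i)" "\<And>i. G i ?a = partial_deriv i u ?a"
    "\<And>x. x \<in> ball ?a r \<Longrightarrow> u x = u ?a + (\<Sum>i\<in>UNIV. (x $ i - ?a $ i) * G i x)"
    using hadamard[of ?a r u] u N(3) by metis
  define g where "g l = function_section j N (G l)" for l
  have g: "g l \<in> sec N" "m' \<in> N \<Longrightarrow> ev j m' N (g l) = Dual (G l (\<phi> j m')) 0" for l m'
    using function_section[OF N(1,2), of "G l"] G(1) N(3) by (auto simp: g_def)
  \<comment> \<open>The even section x_l - a_l over N, which vanishes at m.\<close>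
  define x where "x l = res M (V j) N (coord j l) \<ominus>\<^bsub>sections M N\<^esub> (?a $ l) \<odot>\<^bsub>sections M N\<^esub> ?one" for l
  have one: "?one \<in> sec N" using sec_zero_one(2)[OF N(1)] .
  have rc: "res M (V j) N (coord j l) \<in> sec N" for l
    using coord_sec N by (simp add: res_sec)
  have x: "x l \<in> sec N" for l
    unfolding x_def using N(1) one rc by (simp add: sec_closed smult_sec)
  have evx: "ev j m' N (x l) = Dual (\<phi> j m' $ l - ?a $ l) 0" if "m' \<in> N" for m' l
    using that N coord_sec ev_coord[of m' j l]
    by (simp add: x_def ev_minus rc one smult_sec ev_smult ev_res[of "V j"] ev_one subset_iff dual_eq_iff)
  have xh: "x l \<in> homog M N 0" for l
    by (rule homogI[OF determining_chart[OF N(2)] N(1) order_refl x]) (simp add: evx dual_hom_def)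
  have Yx: "ev j m N (Y N (x l)) = ev j m (V j) (Y (V j) (coord j l))" for l
  proof -
    have "ev j m N (Y N (x l)) = ev j m N (Y N (res M (V j) N (coord j l))) - ?a $ l *\<^sub>R ev j m N (Y N ?one)"
      unfolding x_def by (simp add: ev_vect_minus[OF Yv N(1) NU] rc one smult_sec[OF N(1)] ev_vect_smult[OF Yv N(1) NU])
    then show ?thesis
      using ev_vect_one[OF Yv N(1) NU, of j m] ev_vect_res[OF Yv open_V U(2) coord_sec N(1,2), of j m] m by simp
  qed
  \<comment> \<open>The summands of Hadamard's expansion, with \<open>None\<close> for the constant
    term u(a).\<close>
  define s where "s k = (case k of None \<Rightarrow> u ?a \<odot>\<^bsub>sections M N\<^esub> ?one | Some l \<Rightarrow> x l \<otimes>\<^bsub>sections M N\<^esub> g l)" for k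
  have s: "s k \<in> sec N" for k
    unfolding s_def using one x g N(1) by (auto simp: sec_closed smult_sec split: option.split)
  have "ev j m N (Y N (function_section j N u)) = (\<Sum>k\<in>UNIV. ev j m N (Y N (s k)))"
  proof (rule ev_vect_sum[OF Yv N(1) NU finite s determining_chart[OF N(2)] function_section_sec[OF N(1,2) u]])
    fix i m' assume i: "i \<in> {j}" and m': "m' \<in> N"
    have "\<phi> j m' \<in> ball ?a r" using m' N(3) by blast
    note G(3)[OF this]
    then show "ev i m' N (function_section j N u) = (\<Sum>k\<in>UNIV. ev i m' N (s k))"
      using i m' N one x g
      by (simp add: sum_option s_def ev_function_section[OF N(1,2) u] ev_smult ev_mult ev_one subset_iff
          evx dual_eq_iff)
  qed
  also have "\<dots> = (\<Sum>l\<in>UNIV. ev j m (V j) (Y (V j) (coord j l)) * Dual (partial_deriv l u ?a) 0)"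
  proof -
    have "ev j m N (Y N (s None)) = 0"
      by (simp add: s_def ev_vect_smult[OF Yv N(1) NU one] ev_vect_one[OF Yv N(1) NU])
    \<comment> \<open>The other term of the Leibniz rule contains the value of \<open>x l\<close> at
      m, which is 0.\<close>
    moreover have "ev j m N (Y N (s (Some l))) =
        ev j m (V j) (Y (V j) (coord j l)) * Dual (partial_deriv l u ?a) 0" for l
      using ev_hom_leibniz[OF Y N(1) NU x xh g(1), of j m l l] evx[OF m, of l] g(2)[OF m] Yx G(2)
      by (simp add: s_def zero_dual_def[symmetric])
    ultimately show ?thesis by (simp add: sum_option)
  qed
  finally show ?thesis .
qed

text \<open>The coordinate formula Y = Y(tau) d/dtau + sum_l Y(x_l) d/dx_l at the point m. On a
  coordinate ball f = F + G tau with functions F and G of the even coordinates. The Leibniz rule for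
  G tau and the chain rule for F and G give the claim; the coefficient \<open>loc j W f {0}\<close>
  is the derivative of f with respect to tau.\<close>

lemma ev_vect_chart:
  assumes Y: "Y \<in> vect_hom M U p" and U: "open U" "V j \<subseteq> U"
    and W: "open W" "W \<subseteq> V j" and f: "f \<in> sec W" and m: "m \<in> W"
  shows "ev j m W (Y W f) = Dual (loc j W f {0} (\<phi> j m)) 0 * ev j m (V j) (Y (V j) (theta j)) +
    (\<Sum>l\<in>UNIV. ev j m (V j) (Y (V j) (coord j l)) * ev j m W (coord_vf j l W f))"
proof -
  let ?a = "\<phi> j m" and ?h = "loc j W f"
  have Yv: "Y \<in> vect M U" using vect_hom_vect[OF U(1) Y] .
  have WU: "W \<subseteq> U" using W U by blast
  obtain r where r: "r > 0" "ball ?a r \<subseteq> \<phi> j ` W"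
    using open_chart_image[OF W] m open_contains_ball by blast
  \<comment> \<open>Hadamard's lemma integrates along segments, so f is restricted to the preimage
    of a ball centred at the coordinates of m.\<close>
  define N where "N = {m'\<in>W. \<phi> j m' \<in> ball ?a r}"
  have NW: "N \<subseteq> W" and mN: "m \<in> N" using m r by (auto simp: N_def)
  have N: "open N" "N \<subseteq> V j"
  proof -
    have "continuous_on (V j) (\<phi> j)"
      using superchartD(3)[OF chart[of j]] homeomorphism_cont1 by blast
    then have "continuous_on W (\<phi> j)" using W(2) continuous_on_subset by blast
    from continuous_open_preimage[OF this W(1) open_ball, of ?a r]
    show "open N" unfolding N_def vimage_def Int_def by (simp add: Collect_conj_eq[symmetric])
    show "N \<subseteq> V j" using NW W by blast
  qed
  have img: "\<phi> j ` N = ball ?a r" using r(2) by (auto simp: N_def)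
  have NU: "N \<subseteq> U" using NW WU by blast
  have sm: "smooth_on (\<phi> j ` N) (?h S)" for S
    using loc_smooth[OF W f] NW by (blast intro: smooth_on_subset)
  let ?F = "function_section j N (?h {})" and ?G = "function_section j N (?h {0})"
  let ?t = "res M (V j) N (theta j)"
  note F = function_section[OF N sm[of "{}"]] and G = function_section[OF N sm[of "{0}"]]
  have t: "?t \<in> sec N" using theta_sec N by (simp add: res_sec)
  have evt: "ev j m' N ?t = Dual 0 1" if "m' \<in> N" for m'
    using that N ev_theta[of m' j] theta_sec[of j] by (simp add: ev_res[of "V j"] subset_iff)
  have rf: "res M W N f \<in> sec N" using res_sec[OF W(1) N(1) NW f] .
  have "res M W N f = ?F \<oplus>\<^bsub>sections M N\<^esub> (?G \<otimes>\<^bsub>sections M N\<^esub> ?t)"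
  proof (rule sec_eq_chartI[OF N rf])
    show "?F \<oplus>\<^bsub>sections M N\<^esub> (?G \<otimes>\<^bsub>sections M N\<^esub> ?t) \<in> sec N"
      using F(1) G(1) t N(1) by (simp add: sec_closed)
    fix m' assume m': "m' \<in> N"
    have "m' \<in> W" using m' NW by blast
    then show "ev j m' N (res M W N f) = ev j m' N (?F \<oplus>\<^bsub>sections M N\<^esub> (?G \<otimes>\<^bsub>sections M N\<^esub> ?t))"
      using m' F G t N(1) NW W f evt[OF m']
      by (simp add: ev_res ev_add ev_mult sec_closed ev_chart[OF W] dual_eq_iff)
  qed
  then have "ev j m W (Y W f) = ev j m N (Y N (?F \<oplus>\<^bsub>sections M N\<^esub> (?G \<otimes>\<^bsub>sections M N\<^esub> ?t)))"
    using ev_vect_res[OF Yv W(1) WU f N(1) NW, of j m] mN by simp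
  also have "\<dots> = ev j m N (Y N ?F) + (ev j m N (Y N ?G) * Dual 0 1 + Dual (?h {0} ?a) 0 * ev j m N (Y N ?t))"
    using F G t N(1) mN
    by (simp add: ev_vect_add[OF Yv N(1) NU] sec_closed ev_hom_leibniz[OF Y N(1) NU G(1,2)] evt)
  also have "ev j m N (Y N ?t) = ev j m (V j) (Y (V j) (theta j))"
    using ev_vect_res[OF Yv open_V U(2) theta_sec N, of j m] mN by simp
  also have "ev j m N (Y N ?F) = (\<Sum>l\<in>UNIV. ev j m (V j) (Y (V j) (coord j l)) * Dual (partial_deriv l (?h {}) ?a) 0)"
    by (rule ev_vect_function[OF Y U N img mN sm])
  also have "ev j m N (Y N ?G) = (\<Sum>l\<in>UNIV. ev j m (V j) (Y (V j) (coord j l)) * Dual (partial_deriv l (?h {0}) ?a) 0)"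
    by (rule ev_vect_function[OF Y U N img mN sm])
  finally show ?thesis
    by (simp add: ev_coord_vf[OF W f m] dual_eq_iff sum.distrib sum_distrib_left sum_distrib_right algebra_simps)
qed

end

subsection \<open>Partitions of unity\<close>

text \<open>Doubling the radius leaves the room in which \<open>smooth_bump\<close> falls from 1 to
  0, and the closed ball ensures that the bump can be extended by zero beyond the chart.\<close>

locale bump_atlas = superatlas M V \<phi> \<Phi>
  for M :: "('a::t2_space, 's) superspace"
    and V :: "nat \<Rightarrow> 'a set"
    and \<phi> :: "nat \<Rightarrow> 'a \<Rightarrow> real^'n::finite"
    and \<Phi> :: "nat \<Rightarrow> 'a set \<Rightarrow> 'n ssection \<Rightarrow> 's" +
  fixes a :: "nat \<Rightarrow> real^'n" and r :: "nat \<Rightarrow> real"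
  assumes r_pos: "r j > 0"
    and cball_subset: "cball (a j) (2 * r j) \<subseteq> \<phi> j ` V j"
    and core_cover: "(\<Union>j. {m\<in>V j. \<phi> j m \<in> ball (a j) (r j)}) = UNIV"
begin

definition core :: "nat \<Rightarrow> 'a set" where "core j = {m\<in>V j. \<phi> j m \<in> ball (a j) (r j)}"

text \<open>A set outside which the bump of chart j vanishes; it need not be the exact
  support.\<close>

definition supp :: "nat \<Rightarrow> 'a set" where "supp j = {m\<in>V j. \<phi> j m \<in> cball (a j) (2 * r j)}"

lemma core_supp_subset: "core j \<subseteq> V j" "supp j \<subseteq> V j"
  by (auto simp: core_def supp_def)

lemma open_core: "open (core j)"
proof -
  have "continuous_on (V j) (\<phi> j)"
    using superchartD(3)[OF chart[of j]] homeomorphism_cont1 by blast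
  from continuous_open_preimage[OF this open_V open_ball, of "a j" "r j"]
  show ?thesis unfolding core_def vimage_def Int_def by simp
qed

text \<open>As a preimage under \<open>\<phi> j\<close> this set is closed only relative to
  \<open>V j\<close>. It is closed in the whole space because it is also the image of a compact ball
  under the inverse of the chart, and compact sets are closed in a Hausdorff space.\<close>

lemma closed_supp: "closed (supp j)"
proof -
  obtain \<psi> where h: "homeomorphism (V j) (\<phi> j ` V j) (\<phi> j) \<psi>"
    using superchartD(3)[OF chart[of j]] by blast
  have "supp j = \<psi> ` cball (a j) (2 * r j)"
  proof
    show "supp j \<subseteq> \<psi> ` cball (a j) (2 * r j)"
    proof
      fix m assume "m \<in> supp j"
      then have "m = \<psi> (\<phi> j m)" "\<phi> j m \<in> cball (a j) (2 * r j)"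
        using homeomorphism_apply1[OF h] by (auto simp: supp_def)
      then show "m \<in> \<psi> ` cball (a j) (2 * r j)" by (rule image_eqI)
    qed
    show "\<psi> ` cball (a j) (2 * r j) \<subseteq> supp j"
    proof
      fix m assume "m \<in> \<psi> ` cball (a j) (2 * r j)"
      then obtain x where x: "x \<in> cball (a j) (2 * r j)" "m = \<psi> x" by blast
      have "x \<in> \<phi> j ` V j" using x cball_subset by blast
      then have "\<phi> j m = x" "m \<in> V j"
        using homeomorphism_apply2[OF h] homeomorphism_image2[OF h] x(2) by auto
      then show "m \<in> supp j" using x by (simp add: supp_def)
    qed
  qed
  moreover have "continuous_on (cball (a j) (2 * r j)) \<psi>"
    using homeomorphism_cont2[OF h] cball_subset continuous_on_subset by blast
  ultimately show ?thesis
    using compact_continuous_image compact_cball compact_imp_closed by metis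
qed

lemma bump_section_exists:
  obtains \<beta> where "\<beta> \<in> homog M UNIV 0" "\<And>i m. m \<in> core j \<Longrightarrow> m \<in> V i \<Longrightarrow> ev i m UNIV \<beta> = 1"
    "\<And>i m. m \<notin> supp j \<Longrightarrow> ev i m UNIV \<beta> = 0"
proof -
  obtain b where b: "smooth_on UNIV b" "\<And>x. x \<in> ball (a j) (r j) \<Longrightarrow> b x = 1"
    "\<And>x. x \<notin> ball (a j) (2 * r j) \<Longrightarrow> b x = 0"
    using smooth_bump[OF r_pos] by metis
  define s where "s = function_section j (V j) b"
  have "smooth_on (\<phi> j ` V j) b" using b(1) by (rule smooth_on_subset) simp
  note s = function_section[OF open_V order_refl this, folded s_def]
  \<comment> \<open>The function b is known in chart j only. On the core it gives the unit section,
    whose value is 1 in every chart.\<close>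
  have s1: "ev i m (V j) s = 1" if m: "m \<in> core j" "m \<in> V i" for i m
  proof -
    have "res M (V j) (core j) s = \<one>\<^bsub>sections M (core j)\<^esub>"
    proof (rule sec_eq_chartI[OF open_core core_supp_subset(1)])
      fix m' assume m': "m' \<in> core j"
      then have "m' \<in> V j" "\<phi> j m' \<in> ball (a j) (r j)" by (auto simp: core_def)
      then show "ev j m' (core j) (res M (V j) (core j) s) = ev j m' (core j) \<one>\<^bsub>sections M (core j)\<^esub>"
        using m' s b(2) by (simp add: ev_res open_core core_supp_subset ev_one one_dual_def)
    qed (simp_all add: s open_core core_supp_subset res_sec sec_zero_one)
    then have "ev i m (core j) (res M (V j) (core j) s) = 1"
      using ev_one[OF open_core m] by simp
    then show ?thesis using m s by (simp add: ev_res open_core core_supp_subset)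
  qed
  have s0: "ev i m (V j) s = 0" if m: "m \<notin> supp j" for i m
  proof (cases "m \<in> V j")
    case True
    let ?W = "V j - supp j"
    have W: "open ?W" "?W \<subseteq> V j" using closed_supp by (auto simp: open_Diff)
    have "res M (V j) ?W s = \<zero>\<^bsub>sections M ?W\<^esub>"
    proof (rule sec_eq_chartI[OF W])
      fix m' assume m': "m' \<in> ?W"
      then have "m' \<in> V j" "\<phi> j m' \<notin> ball (a j) (2 * r j)" by (auto simp: supp_def)
      then show "ev j m' ?W (res M (V j) ?W s) = ev j m' ?W \<zero>\<^bsub>sections M ?W\<^esub>"
        using m' s b(3) W by (simp add: ev_res zero_dual_def[symmetric])
    qed (simp_all add: s W res_sec sec_zero_one)
    then have "ev i m ?W (res M (V j) ?W s) = 0"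
      using W by simp
    then show ?thesis using m s W True by (simp add: ev_res)
  qed (simp add: ev_outside)
  \<comment> \<open>Extension by zero: s over \<open>V j\<close> and the zero section over the
    complement of \<open>supp j\<close> both have the prescribed values, which are 0 off
    \<open>V j\<close> by the default of \<open>ev\<close>.\<close>
  have "\<exists>h\<in>sec UNIV. \<forall>i. \<forall>m\<in>UNIV. m \<in> V i \<longrightarrow> ev i m UNIV h = ev i m (V j) s"
  proof (rule ev_glue)
    fix m :: 'a
    show "\<exists>N h. open N \<and> m \<in> N \<and> N \<subseteq> UNIV \<and> h \<in> sec N \<and>
      (\<forall>i. \<forall>m'\<in>N. m' \<in> V i \<longrightarrow> ev i m' N h = ev i m' (V j) s)"
    proof (cases "m \<in> V j")
      case True
      then show ?thesis using s by (intro exI[of _ "V j"] exI[of _ s]) simp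
    next
      case False
      have o: "open (- supp j)" using closed_supp by blast
      have "m \<notin> supp j" using False core_supp_subset(2) by blast
      then show ?thesis using s0 o
        by (intro exI[of _ "- supp j"] exI[of _ "\<zero>\<^bsub>sections M (- supp j)\<^esub>"]) (auto simp: sec_zero_one)
    qed
  qed simp
  then obtain h where h: "h \<in> sec UNIV" "\<And>i m. m \<in> V i \<Longrightarrow> ev i m UNIV h = ev i m (V j) s"
    by blast
  show thesis
  proof (rule that)
    show "h \<in> homog M UNIV 0"
      by (rule homogI[OF determining_UNIV open_UNIV order_refl h(1)])
        (use h(2) ev_homog[OF open_V s(2)] in auto)
    show "ev i m UNIV h = 1" if "m \<in> core j" "m \<in> V i" for i m
      using h(2) s1 that by simp
    show "ev i m UNIV h = 0" if "m \<notin> supp j" for i m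
      using h(2) s0 that ev_outside by metis
  qed
qed

text \<open>Local finiteness is expressed through the cores: on \<open>core k\<close> the members
  beyond k vanish, so the total is the finite sum up to k and no infinite sum occurs.\<close>

definition partition_of_unity :: "(nat \<Rightarrow> 's) \<Rightarrow> bool" where
  "partition_of_unity \<rho> \<longleftrightarrow>
     (\<forall>j. \<rho> j \<in> homog M UNIV 0) \<and>
     (\<forall>j i m. m \<notin> supp j \<longrightarrow> ev i m UNIV (\<rho> j) = 0) \<and>
     (\<forall>j k i m. m \<in> core k \<longrightarrow> k < j \<longrightarrow> ev i m UNIV (\<rho> j) = 0) \<and>
     (\<forall>k i m. m \<in> core k \<longrightarrow> m \<in> V i \<longrightarrow> (\<Sum>j\<le>k. ev i m UNIV (\<rho> j)) = 1)"

text \<open>With \<open>\<beta>\<^sub>j\<close> equal to 1 on the \<open>j\<close>-th core, the products \<open>\<beta>\<^sub>j \<Prod>\<^bsub>i<j\<^esub> (1 - \<beta>\<^sub>i)\<close> vanish on the \<open>k\<close>-th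
  core for \<open>j > k\<close>, so local finiteness needs no refinement of the cover.\<close>

lemma partition_of_unity_exists: "\<exists>\<rho>. partition_of_unity \<rho>"
proof -
  have "\<exists>\<beta>. \<forall>j. \<beta> j \<in> homog M UNIV 0 \<and> (\<forall>i m. m \<in> core j \<longrightarrow> m \<in> V i \<longrightarrow> ev i m UNIV (\<beta> j) = 1) \<and>
      (\<forall>i m. m \<notin> supp j \<longrightarrow> ev i m UNIV (\<beta> j) = 0)"
    by (intro choice allI) (metis bump_section_exists)
  then obtain \<beta> where \<beta>h: "\<And>j. \<beta> j \<in> homog M UNIV 0"
    and \<beta>1: "\<And>j i m. m \<in> core j \<Longrightarrow> m \<in> V i \<Longrightarrow> ev i m UNIV (\<beta> j) = 1"
    and \<beta>0: "\<And>j i m. m \<notin> supp j \<Longrightarrow> ev i m UNIV (\<beta> j) = 0"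
    by blast
  have \<beta>: "\<beta> j \<in> sec UNIV" for j using \<beta>h homog_sec open_UNIV by blast
  define c where "c = rec_nat \<one>\<^bsub>Cinf M\<^esub> (\<lambda>j c. c \<otimes>\<^bsub>Cinf M\<^esub> (\<one>\<^bsub>Cinf M\<^esub> \<ominus>\<^bsub>Cinf M\<^esub> \<beta> j))"
  have one: "\<one>\<^bsub>Cinf M\<^esub> \<in> sec UNIV" by (simp add: sec_zero_one)
  have c: "c j \<in> sec UNIV" for j
    by (induction j) (auto simp: c_def one sec_closed \<beta>)
  have evc: "ev i m UNIV (c j) = (\<Prod>k<j. 1 - ev i m UNIV (\<beta> k))" if "m \<in> V i" for i m j
  proof (induction j)
    case (Suc j)
    have "c (Suc j) = c j \<otimes>\<^bsub>Cinf M\<^esub> (\<one>\<^bsub>Cinf M\<^esub> \<ominus>\<^bsub>Cinf M\<^esub> \<beta> j)" by (simp add: c_def)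
    then show ?case using Suc c \<beta> one that by (simp add: ev_mult ev_minus ev_one sec_closed)
  qed (use that in \<open>simp add: c_def ev_one\<close>)
  define \<rho> where "\<rho> j = \<beta> j \<otimes>\<^bsub>Cinf M\<^esub> c j" for j
  have ev\<rho>: "ev i m UNIV (\<rho> j) = ev i m UNIV (\<beta> j) * ev i m UNIV (c j)" for i m j
    by (simp add: \<rho>_def ev_mult \<beta> c)
  have "\<rho> j \<in> homog M UNIV 0" for j
  proof (rule homogI[OF determining_UNIV open_UNIV order_refl])
    show "\<rho> j \<in> sec UNIV" by (simp add: \<rho>_def sec_closed \<beta> c)
    fix i m assume m: "m \<in> V i"
    have "soul (ev i m UNIV (\<beta> k)) = 0" for k
      using ev_homog[OF open_UNIV \<beta>h, of i m k] by (simp add: dual_hom_def)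
    moreover from this have "soul (\<Prod>k<j. 1 - ev i m UNIV (\<beta> k)) = 0"
      by (induction j) auto
    ultimately show "ev i m UNIV (\<rho> j) \<in> dual_hom 0"
      unfolding ev\<rho> evc[OF m] by (simp add: dual_hom_def)
  qed
  moreover have "ev i m UNIV (\<rho> j) = 0" if "m \<notin> supp j" for i m j
    using \<beta>0[OF that] by (simp add: ev\<rho>)
  moreover have vanish: "ev i m UNIV (c j) = 0" if "m \<in> core k" "k < j" for i m j k
  proof (cases "m \<in> V i")
    case True
    show ?thesis
      unfolding evc[OF True] by (rule prod_zero) (use that \<beta>1[OF that(1) True] in auto)
  qed (simp add: ev_outside)
  moreover have "(\<Sum>j\<le>k. ev i m UNIV (\<rho> j)) = 1" if m: "m \<in> core k" "m \<in> V i" for i m k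
  proof -
    \<comment> \<open>The sum telescopes, because c_(j+1) = c_j (1 - \<beta>_j) makes \<rho>_j equal
      to c_j - c_(j+1), and c_0 = 1.\<close>
    have "(\<Sum>j\<le>k. ev i m UNIV (\<rho> j)) = 1 - ev i m UNIV (c (Suc k))" for k
      by (induction k) (simp_all add: ev\<rho> evc[OF m(2)] algebra_simps)
    then show ?thesis using vanish[OF m(1)] by simp
  qed
  ultimately have "partition_of_unity \<rho>"
    unfolding partition_of_unity_def using ev\<rho> by simp
  then show ?thesis by blast
qed

definition rho :: "nat \<Rightarrow> 's" where "rho = (SOME \<rho>. partition_of_unity \<rho>)"

lemma rho:
  shows rho_homog: "rho j \<in> homog M UNIV 0"
    and rho_sec: "rho j \<in> sec UNIV"
    and rho_supp: "m \<notin> supp j \<Longrightarrow> ev i m UNIV (rho j) = 0"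
    and rho_core: "m \<in> core k \<Longrightarrow> k < j \<Longrightarrow> ev i m UNIV (rho j) = 0"
    and rho_sum: "m \<in> core k \<Longrightarrow> m \<in> V i \<Longrightarrow> (\<Sum>j\<le>k. ev i m UNIV (rho j)) = 1"
proof -
  have "partition_of_unity rho"
    unfolding rho_def using partition_of_unity_exists by (rule someI_ex)
  note * = this[unfolded partition_of_unity_def]
  show h: "rho j \<in> homog M UNIV 0" using * by blast
  show "rho j \<in> sec UNIV" using h homog_sec open_UNIV by blast
  show "m \<notin> supp j \<Longrightarrow> ev i m UNIV (rho j) = 0" using * by blast
  show "m \<in> core k \<Longrightarrow> k < j \<Longrightarrow> ev i m UNIV (rho j) = 0" using * by blast
  show "m \<in> core k \<Longrightarrow> m \<in> V i \<Longrightarrow> (\<Sum>j\<le>k. ev i m UNIV (rho j)) = 1" using * by blast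
qed

definition core_index :: "'a \<Rightarrow> nat" where "core_index m = (LEAST k. m \<in> core k)"

lemma in_core_index: "m \<in> core (core_index m)"
proof -
  have "\<exists>k. m \<in> core k" using core_cover unfolding core_def by blast
  then show ?thesis unfolding core_index_def by (rule LeastI_ex)
qed

text \<open>The bound \<open>core_index m\<close> need not be constant near a point. On a fixed core
  the common bound k may be used instead, since the additional terms vanish.\<close>

lemma sum_rho_core:
  assumes "m \<in> core k"
  shows "(\<Sum>j\<le>core_index m. ev i m UNIV (rho j) * g j) = (\<Sum>j\<le>k. ev i m UNIV (rho j) * g j)"
proof (rule sum.mono_neutral_left)
  have "core_index m \<le> k" unfolding core_index_def by (rule Least_le) fact
  then show "{..core_index m} \<subseteq> {..k}" by simp
  show "\<forall>j\<in>{..k} - {..core_index m}. ev i m UNIV (rho j) * g j = 0"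
    using rho_core[OF in_core_index] by simp
qed simp

end

subsection \<open>The flat frames and the connection\<close>

fun frame_parity :: "'n option \<Rightarrow> bit" where
  "frame_parity None = 1"
| "frame_parity (Some l) = 0"

locale odd_field_atlas = bump_atlas M V \<phi> \<Phi> a r
  for M :: "('a::t2_space, 's) superspace"
    and V :: "nat \<Rightarrow> 'a set"
    and \<phi> :: "nat \<Rightarrow> 'a \<Rightarrow> real^'n::finite"
    and \<Phi> :: "nat \<Rightarrow> 'a set \<Rightarrow> 'n ssection \<Rightarrow> 's"
    and a r +
  fixes Q :: "('a, 's) vfield"
  assumes Q: "Q \<in> vect_hom M UNIV 1"
    and Q_theta: "Q (V j) (theta j) = \<one>\<^bsub>sections M (V j)\<^esub>"
begin

lemma Q_vect: "Q \<in> Vect M"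
  using vect_hom_vect[OF open_UNIV Q] .

primrec frame :: "nat \<Rightarrow> 'n option \<Rightarrow> ('a, 's) vfield" where
  "frame j None = vext M (V j) Q"
| "frame j (Some l) = coord_vf j l"

text \<open>The components of Y in the frame. Applying Y = c Q + sum_l c_l d/dx_l to tau gives c =
  Y(tau), because Q(tau) = 1 and d/dx_l annihilates tau; applying it to x_l gives Y(x_l) = c Q(x_l)
  + c_l.\<close>

primrec coframe :: "nat \<Rightarrow> 'n option \<Rightarrow> ('a, 's) vfield \<Rightarrow> 's" where
  "coframe j None Y = Y (V j) (theta j)"
| "coframe j (Some l) Y = Y (V j) (coord j l) \<ominus>\<^bsub>sections M (V j)\<^esub>
     (Y (V j) (theta j) \<otimes>\<^bsub>sections M (V j)\<^esub> Q (V j) (coord j l))"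

lemma frame_hom: "frame j k \<in> vect_hom M (V j) (frame_parity k)"
proof (cases k)
  case None
  have "vext M (V j) Q \<in> vect_hom M (V j) 1"
  proof (rule vect_homI)
    fix W assume W: "open W" "W \<subseteq> V j"
    note D = vect_homD(2-7)[OF Q W(1) subset_UNIV]
    note ap = vext_apply[OF W] and cl = homog_sec[OF W(1)] sec_closed[OF W(1)] smult_sec[OF W(1)]
    show "vext M (V j) Q W f \<in> sec W" if "f \<in> sec W" for f
      using that D(1) by (simp add: ap)
    show "vext M (V j) Q W (f \<oplus>\<^bsub>sections M W\<^esub> h) = vext M (V j) Q W f \<oplus>\<^bsub>sections M W\<^esub> vext M (V j) Q W h"
      if "f \<in> sec W" "h \<in> sec W" for f h
      using that D(2) by (simp add: ap cl)
    show "vext M (V j) Q W (c \<odot>\<^bsub>sections M W\<^esub> f) = c \<odot>\<^bsub>sections M W\<^esub> vext M (V j) Q W f"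
      if "f \<in> sec W" for c f
      using that D(3) by (simp add: ap cl)
    show "vext M (V j) Q W f \<in> homog M W (1 + s)" if "f \<in> homog M W s" for f s
      using that D(4) by (simp add: ap cl)
    show "vext M (V j) Q W (f \<otimes>\<^bsub>sections M W\<^esub> h) =
        (vext M (V j) Q W f \<otimes>\<^bsub>sections M W\<^esub> h) \<oplus>\<^bsub>sections M W\<^esub>
        (psign 1 s \<odot>\<^bsub>sections M W\<^esub> (f \<otimes>\<^bsub>sections M W\<^esub> vext M (V j) Q W h))"
      if "f \<in> homog M W s" "h \<in> sec W" for f h s
      using that D(5) by (simp add: ap cl)
    fix W' assume W': "open W'" "W' \<subseteq> W"
    show "vext M (V j) Q W' (res M W W' f) = res M W W' (vext M (V j) Q W f)" if "f \<in> sec W" for f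
      using that D(6)[OF W' that] vext_apply[OF W'(1) subset_trans[OF W'(2) W(2)] res_sec[OF W(1) W' that]]
      by (simp add: ap)
  qed simp
  then show ?thesis using None by simp
next
  case (Some l)
  then show ?thesis using coord_vf_hom by simp
qed

lemma frame_vect: "frame j k \<in> vect M (V j)"
  using vect_hom_vect[OF open_V frame_hom] .

lemma Q_sec: "open W \<Longrightarrow> f \<in> sec W \<Longrightarrow> Q W f \<in> sec W"
  using vect_homD(2)[OF Q] by blast

lemma coframe_sec:
  assumes "\<And>f. f \<in> sec (V j) \<Longrightarrow> Y (V j) f \<in> sec (V j)"
  shows "coframe j k Y \<in> sec (V j)"
  using assms theta_sec coord_sec Q_sec[OF open_V coord_sec] by (cases k) (simp_all add: sec_closed)

lemma coframe_vect_sec: "Y \<in> Vect M \<Longrightarrow> coframe j k Y \<in> sec (V j)"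
  by (intro coframe_sec vect_sec[of Y UNIV]) auto

lemma coframe_homog:
  assumes Y: "Y \<in> vect_hom M UNIV p"
  shows "coframe j k Y \<in> homog M (V j) (p + frame_parity k)"
proof (cases k)
  case None
  then show ?thesis using vect_homD(5)[OF Y open_V subset_UNIV theta_homog] by simp
next
  case (Some l)
  have Yv: "Y \<in> Vect M" using vect_hom_vect[OF open_UNIV Y] .
  note s = vect_homD(2)[OF Y open_V subset_UNIV]
  show ?thesis
  proof (rule homogI[OF determining_UNIV open_V order_refl coframe_vect_sec[OF Yv]])
    fix i m
    let ?e = "ev i m (V j)"
    have c: "?e (Y (V j) (coord j l)) \<in> dual_hom (p + 0)"
      using ev_hom_homog[OF Y open_V subset_UNIV coord_sec coord_homog] .
    have t: "?e (Y (V j) (theta j)) \<in> dual_hom (p + 1)"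
      using ev_hom_homog[OF Y open_V subset_UNIV theta_sec theta_homog] .
    have q: "?e (Q (V j) (coord j l)) \<in> dual_hom (1 + 0)"
      using ev_hom_homog[OF Q open_V subset_UNIV coord_sec coord_homog] .
    have "?e (coframe j k Y) = ?e (Y (V j) (coord j l)) - ?e (Y (V j) (theta j)) * ?e (Q (V j) (coord j l))"
      using s[OF coord_sec] s[OF theta_sec] Q_sec[OF open_V coord_sec] Some
      by (simp add: ev_minus ev_mult sec_closed)
    then show "?e (coframe j k Y) \<in> dual_hom (p + frame_parity k)"
      using c dual_hom_mult[OF t q] Some by (cases "p = 0") (auto simp: dual_hom_def)
  qed
qed

lemma coframe_vadd:
  assumes Y: "Y \<in> Vect M" and Z: "Z \<in> Vect M"
  shows "coframe j k (vadd M UNIV Y Z) = coframe j k Y \<oplus>\<^bsub>sections M (V j)\<^esub> coframe j k Z"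
proof (rule sec_eqI[OF open_V])
  note s = vect_sec[OF Y open_V subset_UNIV] vect_sec[OF Z open_V subset_UNIV] theta_sec coord_sec
    Q_sec[OF open_V coord_sec]
  note ap = vadd_apply[OF open_V subset_UNIV]
  show "coframe j k (vadd M UNIV Y Z) \<in> sec (V j)"
    by (rule coframe_sec) (simp add: ap s sec_closed)
  show "coframe j k Y \<oplus>\<^bsub>sections M (V j)\<^esub> coframe j k Z \<in> sec (V j)"
    by (simp add: sec_closed coframe_vect_sec Y Z)
  fix i m
  show "ev i m (V j) (coframe j k (vadd M UNIV Y Z)) =
      ev i m (V j) (coframe j k Y \<oplus>\<^bsub>sections M (V j)\<^esub> coframe j k Z)"
    by (cases k) (simp_all add: ap s sec_closed ev_add ev_minus ev_mult algebra_simps)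
qed

lemma coframe_vscale:
  assumes Y: "Y \<in> Vect M" and f: "f \<in> sec UNIV"
  shows "coframe j k (vscale M UNIV f Y) = res M UNIV (V j) f \<otimes>\<^bsub>sections M (V j)\<^esub> coframe j k Y"
proof (rule sec_eqI[OF open_V])
  note s = vect_sec[OF Y open_V subset_UNIV] theta_sec coord_sec Q_sec[OF open_V coord_sec]
    res_sec[OF open_UNIV open_V subset_UNIV f]
  note ap = vscale_apply[OF open_V subset_UNIV]
  show "coframe j k (vscale M UNIV f Y) \<in> sec (V j)"
    by (rule coframe_sec) (simp add: ap s sec_closed)
  show "res M UNIV (V j) f \<otimes>\<^bsub>sections M (V j)\<^esub> coframe j k Y \<in> sec (V j)"
    by (simp add: sec_closed coframe_vect_sec Y s)
  fix i m
  show "ev i m (V j) (coframe j k (vscale M UNIV f Y)) =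
      ev i m (V j) (res M UNIV (V j) f \<otimes>\<^bsub>sections M (V j)\<^esub> coframe j k Y)"
    by (cases k) (simp_all add: ap s sec_closed ev_add ev_minus ev_mult algebra_simps)
qed

text \<open>Q is itself a member of the frame, so its components are constant; this is why the
  connection annihilates it.\<close>

lemma coframe_Q:
  "coframe j k Q = (if k = None then \<one>\<^bsub>sections M (V j)\<^esub> else \<zero>\<^bsub>sections M (V j)\<^esub>)"
proof (cases k)
  case (Some l)
  interpret R: ring "sections M (V j)" using ring_sec[OF open_V] .
  show ?thesis using Some Q_sec[OF open_V coord_sec] by (simp add: Q_theta R.minus_eq R.r_neg)
qed (simp add: Q_theta)

text \<open>The expansion of Y in the frame of chart j is computed in chart j, where coordinate
  formulas are available, and then read as an equality of sections over W, so that it holds for the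
  values in an arbitrary chart i.\<close>

lemma frame_expansion:
  assumes Y: "Y \<in> Vect M" and W: "open W" "W \<subseteq> V j" and f: "f \<in> sec W"
  shows "ev i m W (Y W f) = (\<Sum>k\<in>UNIV. ev i m (V j) (coframe j k Y) * ev i m W (frame j k W f))"
proof -
  have hom: "ev j m W (Y W f) = (\<Sum>k\<in>UNIV. ev j m (V j) (coframe j k Y) * ev j m W (frame j k W f))"
    if Y: "Y \<in> vect_hom M UNIV p" and m: "m \<in> W" for Y p m
  proof -
    have mV: "m \<in> V j" using m W by blast
    note s = vect_homD(2)[OF Y open_V subset_UNIV] coord_sec theta_sec Q_sec[OF open_V coord_sec]
    have q: "ev j m (V j) (Q (V j) (theta j)) = 1" by (simp add: Q_theta ev_one mV)
    \<comment> \<open>By Q(tau) = 1, the coordinate formula gives Q(f) = df/dtau + sum_l Q(x_l)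
      df/dx_l. Inserting this on the right-hand side cancels the terms with Q(x_l) and leaves the
      coordinate formula for Y(f).\<close>
    show ?thesis
      using ev_vect_chart[OF Q open_UNIV subset_UNIV W f m] ev_vect_chart[OF Y open_UNIV subset_UNIV W f m]
      by (simp add: sum_option vext_apply[OF W f] q ev_minus ev_mult s sec_closed
          sum_subtractf sum_distrib_left algebra_simps)
  qed
  obtain Y0 Y1 where Y01: "Y0 \<in> vect_hom M UNIV 0" "Y1 \<in> vect_hom M UNIV 1" "Y = vadd M UNIV Y0 Y1"
    using Y by (rule vectE)
  have Yv: "Y0 \<in> Vect M" "Y1 \<in> Vect M" using vect_hom_vect[OF open_UNIV] Y01 by blast+
  have chart_j: "ev j m W (Y W f) = (\<Sum>k\<in>UNIV. ev j m (V j) (coframe j k Y) * ev j m W (frame j k W f))"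
    if m: "m \<in> W" for m
    using hom[OF Y01(1) m] hom[OF Y01(2) m] W vect_sec[OF Yv(1) W(1) subset_UNIV f] vect_sec[OF Yv(2) W(1) subset_UNIV f] f
    by (simp add: Y01(3) coframe_vadd Yv ev_add coframe_vect_sec vadd_apply sum.distrib distrib_right)
  have c: "res M (V j) W (coframe j k Y) \<in> sec W" "frame j k W f \<in> sec W" for k
    using coframe_vect_sec[OF Y] W vect_sec[OF frame_vect W f] by (simp_all add: res_sec)
  obtain h where h: "h \<in> sec W" "\<And>i m. ev i m W h =
      (\<Sum>k\<in>UNIV. ev i m W (res M (V j) W (coframe j k Y) \<otimes>\<^bsub>sections M W\<^esub> frame j k W f))"
    using ev_sum_exists[OF W(1) finite, of UNIV "\<lambda>k. res M (V j) W (coframe j k Y) \<otimes>\<^bsub>sections M W\<^esub> frame j k W f"]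
      c W(1) by (auto simp: sec_closed)
  have evh: "ev i m W h = (\<Sum>k\<in>UNIV. ev i m (V j) (coframe j k Y) * ev i m W (frame j k W f))" for i m
    using c W coframe_vect_sec[OF Y] unfolding h(2)
    by (intro sum.cong) (auto simp: ev_mult ev_res ev_outside)
  \<comment> \<open>The section h realises the frame sum in all charts; agreement with
    \<open>Y W f\<close> in chart j makes the two sections equal.\<close>
  have "Y W f = h"
    by (rule sec_eq_chartI[OF W vect_sec[OF Y W(1) subset_UNIV f] h(1)]) (simp add: evh chart_j)
  then show ?thesis using evh by simp
qed

text \<open>The frame fields of chart j act only on sections over subsets of \<open>V j\<close>, so
  f is restricted first. Off \<open>V j\<close> the value is 0; there \<open>rho j\<close> vanishes
  as well.\<close>

definition frame_ev :: "nat \<Rightarrow> 'n option \<Rightarrow> 'a set \<Rightarrow> 's \<Rightarrow> nat \<Rightarrow> 'a \<Rightarrow> dual" where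
  "frame_ev j k W f i m = ev i m (W \<inter> V j) (frame j k (W \<inter> V j) (res M W (W \<inter> V j) f))"

context
  fixes W :: "'a set"
  assumes W: "open W"
begin

lemma inter_V: "open (W \<inter> V j)" "W \<inter> V j \<subseteq> V j" "W \<inter> V j \<subseteq> W"
  using W by auto

lemma res_inter_sec: "f \<in> sec W \<Longrightarrow> res M W (W \<inter> V j) f \<in> sec (W \<inter> V j)"
  using res_sec[OF W inter_V(1,3)] .

lemma frame_ev_add:
  assumes "f \<in> sec W" "h \<in> sec W"
  shows "frame_ev j k W (f \<oplus>\<^bsub>sections M W\<^esub> h) i m = frame_ev j k W f i m + frame_ev j k W h i m"
  unfolding frame_ev_def ring_hom_add[OF res_ring_hom[OF W inter_V(1,3)] assms]
  by (rule ev_vect_add[OF frame_vect inter_V(1,2)]) (use assms res_inter_sec in auto)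

lemma frame_ev_smult:
  assumes "f \<in> sec W"
  shows "frame_ev j k W (c \<odot>\<^bsub>sections M W\<^esub> f) i m = c *\<^sub>R frame_ev j k W f i m"
  unfolding frame_ev_def superalgebra_homD(2)[OF res_hom[OF W inter_V(1,3)] assms]
  by (rule ev_vect_smult[OF frame_vect inter_V(1,2)]) (use assms res_inter_sec in auto)

lemma frame_ev_homog:
  assumes "f \<in> homog M W s"
  shows "frame_ev j k W f i m \<in> dual_hom (frame_parity k + s)"
  unfolding frame_ev_def
  by (rule ev_hom_homog[OF frame_hom inter_V(1,2) res_inter_sec[OF homog_sec[OF W assms]]])
    (rule res_homog[OF W inter_V(1,3) assms])

lemma frame_ev_leibniz:
  assumes f: "f \<in> homog M W s" and h: "h \<in> sec W"
  shows "frame_ev j k W (f \<otimes>\<^bsub>sections M W\<^esub> h) i m =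
    frame_ev j k W f i m * ev i m W h + psign (frame_parity k) s *\<^sub>R (ev i m W f * frame_ev j k W h i m)"
proof -
  have fs: "f \<in> sec W" using homog_sec[OF W f] .
  have "frame_ev j k W (f \<otimes>\<^bsub>sections M W\<^esub> h) i m =
    frame_ev j k W f i m * ev i m (W \<inter> V j) (res M W (W \<inter> V j) h) +
    psign (frame_parity k) s *\<^sub>R (ev i m (W \<inter> V j) (res M W (W \<inter> V j) f) * frame_ev j k W h i m)"
    unfolding frame_ev_def ring_hom_mult[OF res_ring_hom[OF W inter_V(1,3)] fs h]
    by (rule ev_hom_leibniz[OF frame_hom inter_V(1,2)])
      (use fs f h res_inter_sec res_homog[OF W inter_V(1,3)] in auto)
  moreover have "frame_ev j k W u i m = 0" if "m \<notin> W \<inter> V j" for u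
    unfolding frame_ev_def using that by (simp add: ev_outside)
  ultimately show ?thesis
    using ev_res[OF W fs inter_V(1,3)] ev_res[OF W h inter_V(1,3)] by (cases "m \<in> W \<inter> V j") auto
qed

lemma frame_ev_res:
  assumes f: "f \<in> sec W" and W': "open W'" "W' \<subseteq> W" and m: "m \<in> W'"
  shows "frame_ev j k W' (res M W W' f) i m = frame_ev j k W f i m"
proof -
  have o: "open (W' \<inter> V j)" "W' \<inter> V j \<subseteq> W'" "W' \<inter> V j \<subseteq> W \<inter> V j" "W' \<inter> V j \<subseteq> W" using W' by auto
  have "res M W' (W' \<inter> V j) (res M W W' f) = res M W (W' \<inter> V j) f"
    using res_res[OF W W'(1) o(1,2) W'(2) f] .
  also have "\<dots> = res M (W \<inter> V j) (W' \<inter> V j) (res M W (W \<inter> V j) f)"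
    using res_res[OF W inter_V(1) o(1,3) inter_V(3) f] by simp
  finally show ?thesis
    unfolding frame_ev_def using m
    by (simp add: ev_vect_res[OF frame_vect inter_V(1,2) res_inter_sec[OF f] o(1,3)] ev_outside)
qed

lemma frame_ev_subset:
  assumes f: "f \<in> sec W" and W': "open W'" "W' \<subseteq> W \<inter> V j" and m: "m \<in> W'"
  shows "ev i m W' (frame j k W' (res M W W' f)) = frame_ev j k W f i m"
proof -
  have "res M W W' f = res M (W \<inter> V j) W' (res M W (W \<inter> V j) f)"
    using res_res[OF W inter_V(1) W'(1,2) inter_V(3) f] by simp
  then show ?thesis
    unfolding frame_ev_def using m
    by (simp add: ev_vect_res[OF frame_vect inter_V(1,2) res_inter_sec[OF f] W'])
qed

lemma frame_ev_expansion:
  assumes Y: "Y \<in> Vect M" and f: "f \<in> sec W" and m: "m \<in> V j"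
  shows "(\<Sum>k\<in>UNIV. ev i m (V j) (coframe j k Y) * frame_ev j k W f i m) = ev i m W (Y W f)"
  using frame_expansion[OF Y inter_V(1,2) res_inter_sec[OF f], of i m j, symmetric]
    ev_vect_res[OF Y W subset_UNIV f inter_V(1,3), of i m j] m
  by (auto simp: frame_ev_def ev_outside)

end

text \<open>The value in chart i at m of sum_j rho_j sum_k X(c_jk) e_jk(f), where the c_jk are the
  components of Y in the frame e_jk of chart j. The sum over j may stop at
  \<open>core_index m\<close>, since the later members of the partition vanish at m.\<close>

definition connection_ev ::
    "('a, 's) vfield \<Rightarrow> ('a, 's) vfield \<Rightarrow> 'a set \<Rightarrow> 's \<Rightarrow> nat \<Rightarrow> 'a \<Rightarrow> dual" where
  "connection_ev X Y W f i m = (\<Sum>j\<le>core_index m. ev i m UNIV (rho j) *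
     (\<Sum>k\<in>UNIV. ev i m (V j) (X (V j) (coframe j k Y)) * frame_ev j k W f i m))"

text \<open>At most one section has the prescribed values; its existence is
  \<open>connection_ev_exists\<close>.\<close>

definition connection :: "('a, 's) vfield \<Rightarrow> ('a, 's) vfield \<Rightarrow> ('a, 's) vfield" where
  "connection X Y = vext M UNIV (\<lambda>W f. SOME h. h \<in> sec W \<and>
     (\<forall>i. \<forall>m\<in>W. m \<in> V i \<longrightarrow> ev i m W h = connection_ev X Y W f i m))"

text \<open>Near each point the formula is a finite sum of products of genuine sections. The
  hypothesis speaks of the sections X(c_jk) and not of X being a vector field, so that the result
  applies directly to \<open>vadd M UNIV X X'\<close> and \<open>vscale M UNIV u X\<close>.\<close>

lemma connection_ev_exists:
  assumes X: "\<And>j k. X (V j) (coframe j k Y) \<in> sec (V j)" and W: "open W" and f: "f \<in> sec W"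
  shows "\<exists>h\<in>sec W. \<forall>i. \<forall>m\<in>W. m \<in> V i \<longrightarrow> ev i m W h = connection_ev X Y W f i m"
proof (rule ev_glue[OF W])
  fix m assume m: "m \<in> W"
  define n where "n = core_index m"
  define F where "F = {j\<in>{..n}. m \<in> V j}"
  \<comment> \<open>On \<open>core n\<close> the terms with j > n vanish. For j <= n either m lies
    in \<open>V j\<close>, and N is shrunk into \<open>V j\<close>, or m lies outside the closed set
    \<open>supp j\<close>, and N is shrunk to avoid it.\<close>
  define N where "N = W \<inter> core n \<inter> (\<Inter>j\<in>F. V j) \<inter> (\<Inter>j\<in>{..n} - F. - supp j)"
  have fin: "finite F" by (simp add: F_def)
  have N: "open N" "m \<in> N" "N \<subseteq> W"
  proof -
    show "open N" unfolding N_def using W closed_supp open_core fin by (intro open_Int open_INT) auto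
    show "m \<in> N" using m in_core_index[of m] core_supp_subset by (auto simp: N_def n_def F_def)
    show "N \<subseteq> W" by (auto simp: N_def)
  qed
  have NV: "N \<subseteq> V j" if "j \<in> F" for j using that by (auto simp: N_def)
  define s where "s = (\<lambda>(j, k). res M UNIV N (rho j) \<otimes>\<^bsub>sections M N\<^esub>
    (res M (V j) N (X (V j) (coframe j k Y)) \<otimes>\<^bsub>sections M N\<^esub> frame j k N (res M W N f)))"
  have parts: "res M UNIV N (rho j) \<in> sec N" "res M (V j) N (X (V j) (coframe j k Y)) \<in> sec N"
    "frame j k N (res M W N f) \<in> sec N" if "j \<in> F" for j k
    using N NV[OF that] rho_sec X f W by (auto intro!: res_sec vect_sec[OF frame_vect])
  have "s z \<in> sec N" if "z \<in> F \<times> UNIV" for z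
    using that parts N by (auto simp: s_def sec_closed)
  then obtain h where h: "h \<in> sec N" "\<And>i m. ev i m N h = (\<Sum>z\<in>F \<times> UNIV. ev i m N (s z))"
    using ev_sum_exists[OF N(1), of "F \<times> UNIV" s] fin by auto
  have "ev i m' N h = connection_ev X Y W f i m'" if m': "m' \<in> N" for i m'
  proof -
    let ?g = "\<lambda>j. \<Sum>k\<in>UNIV. ev i m' (V j) (X (V j) (coframe j k Y)) * frame_ev j k W f i m'"
    have core: "m' \<in> core n" using m' by (simp add: N_def)
    have "ev i m' N (s (j, k)) = ev i m' UNIV (rho j) *
        (ev i m' (V j) (X (V j) (coframe j k Y)) * frame_ev j k W f i m')" if j: "j \<in> F" for j k
    proof -
      have "N \<subseteq> W \<inter> V j" using N NV[OF j] by blast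
      note fr = frame_ev_subset[OF W f N(1) this m']
      show ?thesis
        using parts[OF j] N NV[OF j] m' fr rho_sec[of j] X[of j k]
        by (simp add: s_def ev_mult sec_closed ev_res)
    qed
    then have "ev i m' N h = (\<Sum>(j, k)\<in>F \<times> UNIV. ev i m' UNIV (rho j) *
        (ev i m' (V j) (X (V j) (coframe j k Y)) * frame_ev j k W f i m'))"
      unfolding h(2) by (intro sum.cong) auto
    also have "\<dots> = (\<Sum>j\<in>F. ev i m' UNIV (rho j) * ?g j)"
      by (simp add: sum.cartesian_product[symmetric] sum_distrib_left)
    also have "\<dots> = (\<Sum>j\<le>n. ev i m' UNIV (rho j) * ?g j)"
    \<comment> \<open>For the indices j <= n outside F the neighbourhood N misses
      \<open>supp j\<close>, so \<open>rho j\<close> vanishes on it.\<close>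
    proof (rule sum.mono_neutral_left)
      show "F \<subseteq> {..n}" by (auto simp: F_def)
      show "\<forall>j\<in>{..n} - F. ev i m' UNIV (rho j) * ?g j = 0"
        using m' rho_supp[of m' _ i] by (auto simp: N_def)
    qed simp
    also have "\<dots> = connection_ev X Y W f i m'"
      unfolding connection_ev_def by (rule sum_rho_core[OF core, symmetric])
    finally show ?thesis .
  qed
  then show "\<exists>N h. open N \<and> m \<in> N \<and> N \<subseteq> W \<and> h \<in> sec N \<and>
      (\<forall>i. \<forall>m'\<in>N. m' \<in> V i \<longrightarrow> ev i m' N h = connection_ev X Y W f i m')"
    using N h(1) by blast
qed

lemma connection:
  assumes "\<And>j k. X (V j) (coframe j k Y) \<in> sec (V j)" and "open W" and "f \<in> sec W"
  shows connection_sec: "connection X Y W f \<in> sec W"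
    and ev_connection: "m \<in> W \<Longrightarrow> m \<in> V i \<Longrightarrow> ev i m W (connection X Y W f) = connection_ev X Y W f i m"
proof -
  let ?P = "\<lambda>h. h \<in> sec W \<and> (\<forall>i. \<forall>m\<in>W. m \<in> V i \<longrightarrow> ev i m W h = connection_ev X Y W f i m)"
  have "?P (SOME h. ?P h)"
    using connection_ev_exists[OF assms] by (intro someI_ex[of ?P]) blast
  moreover have "connection X Y W f = (SOME h. ?P h)"
    unfolding connection_def by (rule vext_apply) (use assms in auto)
  ultimately show "connection X Y W f \<in> sec W"
    "m \<in> W \<Longrightarrow> m \<in> V i \<Longrightarrow> ev i m W (connection X Y W f) = connection_ev X Y W f i m"
    by auto
qed

section \<open>Verification of the axioms of a connection\<close>

lemma vect_coframe_sec: "X \<in> Vect M \<Longrightarrow> Y \<in> Vect M \<Longrightarrow> X (V j) (coframe j k Y) \<in> sec (V j)"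
  using vect_sec[OF _ open_V subset_UNIV coframe_vect_sec] .

lemma vext_connection [simp]: "vext M UNIV (connection X Y) = connection X Y"
  by (simp add: connection_def)

lemma connection_hom:
  assumes X: "X \<in> vect_hom M UNIV p" and Y: "Y \<in> vect_hom M UNIV q"
  shows "connection X Y \<in> vect_hom M UNIV (p + q)"
proof (rule vect_hom_evI[OF determining_UNIV vext_connection])
  have XY: "X \<in> Vect M" "Y \<in> Vect M" using vect_hom_vect[OF open_UNIV] X Y by blast+
  note spec = connection[where X = X and Y = Y, OF vect_coframe_sec[OF XY]]
  have c: "ev i m (V j) (X (V j) (coframe j k Y)) \<in> dual_hom ((p + q) + frame_parity k)" for i m j k
    using ev_hom_homog[OF X open_V subset_UNIV coframe_vect_sec[OF XY(2)] coframe_homog[OF Y], of i m j k]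
    by (simp add: add.assoc)
  fix W :: "'a set" assume W: "open W"
  show "connection X Y W f \<in> sec W" if "f \<in> sec W" for f
    using spec(1)[OF W that] .
  show "ev i m W (connection X Y W (f \<oplus>\<^bsub>sections M W\<^esub> h)) =
      ev i m W (connection X Y W f) + ev i m W (connection X Y W h)"
    if "f \<in> sec W" "h \<in> sec W" "m \<in> W" "m \<in> V i" for f h i m
    using that W by (simp add: spec(2) sec_closed connection_ev_def frame_ev_add distrib_left sum.distrib)
  show "ev i m W (connection X Y W (c \<odot>\<^bsub>sections M W\<^esub> f)) = c *\<^sub>R ev i m W (connection X Y W f)"
    if "f \<in> sec W" "m \<in> W" "m \<in> V i" for f c i m
    using that W by (simp add: spec(2) smult_sec connection_ev_def frame_ev_smult flip: scaleR_sum_right)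
  show "ev i m W (connection X Y W f) \<in> dual_hom ((p + q) + s)"
    if f: "f \<in> homog M W s" "m \<in> W" "m \<in> V i" for f s i m
  proof -
    have "ev i m UNIV (rho j) * (\<Sum>k\<in>UNIV. ev i m (V j) (X (V j) (coframe j k Y)) * frame_ev j k W f i m)
        \<in> dual_hom (0 + ((p + q) + s))" for j
    proof (rule dual_hom_mult[OF ev_homog[OF open_UNIV rho_homog] dual_hom_sum])
      fix k :: "'n option"
      \<comment> \<open>The component and the frame field both contribute the parity of k, which
        cancels modulo 2.\<close>
      have eq: "(p + q + frame_parity k) + (frame_parity k + s) = (p + q) + s"
        by (cases k) (simp_all add: add.assoc flip: add.assoc[of 1 1 s])
      show "ev i m (V j) (X (V j) (coframe j k Y)) * frame_ev j k W f i m \<in> dual_hom ((p + q) + s)"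
        using dual_hom_mult[OF c frame_ev_homog[OF W f(1)], of i m j k j k i m] unfolding eq .
    qed
    then show ?thesis
      unfolding spec(2)[OF W homog_sec[OF W f(1)] f(2,3)] connection_ev_def
      by (intro dual_hom_sum) simp
  qed
  show "ev i m W (connection X Y W (f \<otimes>\<^bsub>sections M W\<^esub> h)) =
      ev i m W (connection X Y W f) * ev i m W h +
      psign (p + q) s *\<^sub>R (ev i m W f * ev i m W (connection X Y W h))"
    if f: "f \<in> homog M W s" and h: "h \<in> sec W" and m: "m \<in> W" "m \<in> V i" for f h s i m
  proof -
    have fs: "f \<in> sec W" using homog_sec[OF W f] .
    have "ev i m (V j) (X (V j) (coframe j k Y)) * frame_ev j k W (f \<otimes>\<^bsub>sections M W\<^esub> h) i m =
        ev i m (V j) (X (V j) (coframe j k Y)) * frame_ev j k W f i m * ev i m W h +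
        psign (p + q) s *\<^sub>R (ev i m W f * (ev i m (V j) (X (V j) (coframe j k Y)) * frame_ev j k W h i m))" for j k
    proof -
      let ?c = "ev i m (V j) (X (V j) (coframe j k Y))"
      have "?c * psign (frame_parity k) s *\<^sub>R (ev i m W f * frame_ev j k W h i m) =
          (psign (frame_parity k) s *\<^sub>R (?c * ev i m W f)) * frame_ev j k W h i m"
        by (simp add: mult.assoc)
      \<comment> \<open>The frame field produces the sign for its own parity, while the Leibniz rule
        of the result requires the one for p + q. When the two parities differ the component is odd,
        and its product with an odd value of f vanishes; for even f both signs are 1.\<close>
      also have "psign (frame_parity k) s *\<^sub>R (?c * ev i m W f) = psign (p + q) s *\<^sub>R (?c * ev i m W f)"
        by (rule psign_dual_hom[OF c ev_homog[OF W f]])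
      finally show ?thesis
        by (simp add: frame_ev_leibniz[OF W f h] distrib_left mult_ac)
    qed
    then show ?thesis
      using fs h m W
      by (simp add: spec(2) sec_closed connection_ev_def distrib_left sum.distrib sum_distrib_left
          sum_distrib_right scaleR_sum_right mult_ac)
  qed
  fix W' assume W': "open W'" "W' \<subseteq> W"
  show "ev i m W' (connection X Y W' (res M W W' f)) = ev i m W (connection X Y W f)"
    if f: "f \<in> sec W" and m: "m \<in> W'" "m \<in> V i" for f i m
  proof -
    have "m \<in> W" using m W' by blast
    then show ?thesis
      using spec(2)[OF W f] spec(2)[OF W'(1) res_sec[OF W W' f] m] m
      by (simp add: connection_ev_def frame_ev_res[OF W f W' m(1)])
  qed
qed

lemma vadd_hom:
  assumes X: "X \<in> vect_hom M UNIV p" and Y: "Y \<in> vect_hom M UNIV p"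
  shows "vadd M UNIV X Y \<in> vect_hom M UNIV p"
proof (rule vect_hom_evI[OF determining_UNIV vext_vadd])
  have XY: "X \<in> Vect M" "Y \<in> Vect M" using vect_hom_vect[OF open_UNIV] X Y by blast+
  fix W :: "'a set" assume W: "open W"
  note s = vect_sec[OF XY(1) W subset_UNIV] vect_sec[OF XY(2) W subset_UNIV]
  note simps = vadd_apply[OF W subset_UNIV] s ev_add[OF W] sec_closed[OF W] smult_sec[OF W]
  show "vadd M UNIV X Y W f \<in> sec W" if "f \<in> sec W" for f
    using that by (simp add: simps)
  show "ev i m W (vadd M UNIV X Y W (f \<oplus>\<^bsub>sections M W\<^esub> h)) =
      ev i m W (vadd M UNIV X Y W f) + ev i m W (vadd M UNIV X Y W h)"
    if "f \<in> sec W" "h \<in> sec W" for f h i m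
    using that by (simp add: simps ev_vect_add[OF XY(1) W subset_UNIV] ev_vect_add[OF XY(2) W subset_UNIV])
  show "ev i m W (vadd M UNIV X Y W (c \<odot>\<^bsub>sections M W\<^esub> f)) = c *\<^sub>R ev i m W (vadd M UNIV X Y W f)"
    if "f \<in> sec W" for c f i m
    using that by (simp add: simps ev_vect_smult[OF XY(1) W subset_UNIV] ev_vect_smult[OF XY(2) W subset_UNIV]
        scaleR_add_right)
  show "ev i m W (vadd M UNIV X Y W f) \<in> dual_hom (p + s)" if f: "f \<in> homog M W s" for f s i m
    using homog_sec[OF W f] ev_hom_homog[OF X W subset_UNIV _ f, of i m] ev_hom_homog[OF Y W subset_UNIV _ f, of i m]
    by (auto simp: simps dual_hom_def)
  show "ev i m W (vadd M UNIV X Y W (f \<otimes>\<^bsub>sections M W\<^esub> h)) =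
      ev i m W (vadd M UNIV X Y W f) * ev i m W h +
      psign p s *\<^sub>R (ev i m W f * ev i m W (vadd M UNIV X Y W h))"
    if f: "f \<in> homog M W s" and h: "h \<in> sec W" for f h s i m
    using homog_sec[OF W f] h
      ev_hom_leibniz[OF X W subset_UNIV homog_sec[OF W f] f h] ev_hom_leibniz[OF Y W subset_UNIV homog_sec[OF W f] f h]
    by (simp add: simps distrib_left distrib_right scaleR_add_right)
  fix W' assume W': "open W'" "W' \<subseteq> W"
  show "ev i m W' (vadd M UNIV X Y W' (res M W W' f)) = ev i m W (vadd M UNIV X Y W f)"
    if f: "f \<in> sec W" and m: "m \<in> W'" for f i m
    using f m ev_vect_res[OF XY(1) W subset_UNIV f W', of i m] ev_vect_res[OF XY(2) W subset_UNIV f W', of i m]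
      vect_sec[OF XY(1) W'(1) subset_UNIV res_sec[OF W W' f]] vect_sec[OF XY(2) W'(1) subset_UNIV res_sec[OF W W' f]]
      vadd_apply[OF W'(1) subset_UNIV res_sec[OF W W' f]]
    by (simp add: simps ev_add[OF W'(1)])
qed

lemma connection_vadd_left:
  assumes X: "X \<in> Vect M" "X' \<in> Vect M" and Y: "Y \<in> Vect M"
  shows "connection (vadd M UNIV X X') Y = vadd M UNIV (connection X Y) (connection X' Y)"
proof (rule vext_eqI[OF vext_connection vext_vadd])
  fix W f assume W: "open W" and f: "f \<in> sec W"
  note c = vect_coframe_sec[OF X(1) Y] vect_coframe_sec[OF X(2) Y]
  have ap: "vadd M UNIV X X' (V j) (coframe j k Y) =
      X (V j) (coframe j k Y) \<oplus>\<^bsub>sections M (V j)\<^esub> X' (V j) (coframe j k Y)" for j k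
    by (rule vadd_apply[OF open_V subset_UNIV coframe_vect_sec[OF Y]])
  have c': "vadd M UNIV X X' (V j) (coframe j k Y) \<in> sec (V j)" for j k
    using c by (simp add: ap sec_closed)
  note spec = connection[where X = X and Y = Y, OF c(1) W f] connection[where X = X' and Y = Y, OF c(2) W f]
    connection[where X = "vadd M UNIV X X'" and Y = Y, OF c' W f]
  show "connection (vadd M UNIV X X') Y W f = vadd M UNIV (connection X Y) (connection X' Y) W f"
    unfolding vadd_apply[OF W subset_UNIV f]
    by (rule determiningD[OF determining_UNIV W order_refl])
      (simp_all add: spec sec_closed[OF W] ev_add[OF W] connection_ev_def ap c ev_add distrib_left
        distrib_right sum.distrib)
qed

lemma connection_vadd_right:
  assumes X: "X \<in> Vect M" and Y: "Y \<in> Vect M" "Y' \<in> Vect M"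
  shows "connection X (vadd M UNIV Y Y') = vadd M UNIV (connection X Y) (connection X Y')"
proof (rule vext_eqI[OF vext_connection vext_vadd])
  fix W f assume W: "open W" and f: "f \<in> sec W"
  note c = vect_coframe_sec[OF X Y(1)] vect_coframe_sec[OF X Y(2)]
  have c': "X (V j) (coframe j k (vadd M UNIV Y Y')) \<in> sec (V j)" for j k
    unfolding coframe_vadd[OF Y] using coframe_vect_sec Y
    by (intro vect_sec[OF X open_V subset_UNIV]) (simp add: sec_closed)
  note spec = connection[where X = X and Y = Y, OF c(1) W f] connection[where X = X and Y = Y', OF c(2) W f]
    connection[where X = X and Y = "vadd M UNIV Y Y'", OF c' W f]
  show "connection X (vadd M UNIV Y Y') W f = vadd M UNIV (connection X Y) (connection X Y') W f"
    unfolding vadd_apply[OF W subset_UNIV f]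
    by (rule determiningD[OF determining_UNIV W order_refl])
      (simp_all add: spec sec_closed[OF W] ev_add[OF W] connection_ev_def coframe_vadd Y coframe_vect_sec
        ev_vect_add[OF X open_V subset_UNIV] distrib_left distrib_right sum.distrib)
qed

lemma connection_vscale_left:
  assumes X: "X \<in> Vect M" and Y: "Y \<in> Vect M" and u: "u \<in> sec UNIV"
  shows "connection (vscale M UNIV u X) Y = vscale M UNIV u (connection X Y)"
proof (rule vext_eqI[OF vext_connection vext_vscale])
  fix W f assume W: "open W" and f: "f \<in> sec W"
  note c = vect_coframe_sec[OF X Y] and ru = res_sec[OF open_UNIV open_V subset_UNIV u]
  have ap: "vscale M UNIV u X (V j) (coframe j k Y) =
      res M UNIV (V j) u \<otimes>\<^bsub>sections M (V j)\<^esub> X (V j) (coframe j k Y)" for j k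
    by (rule vscale_apply[OF open_V subset_UNIV coframe_vect_sec[OF Y]])
  have c': "vscale M UNIV u X (V j) (coframe j k Y) \<in> sec (V j)" for j k
    using c ru by (simp add: ap sec_closed)
  note spec = connection[where X = X and Y = Y, OF c W f]
    connection[where X = "vscale M UNIV u X" and Y = Y, OF c' W f]
  have uW: "res M UNIV W u \<in> sec W" using res_sec[OF open_UNIV W subset_UNIV u] .
  have eq: "ev i m (V j) (vscale M UNIV u X (V j) (coframe j k Y)) =
      ev i m UNIV u * ev i m (V j) (X (V j) (coframe j k Y))" for i m j k
    using c ru by (simp add: ap ev_mult ev_res[OF open_UNIV u] ev_outside)
  show "connection (vscale M UNIV u X) Y W f = vscale M UNIV u (connection X Y) W f"
    unfolding vscale_apply[OF W subset_UNIV f]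
    by (rule determiningD[OF determining_UNIV W order_refl])
      (simp_all add: spec uW sec_closed[OF W] ev_mult[OF W] connection_ev_def eq
        ev_res[OF open_UNIV u W] sum_distrib_left mult_ac)
qed

text \<open>The components of u Y are u c_k, and X(u c_k) = X(u) c_k plus the signed u X(c_k). In
  each chart the first terms sum over k to X(u) Y by the frame expansion, and the weights combine
  these contributions into a single X(u) Y because they sum to 1.\<close>

lemma connection_vscale_right:
  assumes X: "X \<in> vect_hom M UNIV p" and Y: "Y \<in> Vect M" and u: "u \<in> homog M UNIV s"
  shows "connection X (vscale M UNIV u Y) = vadd M UNIV (vscale M UNIV (X UNIV u) Y)
    (vscale M UNIV (psign p s \<odot>\<^bsub>Cinf M\<^esub> u) (connection X Y))"
proof (rule vext_eqI[OF vext_connection vext_vadd])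
  fix W f assume W: "open W" and f: "f \<in> sec W"
  have Xv: "X \<in> Vect M" using vect_hom_vect[OF open_UNIV X] .
  have us: "u \<in> sec UNIV" using homog_sec[OF open_UNIV u] .
  have ru: "res M UNIV (V j) u \<in> homog M (V j) s" "res M UNIV (V j) u \<in> sec (V j)" for j
    using res_homog[OF open_UNIV open_V subset_UNIV u] res_sec[OF open_UNIV open_V subset_UNIV us] by auto
  note c = vect_coframe_sec[OF Xv Y]
  have c': "X (V j) (coframe j k (vscale M UNIV u Y)) \<in> sec (V j)" for j k
    unfolding coframe_vscale[OF Y us] using coframe_vect_sec[OF Y] ru
    by (intro vect_sec[OF Xv open_V subset_UNIV]) (simp add: sec_closed)
  note spec = connection[where X = X and Y = Y, OF c W f]
    connection[where X = X and Y = "vscale M UNIV u Y", OF c' W f]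
  have su: "X UNIV u \<in> sec UNIV" "psign p s \<odot>\<^bsub>Cinf M\<^esub> u \<in> sec UNIV"
    using vect_sec[OF Xv open_UNIV subset_UNIV us] us by (auto simp: smult_sec)
  note sW = res_sec[OF open_UNIV W subset_UNIV su(1)] res_sec[OF open_UNIV W subset_UNIV su(2)]
  have YW: "Y W f \<in> sec W" using vect_sec[OF Y W subset_UNIV f] .
  have ap: "vadd M UNIV (vscale M UNIV (X UNIV u) Y) (vscale M UNIV (psign p s \<odot>\<^bsub>Cinf M\<^esub> u) (connection X Y)) W f =
      (res M UNIV W (X UNIV u) \<otimes>\<^bsub>sections M W\<^esub> Y W f) \<oplus>\<^bsub>sections M W\<^esub>
      (res M UNIV W (psign p s \<odot>\<^bsub>Cinf M\<^esub> u) \<otimes>\<^bsub>sections M W\<^esub> connection X Y W f)"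
    using W f by (simp add: vadd_apply vscale_apply)
  show "connection X (vscale M UNIV u Y) W f =
      vadd M UNIV (vscale M UNIV (X UNIV u) Y) (vscale M UNIV (psign p s \<odot>\<^bsub>Cinf M\<^esub> u) (connection X Y)) W f"
    unfolding ap
  proof (rule determiningD[OF determining_UNIV W order_refl])
    fix i m assume m: "m \<in> W" "m \<in> V i"
    let ?c = "\<lambda>j k. ev i m (V j) (coframe j k Y)" and ?Xc = "\<lambda>j k. ev i m (V j) (X (V j) (coframe j k Y))"
    let ?e = "\<lambda>j k. frame_ev j k W f i m" and ?r = "\<lambda>j. ev i m UNIV (rho j)"
    let ?u = "ev i m UNIV u" and ?Xu = "ev i m UNIV (X UNIV u)"
    have Xc: "ev i m (V j) (X (V j) (coframe j k (vscale M UNIV u Y))) =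
        ?Xu * ?c j k + psign p s *\<^sub>R (?u * ?Xc j k)" if "m \<in> V j" for j k
      using ev_hom_leibniz[OF X open_V subset_UNIV ru(2,1) coframe_vect_sec[OF Y, of j k], of i m]
        ev_vect_res[OF Xv open_UNIV subset_UNIV us open_V subset_UNIV, of i m j]
        ev_res[OF open_UNIV us open_V subset_UNIV, of i m j] that
      by (simp add: coframe_vscale[OF Y us])
    have "?r j * (\<Sum>k\<in>UNIV. ev i m (V j) (X (V j) (coframe j k (vscale M UNIV u Y))) * ?e j k) =
        ?Xu * ev i m W (Y W f) * ?r j + psign p s *\<^sub>R ?u * (?r j * (\<Sum>k\<in>UNIV. ?Xc j k * ?e j k))" for j
    proof (cases "m \<in> V j")
      case True
      have "(\<Sum>k\<in>UNIV. ev i m (V j) (X (V j) (coframe j k (vscale M UNIV u Y))) * ?e j k) =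
          ?Xu * (\<Sum>k\<in>UNIV. ?c j k * ?e j k) + psign p s *\<^sub>R ?u * (\<Sum>k\<in>UNIV. ?Xc j k * ?e j k)"
        unfolding Xc[OF True] by (simp add: sum.distrib sum_distrib_left scaleR_sum_right algebra_simps)
      also have "(\<Sum>k\<in>UNIV. ?c j k * ?e j k) = ev i m W (Y W f)"
        by (rule frame_ev_expansion[OF W Y f True])
      finally show ?thesis by (simp add: algebra_simps)
    next
      case False
      then have "m \<notin> supp j" using core_supp_subset by blast
      then show ?thesis using rho_supp by simp
    qed
    then have "connection_ev X (vscale M UNIV u Y) W f i m =
        ?Xu * ev i m W (Y W f) * (\<Sum>j\<le>core_index m. ?r j) + psign p s *\<^sub>R ?u * connection_ev X Y W f i m"
      by (simp only: connection_ev_def sum.distrib sum_distrib_left)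
    also have "(\<Sum>j\<le>core_index m. ?r j) = 1"
      by (rule rho_sum[OF in_core_index m(2)])
    finally show "ev i m W (connection X (vscale M UNIV u Y) W f) =
        ev i m W ((res M UNIV W (X UNIV u) \<otimes>\<^bsub>sections M W\<^esub> Y W f) \<oplus>\<^bsub>sections M W\<^esub>
          (res M UNIV W (psign p s \<odot>\<^bsub>Cinf M\<^esub> u) \<otimes>\<^bsub>sections M W\<^esub> connection X Y W f))"
      using m spec sW YW su us
      by (simp add: sec_closed[OF W] ev_add[OF W] ev_mult[OF W] ev_res[OF open_UNIV _ W] ev_smult)
  qed (use spec sW YW W in \<open>simp_all add: sec_closed\<close>)
qed

text \<open>Biadditivity reduces the claim to four pairs of homogeneous fields. Parities add modulo
  2, so the pairs of equal parity form the even part and the mixed pairs the odd part.\<close>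

lemma connection_vect:
  assumes X: "X \<in> Vect M" and Y: "Y \<in> Vect M"
  shows "connection X Y \<in> Vect M"
proof -
  obtain X0 X1 where X01: "X0 \<in> vect_hom M UNIV 0" "X1 \<in> vect_hom M UNIV 1" "X = vadd M UNIV X0 X1"
    using X by (rule vectE)
  obtain Y0 Y1 where Y01: "Y0 \<in> vect_hom M UNIV 0" "Y1 \<in> vect_hom M UNIV 1" "Y = vadd M UNIV Y0 Y1"
    using Y by (rule vectE)
  have v: "X0 \<in> Vect M" "X1 \<in> Vect M" "Y0 \<in> Vect M" "Y1 \<in> Vect M"
    using vect_hom_vect[OF open_UNIV] X01 Y01 by blast+
  note C00 = connection_hom[OF X01(1) Y01(1)] and C01 = connection_hom[OF X01(1) Y01(2)]
    and C10 = connection_hom[OF X01(2) Y01(1)] and C11 = connection_hom[OF X01(2) Y01(2)]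
  let ?E = "vadd M UNIV (connection X0 Y0) (connection X1 Y1)"
  let ?O = "vadd M UNIV (connection X0 Y1) (connection X1 Y0)"
  have "?E \<in> vect_hom M UNIV 0" "?O \<in> vect_hom M UNIV 1"
    using vadd_hom[of _ 0] vadd_hom[of _ 1] C00 C01 C10 C11 by simp_all
  moreover have "connection X Y = vadd M UNIV ?E ?O"
  proof (rule vext_eqI[OF vext_connection vext_vadd])
    fix W f assume W: "open W" and f: "f \<in> sec W"
    interpret R: ring "sections M W" using ring_sec[OF W] .
    note s = connection_sec[OF vect_coframe_sec[OF v(1,3)] W f] connection_sec[OF vect_coframe_sec[OF v(1,4)] W f]
      connection_sec[OF vect_coframe_sec[OF v(2,3)] W f] connection_sec[OF vect_coframe_sec[OF v(2,4)] W f]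
    show "connection X Y W f = vadd M UNIV ?E ?O W f"
      unfolding X01(3) Y01(3)
      using v Y Y01(3) by (simp add: connection_vadd_left connection_vadd_right vadd_apply W f s R.a_ac)
  qed
  ultimately show ?thesis unfolding vect_def by blast
qed

text \<open>All components of Q are the sections 1 or 0, and X annihilates both.\<close>

lemma connection_Q:
  assumes X: "X \<in> Vect M"
  shows "connection X Q = vzero M UNIV"
proof (rule vext_eqI[OF vext_connection vext_vzero])
  fix W f assume W: "open W" and f: "f \<in> sec W"
  note spec = connection[where X = X and Y = Q, OF vect_coframe_sec[OF X Q_vect] W f]
  have "ev i m (V j) (X (V j) (coframe j k Q)) = 0" for i m j k
    using ev_vect_one[OF X open_V subset_UNIV] ev_vect_zero[OF X open_V subset_UNIV] by (simp add: coframe_Q)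
  then show "connection X Q W f = vzero M UNIV W f"
    unfolding vzero_apply[OF W subset_UNIV f]
    by (intro determiningD[OF determining_UNIV W order_refl])
      (simp_all add: spec sec_zero_one W connection_ev_def)
qed

lemma connection_affine: "affine_connection M connection"
  unfolding affine_connection_def
  by (simp add: connection_vect connection_hom connection_vadd_left connection_vadd_right
      connection_vscale_left connection_vscale_right)

end

section \<open>Shander charts and the assembly of the atlas\<close>

context superatlas
begin

text \<open>Q(tau) = d/dtau (tau) + tau d/dt (tau) = 1 + tau * 0, because the coefficients of tau in
  coordinates are the constants 0 and 1.\<close>

lemma shander_field_theta:
  assumes Q: "vext M (V j) Q = vadd M (V j) (d_odd 1 M (V j) (\<phi> j) (\<Phi> j) 0)
      (vscale M (V j) (theta j) (coord_vf j k))"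
  shows "Q (V j) (theta j) = \<one>\<^bsub>sections M (V j)\<^esub>"
proof -
  let ?U = "\<phi> j ` V j"
  note W = open_V order_refl and t = theta_sec[of j]
  note o = open_chart_image[OF W, of j]
  have "model_deriv_odd 0 ?U (loc j (V j) (theta j)) = \<one>\<^bsub>model_sections 1 ?U\<^esub>"
    unfolding loc_theta by (auto simp: model_deriv_odd_def model1_def model_sections_def intro!: ext)
  then have odd: "d_odd 1 M (V j) (\<phi> j) (\<Phi> j) 0 (V j) (theta j) = \<one>\<^bsub>sections M (V j)\<^esub>"
    using ring_hom_one[OF superalgebra_homD(1)[OF chart_hom[OF W]]] vext_apply[OF W t]
    by (simp add: d_odd_def chart_deriv_def loc_def)
  have even: "ev j m (V j) (coord_vf j k (V j) (theta j)) = 0" if m: "m \<in> V j" for m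
  proof -
    have "partial_deriv k (loc j (V j) (theta j) S) (\<phi> j m) = partial_deriv k (\<lambda>_. if S = {0} then 1 else 0) (\<phi> j m)" for S
      by (rule partial_deriv_cong[OF o])
        (use m loc_differentiable[OF W t m] in \<open>auto simp: loc_theta model1_def\<close>)
    then show ?thesis
      by (simp add: ev_coord_vf[OF W t m] partial_deriv_const zero_dual_def)
  qed
  have Qt: "Q (V j) (theta j) = \<one>\<^bsub>sections M (V j)\<^esub> \<oplus>\<^bsub>sections M (V j)\<^esub>
      (theta j \<otimes>\<^bsub>sections M (V j)\<^esub> coord_vf j k (V j) (theta j))"
    using fun_cong[OF fun_cong[OF Q, of "V j"], of "theta j"]
    by (simp add: vext_apply[OF W t] vadd_apply[OF W t] vscale_apply[OF W t] odd res_id[OF open_V t])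
  show ?thesis
  proof (rule sec_eq_chartI[OF W])
    fix m assume m: "m \<in> V j"
    show "ev j m (V j) (Q (V j) (theta j)) = ev j m (V j) \<one>\<^bsub>sections M (V j)\<^esub>"
      using t coord_vf_sec[OF W t] unfolding Qt
      by (simp add: ev_add ev_mult sec_closed sec_zero_one even[OF m])
  qed (use t coord_vf_sec[OF W t] in \<open>simp_all add: Qt sec_closed sec_zero_one\<close>)
qed

end

theorem theorem2p1:
  fixes M :: "('a::{t2_space,second_countable_topology}, 's) superspace"
    and g :: "('a, 's) pairing"
    and Q P :: "('a, 's) vfield"
  assumes "super_null_riemannian TYPE('n::finite) M g Q P"
  shows "\<exists>D. affine_connection M D \<and> (\<forall>X\<in>Vect M. D X Q = vzero M UNIV)"
proof -
  have sheaf: "superalgebra_sheaf M" and Q: "Q \<in> vect_hom M UNIV 1"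
    and shander: "\<forall>m. \<exists>V (\<phi> :: 'a \<Rightarrow> real^'n) \<Phi> k. m \<in> V \<and> shander_chart M Q P V \<phi> \<Phi> k"
    using assms unfolding super_null_riemannian_def supermanifold_def by blast+
  obtain V \<phi> \<Phi> k where ch: "\<And>m. m \<in> V m" "\<And>m. shander_chart M Q P (V m) (\<phi> m :: 'a \<Rightarrow> real^'n) (\<Phi> m) (k m)"
    using shander by metis
  have sc: "superchart 1 M (V m) (\<phi> m) (\<Phi> m)" for m
    using ch(2) unfolding shander_chart_def by blast
  have "\<exists>\<epsilon>>0. cball (\<phi> m m) (2 * \<epsilon>) \<subseteq> \<phi> m ` V m" for m
  proof -
    have "open (\<phi> m ` V m)" "\<phi> m m \<in> \<phi> m ` V m" using superchartD(2)[OF sc] ch(1) by auto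
    then obtain e where "e > 0" "cball (\<phi> m m) e \<subseteq> \<phi> m ` V m" using open_contains_cball by blast
    \<comment> \<open>Halving the radius makes the ball of radius \<open>2 * \<epsilon>\<close> fit
      into the chart image, as \<open>bump_atlas\<close> requires.\<close>
    then show ?thesis by (intro exI[of _ "e / 2"]) simp
  qed
  then obtain \<epsilon> where \<epsilon>: "\<And>m. \<epsilon> m > 0" "\<And>m. cball (\<phi> m m) (2 * \<epsilon> m) \<subseteq> \<phi> m ` V m"
    by metis
  define B where "B m = {m'\<in>V m. \<phi> m m' \<in> ball (\<phi> m m) (\<epsilon> m)}" for m
  have oB: "open (B m)" for m
  proof -
    have "continuous_on (V m) (\<phi> m)"
      using superchartD(3)[OF sc] homeomorphism_cont1 by blast
    from continuous_open_preimage[OF this superchartD(1)[OF sc] open_ball, of "\<phi> m m" "\<epsilon> m"]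
    show ?thesis unfolding B_def vimage_def Int_def by simp
  qed
  have mB: "m \<in> B m" for m using ch(1) \<epsilon>(1) by (simp add: B_def)
  \<comment> \<open>There is one chart for each point; second countability leaves countably many
    whose cores B still cover.\<close>
  obtain \<F> where \<F>: "\<F> \<subseteq> range B" "countable \<F>" "\<Union>\<F> = \<Union>(range B)"
    using Lindelof[of "range B"] oB by blast
  obtain C where C: "countable C" "B ` C = \<F>"
    using \<F>(1,2) countable_subset_image[of \<F> B UNIV] by blast
  have UC: "(\<Union>m\<in>C. B m) = UNIV" using C(2) \<F>(3) mB by blast
  \<comment> \<open>The space is nonempty, being a type, so C is a nonempty countable set and hence
    the range of a sequence, possibly with repetitions.\<close>
  then have "C \<noteq> {}" by auto
  then obtain c :: "nat \<Rightarrow> 'a" where c: "range c = C"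
    using C(1) uncountable_def by blast
  interpret superatlas M "\<lambda>j. V (c j)" "\<lambda>j. \<phi> (c j)" "\<lambda>j. \<Phi> (c j)"
  proof
    have "(\<Union>j. B (c j)) = UNIV" using UC unfolding c[symmetric] by blast
    then show "(\<Union>j. V (c j)) = UNIV" unfolding B_def by blast
  qed (use sheaf sc in auto)
  interpret odd_field_atlas M "\<lambda>j. V (c j)" "\<lambda>j. \<phi> (c j)" "\<lambda>j. \<Phi> (c j)" "\<lambda>j. \<phi> (c j) (c j)" "\<lambda>j. \<epsilon> (c j)" Q
  proof unfold_locales
    have "(\<Union>j. B (c j)) = UNIV" using UC unfolding c[symmetric] by blast
    then show "(\<Union>j. {m \<in> V (c j). \<phi> (c j) m \<in> ball (\<phi> (c j) (c j)) (\<epsilon> (c j))}) = UNIV"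
      unfolding B_def .
    show "Q (V (c j)) (theta j) = \<one>\<^bsub>sections M (V (c j))\<^esub>" for j
      by (rule shander_field_theta) (use ch(2)[of "c j"] in \<open>simp add: shander_chart_def\<close>)
  qed (use \<epsilon> Q in auto)
  show ?thesis using connection_affine connection_Q by blast
qed

end
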